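(* Let $(X,\mathcal{F})$ be a dual pair of Banach spaces having the Krein property and such that the pair $(\mathcal{F},X)$ also has the Krein property. Let $U=\{U_t\}_{t\in\mathbb{R}}$ be a $\sigma(X,\mathcal{F})$-continuous one-parameter group of isometries in $B_{\mathcal{F}}(X)$ and let $U_i$ be its analytic generator. Let $\Delta$ be the ampliation of $U_i$ onto $\mathrm{Graph}(U_i)$, $\Delta=\begin{pmatrix}U_i&0\\ 0&U_i\end{pmatrix}$, regarded as an operator in the Banach space $\mathrm{Graph}(U_i)$. Then $$\mathrm{Sp}\,\Delta\subset[0,\infty).$$ Moreover, for every $\mu\in\mathbb{C}\setminus(-\infty,0]$ the resolvent of $\Delta$ at $-\mu$, i.e. $(\Delta+\mu I)^{-1}$, is the restriction to $\mathrm{Graph}(U_i)$ of the operator $$\begin{pmatrix}-Q_\mu+\frac1\mu I&-\frac1\mu Q_\mu\\ \mu Q_\mu&Q_\mu\end{pmatrix}$$ on $X\times X$ (which leaves $\mathrm{Graph}(U_i)$ invariant), where $Q_\mu=\int_{-\infty}^{+\infty}F_\mu(t)U_t\,dt\in B_{\mathcal{F}}(X)$ and $F_\mu(t)=\frac1{2\pi}\int_{-\infty}^{+\infty}\frac{e^{E(1+it)}}{(e^E+\mu)^2}\,dE=\frac{t\,\mu^{it-1}}{e^{\pi t}-e^{-\pi t}}$.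
   Context: All Banach spaces are complex. A dual pair of Banach spaces $(X,\mathcal{F})$ consists of Banach spaces $X,\mathcal{F}$ with a bilinear pairing $\langle\cdot,\cdot\rangle:X\times\mathcal{F}\to\mathbb{C}$ such that $\|x\|=\sup\{|\langle x,\phi\rangle|:\phi\in\mathcal{F},\|\phi\|\le1\}$ for $x\in X$ and $\|\phi\|=\sup\{|\langle x,\phi\rangle|:x\in X,\|x\|\le1\}$ for $\phi\in\mathcal{F}$. The symbol $\sigma(X,\mathcal{F})$ denotes the weak topology on $X$ given by the pairing with $\mathcal{F}$, and also the product of such topologies on $X\times X$. The pair $(X,\mathcal{F})$ has the Krein property if the $\sigma(X,\mathcal{F})$-closed convex hull of every $\sigma(X,\mathcal{F})$-compact subset of $X$ is $\sigma(X,\mathcal{F})$-compact; the Krein property of $(\mathcal{F},X)$ is defined in the same way with the roles exchanged. $B_{\mathcal{F}}(X)\subset B(X)$ is the space of $\sigma(X,\mathcal{F})$-continuous linear maps $X\to X$. The group $U$ being $\sigma(X,\mathcal{F})$-continuous means that $t\mapsto U_tx$ is $\sigma(X,\mathcal{F})$-continuous for each $x\in X$. The analytic generator $U_i$ of $U$ is the $\sigma(X,\mathcal{F})$-closed linear operator in $X$ defined by: $\begin{pmatrix}x\\ y\end{pmatrix}\in\mathrm{Graph}(U_i)$ (i.e. $x\in D(U_i)$ and $U_ix=y$) if and only if there is a $\sigma(X,\mathcal{F})$-continuous function $F_x:\{w\in\mathbb{C}:0\le\mathrm{Im}\,w\le1\}\to X$, holomorphic in the interior of the strip, with $F_x(t)=U_tx$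 for all $t\in\mathbb{R}$ and $F_x(i)=y$. $\mathrm{Graph}(U_i)$ is a closed subspace of $X\times X$ and is regarded as a Banach space with the norm inherited from $X\times X$. The ampliation $\Delta$ of $U_i$ onto its graph is the operator in $\mathrm{Graph}(U_i)$ given, for $\begin{pmatrix}x\\ x'\end{pmatrix},\begin{pmatrix}y\\ y'\end{pmatrix}\in\mathrm{Graph}(U_i)$, by: $\begin{pmatrix}x\\ x'\end{pmatrix}\in D(\Delta)$ and $\Delta\begin{pmatrix}x\\ x'\end{pmatrix}=\begin{pmatrix}y\\ y'\end{pmatrix}$ if and only if $x,x'\in D(U_i)$, $y=U_ix$ and $y'=U_ix'$. $\mathrm{Sp}\,\Delta$ is the spectrum of $\Delta$ as an operator in $\mathrm{Graph}(U_i)$. Powers $\mu^{it-1}$ are taken with the principal branch of the logarithm on $\mathbb{C}\setminus(-\infty,0]$, and the closed formula for $F_\mu$ is extended by continuity at $t=0$; $F_\mu$ is integrable on $\mathbb{R}$. The integral $Q_\mu=\int F_\mu(t)U_t\,dt$ is the operator with $\langle Q_\mu x,\phi\rangle=\int_{-\infty}^{+\infty}F_\mu(t)\langle U_tx,\phi\rangle\,dt$ for $x\in X$, $\phi\in\mathcal{F}$. *)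

theory Defs
  imports "HOL-Analysis.Analysis"
begin

class complex_normed_vector = real_normed_vector +
  fixes scaleC :: "complex \<Rightarrow> 'a \<Rightarrow> 'a"  (infixr "*\<^sub>C" 75)
  assumes scaleC_add_right: "a *\<^sub>C (x + y) = a *\<^sub>C x + a *\<^sub>C y"
    and scaleC_add_left: "(a + b) *\<^sub>C x = a *\<^sub>C x + b *\<^sub>C x"
    and scaleC_scaleC: "a *\<^sub>C (b *\<^sub>C x) = (a * b) *\<^sub>C x"
    and scaleR_scaleC: "r *\<^sub>R x = complex_of_real r *\<^sub>C x"
    and norm_scaleC: "norm (a *\<^sub>C x) = cmod a * norm x"

class complex_banach = complex_normed_vector + banach

lemma scaleC_one: "1 *\<^sub>C x = (x :: 'a::complex_normed_vector)"
  using scaleR_scaleC[of 1 x] by simp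

lemma vector_space_scaleC:
  "vector_space (scaleC :: complex \<Rightarrow> 'a \<Rightarrow> 'a::complex_normed_vector)"
  by unfold_locales
    (simp_all add: scaleC_add_right scaleC_add_left scaleC_scaleC scaleC_one)

instantiation complex :: complex_banach
begin

definition scaleC_complex :: "complex \<Rightarrow> complex \<Rightarrow> complex" where
  "scaleC_complex a x = a * x"

instance
  by standard
    (simp_all add: scaleC_complex_def algebra_simps scaleR_conv_of_real norm_mult)

end

instantiation prod :: (complex_normed_vector, complex_normed_vector) complex_normed_vector
begin

definition scaleC_prod :: "complex \<Rightarrow> 'a \<times> 'b \<Rightarrow> 'a \<times> 'b" where
  "scaleC_prod a u = (a *\<^sub>C fst u, a *\<^sub>C snd u)"

instance
proof
  fix a b :: complex and r :: real and x y :: "'a \<times> 'b"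
  show "a *\<^sub>C (x + y) = a *\<^sub>C x + a *\<^sub>C y"
    by (simp add: scaleC_prod_def scaleC_add_right)
  show "(a + b) *\<^sub>C x = a *\<^sub>C x + b *\<^sub>C x"
    by (simp add: scaleC_prod_def scaleC_add_left)
  show "a *\<^sub>C (b *\<^sub>C x) = (a * b) *\<^sub>C x"
    by (simp add: scaleC_prod_def scaleC_scaleC)
  show "r *\<^sub>R x = complex_of_real r *\<^sub>C x"
    by (simp add: scaleC_prod_def scaleR_scaleC prod_eq_iff)
  show "norm (a *\<^sub>C x) = cmod a * norm x"
    by (simp add: scaleC_prod_def norm_prod_def norm_scaleC power_mult_distrib
        real_sqrt_mult flip: distrib_left)
qed

end

instance prod :: (complex_banach, complex_banach) complex_banach ..

abbreviation clinear ::
  "('a::complex_normed_vector \<Rightarrow> 'b::complex_normed_vector) \<Rightarrow> bool" where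
  "clinear \<equiv> Vector_Spaces.linear scaleC scaleC"

text \<open>
  The \<^const>\<open>bdd_above\<close> conditions say that the suprema are finite; they are needed because
  \<^const>\<open>Sup\<close> on the reals is unspecified for unbounded sets.
\<close>

locale dual_pair =
  fixes p :: "'x::complex_banach \<Rightarrow> 'f::complex_banach \<Rightarrow> complex"
  assumes clinear_left: "clinear (\<lambda>x. p x \<phi>)"
    and clinear_right: "clinear (p x)"
    and bdd_left: "bdd_above ((\<lambda>\<phi>. cmod (p x \<phi>)) ` {\<phi>. norm \<phi> \<le> 1})"
    and norm_left: "norm x = (SUP \<phi>\<in>{\<phi>. norm \<phi> \<le> 1}. cmod (p x \<phi>))"
    and bdd_right: "bdd_above ((\<lambda>x. cmod (p x \<phi>)) ` {x. norm x \<le> 1})"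
    and norm_right: "norm \<phi> = (SUP x\<in>{x. norm x \<le> 1}. cmod (p x \<phi>))"

text \<open>
  \<open>sigma p\<close> is the weak topology on the first argument of \<open>p\<close>; the weak topology on the second
  argument is obtained from the flipped pairing \<open>\<lambda>\<phi> x. p x \<phi>\<close>, and likewise for
  \<open>krein_property\<close>.
\<close>

definition sigma :: "('x \<Rightarrow> 'f \<Rightarrow> complex) \<Rightarrow> 'x topology" where
  "sigma p = topology_generated_by {{x. p x \<phi> \<in> W} |\<phi> W. open W}"

definition krein_property :: "('x::complex_banach \<Rightarrow> 'f \<Rightarrow> complex) \<Rightarrow> bool" where
  "krein_property p \<longleftrightarrow>
     (\<forall>K. compactin (sigma p) K \<longrightarrow> compactin (sigma p) (sigma p closure_of (convex hull K)))"

definition B_sigma :: "('x::complex_banach \<Rightarrow> 'f \<Rightarrow> complex) \<Rightarrow> ('x \<Rightarrow> 'x) set" where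
  "B_sigma p = {T. clinear T \<and> bounded_linear T \<and> continuous_map (sigma p) (sigma p) T}"

locale sigma_isometry_group =
  fixes p :: "'x::complex_banach \<Rightarrow> 'f::complex_banach \<Rightarrow> complex"
    and U :: "real \<Rightarrow> 'x \<Rightarrow> 'x"
  assumes zero: "U 0 = id"
    and add: "U (s + t) = U s \<circ> U t"
    and in_B_sigma: "U t \<in> B_sigma p"
    and isometry: "norm (U t x) = norm x"
    and sigma_continuous: "continuous_map euclidean (sigma p) (\<lambda>t. U t x)"

text \<open>
  Unbounded operators are represented by their graphs.

  In the following definition holomorphy is complex differentiability with respect to the norm:
  the Frechet derivative is multiplication by a complex scalar. The values of \<open>F\<close> outside the
  closed strip are irrelevant.
\<close>

definition analytic_generator ::
  "('x::complex_banach \<Rightarrow> 'f \<Rightarrow> complex) \<Rightarrow> (real \<Rightarrow> 'x \<Rightarrow> 'x) \<Rightarrow> ('x \<times> 'x) set" where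
  "analytic_generator p U = {(x, y). \<exists>F :: complex \<Rightarrow> 'x.
     continuous_map (top_of_set {w. 0 \<le> Im w \<and> Im w \<le> 1}) (sigma p) F \<and>
     (\<forall>w. 0 < Im w \<and> Im w < 1 \<longrightarrow> (\<exists>D. (F has_derivative (\<lambda>h. h *\<^sub>C D)) (at w))) \<and>
     (\<forall>t. F (complex_of_real t) = U t x) \<and>
     F \<i> = y}"

definition ampliation :: "('x \<times> 'x) set \<Rightarrow> (('x \<times> 'x) \<times> ('x \<times> 'x)) set" where
  "ampliation G = {((x, x'), (y, y')).
     (x, x') \<in> G \<and> (y, y') \<in> G \<and> (x, y) \<in> G \<and> (x', y') \<in> G}"

text \<open>
  The relation \<open>A - z I\<close> for an operator \<open>A\<close> given by its graph. \<open>is_resolvent Y A z R\<close> says that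
  on the subspace \<open>Y\<close> the map \<open>R\<close> is the everywhere defined bounded inverse of \<open>A - z I\<close>, where
  \<open>A\<close> is an operator in \<open>Y\<close>; the values of \<open>R\<close> outside \<open>Y\<close> are irrelevant.
\<close>

definition minus_scalar ::
  "('a::complex_normed_vector \<times> 'a) set \<Rightarrow> complex \<Rightarrow> ('a \<times> 'a) set" where
  "minus_scalar A z = {(v, w - z *\<^sub>C v) |v w. (v, w) \<in> A}"

definition is_resolvent ::
  "'a::complex_normed_vector set \<Rightarrow> ('a \<times> 'a) set \<Rightarrow> complex \<Rightarrow> ('a \<Rightarrow> 'a) \<Rightarrow> bool" where
  "is_resolvent Y A z R \<longleftrightarrow>
     (minus_scalar A z)\<inverse> = {(u, R u) |u. u \<in> Y} \<and>
     R ` Y \<subseteq> Y \<and>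
     (\<forall>u\<in>Y. \<forall>v\<in>Y. R (u + v) = R u + R v) \<and>
     (\<forall>c. \<forall>u\<in>Y. R (c *\<^sub>C u) = c *\<^sub>C R u) \<and>
     (\<exists>K. \<forall>u\<in>Y. norm (R u) \<le> K * norm u)"

definition spectrum :: "'a::complex_normed_vector set \<Rightarrow> ('a \<times> 'a) set \<Rightarrow> complex set" where
  "spectrum Y A = {z. \<nexists>R. is_resolvent Y A z R}"

definition F_kernel :: "complex \<Rightarrow> real \<Rightarrow> complex" where
  "F_kernel \<mu> t = 1 / (2 * pi) *
     (LINT E|lborel. exp (complex_of_real E * (1 + \<i> * complex_of_real t)) /
        (exp (complex_of_real E) + \<mu>)\<^sup>2)"

text \<open>At \<open>t = 0\<close> the quotient is \<open>0 / 0\<close>, so only its limit there is meaningful.\<close>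

definition F_closed :: "complex \<Rightarrow> real \<Rightarrow> complex" where
  "F_closed \<mu> t = complex_of_real t * \<mu> powr (\<i> * complex_of_real t - 1) /
     complex_of_real (exp (pi * t) - exp (- pi * t))"

text \<open>
  The integral \<open>\<integral> f(t) U\<^sub>t dt\<close> in the weak sense. The defining element is unique for a dual pair
  because the pairing separates points; its existence is part of the results, not of the definition.
\<close>

definition sigma_integral ::
  "('x \<Rightarrow> 'f \<Rightarrow> complex) \<Rightarrow> (real \<Rightarrow> complex) \<Rightarrow> (real \<Rightarrow> 'x \<Rightarrow> 'x) \<Rightarrow> 'x \<Rightarrow> 'x" where
  "sigma_integral p f U x = (THE y. \<forall>\<phi>. p y \<phi> = (LINT t|lborel. f t * p (U t x) \<phi>))"

definition block_op ::
  "('x \<Rightarrow> 'x) \<Rightarrow> ('x \<Rightarrow> 'x) \<Rightarrow> ('x \<Rightarrow> 'x) \<Rightarrow> ('x \<Rightarrow> 'x) \<Rightarrow> 'x \<times> 'x \<Rightarrow> 'x \<times> 'x::plus" where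
  "block_op A B C D = (\<lambda>(x, y). (A x + B y, C x + D y))"

end

theory Submission
  imports Defs "HOL-Complex_Analysis.Complex_Analysis"
begin

text \<open>
  Formally \<open>Q\<^sub>\<mu> = U\<^sub>i / (U\<^sub>i + \<mu>)\<^sup>2\<close>, and the theorem amounts to two facts: \<open>U\<^sub>i + \<mu>\<close> is injective,
  and for \<open>(x, x')\<close> in the graph of \<open>U\<^sub>i\<close> the vector \<open>R = x / \<mu> - Q\<^sub>\<mu> x - Q\<^sub>\<mu> x' / \<mu>\<close>, which is
  \<open>(U\<^sub>i + \<mu>)\<inverse> x\<close>, lies in the domain with \<open>U\<^sub>i R = \<mu> Q\<^sub>\<mu> x + Q\<^sub>\<mu> x'\<close>. The kernel \<open>F\<^sub>\<mu>\<close> extends to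
  \<open>\<mu> powr (i w - 1) \<Gamma>(1 + i w) \<Gamma>(1 - i w) / (2 \<pi>)\<close>, which is holomorphic and exponentially decaying
  on \<open>\<bar>Im w\<bar> < 1\<close> and satisfies \<open>F\<^sub>\<mu>(w) + \<mu> F\<^sub>\<mu>(w + i) = F\<^sub>\<mu>(w) / (i w)\<close>. Hence a bounded holomorphic
  function \<open>f\<close> on the strip \<open>0 < Im z < 1\<close> is reproduced by Cauchy's formula with kernel
  \<open>F\<^sub>\<mu>(s - z) / (s - z)\<close>: writing \<open>J\<^sub>k(z) = \<integral> F\<^sub>\<mu>(s - z) f(s + k i) ds\<close>,
  \<open>f(z) = \<mu> (J\<^sub>0(z) + \<mu> J\<^sub>0(z - i)) + (J\<^sub>1(z) + \<mu> J\<^sub>1(z - i))\<close>.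
  If \<open>U\<^sub>i y = - \<mu> y\<close>, the right-hand side vanishes for \<open>f(z) = \<langle>U\<^sub>z y, \<phi>\<rangle>\<close>, which gives injectivity.
  For general \<open>x\<close> it says \<open>f / \<mu> - J\<^sub>0 - J\<^sub>1 / \<mu> = \<mu> J\<^sub>0(\<cdot> - i) + J\<^sub>1(\<cdot> - i)\<close>; the left-hand side
  is continuous up to the lower boundary of the strip and the right-hand side up to the upper one, so
  that together they give the extension of \<open>t \<mapsto> U\<^sub>t R\<close>. The Krein properties enter only through the
  existence of weak integrals in \<open>X\<close> and of their transposes in \<open>\<F>\<close>.
\<close>

section \<open>Dual pairs and their weak topologies\<close>

lemma clinearD:
  assumes "clinear f"
  shows "f (x + y) = f x + f y" "f (a *\<^sub>C x) = a *\<^sub>C f x"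
  using assms by (auto simp: Vector_Spaces.linear_iff)

lemma clinearI:
  assumes "\<And>x y. f (x + y) = f x + f y" "\<And>a x. f (a *\<^sub>C x) = a *\<^sub>C f x"
  shows "clinear f"
  using assms by (simp add: Vector_Spaces.linear_iff vector_space_scaleC)

lemma scaleC_zero_right [simp]: "a *\<^sub>C (0::'a::complex_normed_vector) = 0"
  using scaleC_add_right[of a 0 "0::'a"] by simp

lemma scaleC_zero_left [simp]: "0 *\<^sub>C (x::'a::complex_normed_vector) = 0"
  using scaleC_add_left[of 0 0 x] by simp

lemma scaleC_minus_right: "a *\<^sub>C (- x) = - (a *\<^sub>C (x::'a::complex_normed_vector))"
  using scaleC_add_right[of a x "- x"] by (simp add: eq_neg_iff_add_eq_0 add.commute)

lemma scaleC_minus_left: "(- a) *\<^sub>C x = - (a *\<^sub>C (x::'a::complex_normed_vector))"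
  using scaleC_add_left[of a "- a" x] by (simp add: eq_neg_iff_add_eq_0 add.commute)

lemma scaleC_diff_right: "a *\<^sub>C (x - y) = a *\<^sub>C x - a *\<^sub>C (y::'a::complex_normed_vector)"
  using scaleC_add_right[of a x "- y"] by (simp add: scaleC_minus_right)

lemma bounded_linear_scaleC_right: "bounded_linear (\<lambda>x::'a::complex_normed_vector. a *\<^sub>C x)"
proof (rule bounded_linear_intro[where K = "cmod a"])
  fix x y :: 'a and r
  show "a *\<^sub>C (x + y) = a *\<^sub>C x + a *\<^sub>C y" by (rule scaleC_add_right)
  show "a *\<^sub>C (r *\<^sub>R x) = r *\<^sub>R (a *\<^sub>C x)"
    by (simp add: scaleR_scaleC scaleC_scaleC mult.commute)
  show "norm (a *\<^sub>C x) \<le> norm x * cmod a" by (simp add: norm_scaleC)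
qed

lemma bounded_linear_scaleC_left: "bounded_linear (\<lambda>a. a *\<^sub>C (x::'a::complex_normed_vector))"
proof (rule bounded_linear_intro[where K = "norm x"])
  fix a b :: complex and r
  show "(a + b) *\<^sub>C x = a *\<^sub>C x + b *\<^sub>C x" by (rule scaleC_add_left)
  show "(r *\<^sub>R a) *\<^sub>C x = r *\<^sub>R (a *\<^sub>C x)"
    by (simp add: scaleR_scaleC scaleC_scaleC scaleC_complex_def)
  show "norm (a *\<^sub>C x) \<le> norm a * norm x" by (simp add: norm_scaleC)
qed

section \<open>The weak topology as an initial topology\<close>

lemma topspace_sigma [simp]: "topspace (sigma p) = UNIV"
proof -
  have "x \<in> \<Union> {{x. p x \<phi> \<in> W} |\<phi> W. open W}" for x
    by (auto intro!: exI[of _ UNIV])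
  then show ?thesis
    unfolding sigma_def topology_generated_by_topspace by blast
qed

lemma openin_sigma_basic: "open W \<Longrightarrow> openin (sigma p) {x. p x \<phi> \<in> W}"
  unfolding sigma_def by (rule topology_generated_by_Basis) auto

lemma continuous_map_sigma_iff:
  "continuous_map X (sigma p) g \<longleftrightarrow> (\<forall>\<phi>. continuous_map X euclidean (\<lambda>t. p (g t) \<phi>))"
proof -
  have U: "\<Union> {{x. p x \<phi> \<in> W} |\<phi> W. open W} = UNIV"
    using topspace_sigma[of p] unfolding sigma_def topology_generated_by_topspace .
  have eq: "g -` {x. p x \<phi> \<in> W} \<inter> topspace X = {x \<in> topspace X. p (g x) \<phi> \<in> W}" for \<phi> W
    by auto
  have "continuous_map X (sigma p) g \<longleftrightarrow>
      (\<forall>\<phi> W. open W \<longrightarrow> openin X (g -` {x. p x \<phi> \<in> W} \<inter> topspace X))"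
    unfolding sigma_def continuous_on_generated_topo_iff U by blast
  then show ?thesis
    unfolding eq continuous_map_def by simp
qed

text \<open>Induction over how the open set is generated: an intersection merges the finite sets of
  functionals and takes the smaller radius, a union inherits the data of a member containing
  \<open>x\<close>.\<close>

lemma sigma_neighbourhood_base:
  assumes "openin (sigma p) S" "x \<in> S"
  shows "\<exists>\<Phi> e. finite \<Phi> \<and> 0 < e \<and> (\<forall>y. (\<forall>\<phi>\<in>\<Phi>. cmod (p y \<phi> - p x \<phi>) < e) \<longrightarrow> y \<in> S)"
proof -
  have "generate_topology_on {{x. p x \<phi> \<in> W} |\<phi> W. open W} S"
    using assms(1) unfolding sigma_def by (rule openin_topology_generated_by)
  then show ?thesis using assms(2)
  proof induction
    case Empty
    then show ?case by simp
  next
    case (Int a b)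
    from Int.IH(1) Int.prems obtain A d where "finite A" "0 < d" and
      a: "\<And>y. (\<forall>\<phi>\<in>A. cmod (p y \<phi> - p x \<phi>) < d) \<Longrightarrow> y \<in> a" by blast
    moreover from Int.IH(2) Int.prems obtain B e where "finite B" "0 < e" and
      b: "\<And>y. (\<forall>\<phi>\<in>B. cmod (p y \<phi> - p x \<phi>) < e) \<Longrightarrow> y \<in> b" by blast
    ultimately show ?case
      by (intro exI[of _ "A \<union> B"] exI[of _ "min d e"]) auto
  next
    case (UN K)
    then obtain k where k: "k \<in> K" "x \<in> k" by blast
    from UN.IH[OF k] obtain \<Phi> e where "finite \<Phi>" "0 < e"
      "\<And>y. (\<forall>\<phi>\<in>\<Phi>. cmod (p y \<phi> - p x \<phi>) < e) \<Longrightarrow> y \<in> k" by blast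
    with k(1) show ?case by blast
  next
    case (Basis s)
    then obtain \<phi> W where s: "s = {x. p x \<phi> \<in> W}" "open W" by blast
    then obtain e where "e > 0" "ball (p x \<phi>) e \<subseteq> W"
      using Basis by (auto simp: open_contains_ball)
    then show ?case
      by (intro exI[of _ "{\<phi>}"] exI[of _ e]) (auto simp: s dist_norm norm_minus_commute)
  qed
qed

text \<open>The induction removes one functional at a time: \<open>f\<close> minus a suitable
  multiple of the pairing with \<open>\<phi>\<close> vanishes already on the joint kernel of the
  remaining ones. So \<open>f\<close> is a linear combination of pairings, hence itself a
  pairing.\<close>

lemma functional_in_span:
  fixes p :: "'x::complex_banach \<Rightarrow> 'f::complex_banach \<Rightarrow> complex"
  assumes "finite \<Phi>" and p: "\<And>\<phi>. clinear (\<lambda>x. p x \<phi>)" and pr: "\<And>x. clinear (p x)"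
    and "clinear f" "\<And>x. (\<forall>\<phi>\<in>\<Phi>. p x \<phi> = 0) \<Longrightarrow> f x = 0"
  shows "\<exists>\<psi>. \<forall>x. f x = p x \<psi>"
  using assms(1,4,5)
proof (induction \<Phi> arbitrary: f)
  case empty
  have "p x 0 = 0" for x
    using clinearD(2)[OF pr, of x 0 0] by (simp add: scaleC_complex_def)
  with empty show ?case by (intro exI[of _ 0]) simp
next
  case (insert \<phi> \<Phi>)
  show ?case
  proof (cases "\<exists>u. (\<forall>\<phi>\<in>\<Phi>. p u \<phi> = 0) \<and> p u \<phi> \<noteq> 0")
    case False
    then have "\<And>x. \<forall>\<phi>\<in>\<Phi>. p x \<phi> = 0 \<Longrightarrow> f x = 0"
      by (intro insert.prems(2)) auto
    then show ?thesis by (intro insert.IH insert.prems(1))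
  next
    case True
    then obtain u where u: "\<forall>\<phi>\<in>\<Phi>. p u \<phi> = 0" "p u \<phi> \<noteq> 0" by blast
    \<comment> \<open>\<open>c\<close> makes \<open>g u = 0\<close>. Any \<open>x\<close> killed by
      \<open>\<Phi>\<close> can be moved along \<open>u\<close> into the kernel of
      \<open>\<phi>\<close> as well, where \<open>f\<close> vanishes, so \<open>g x = 0\<close>
      follows.\<close>
    define c where "c = f u / p u \<phi>"
    define g where "g = (\<lambda>x. f x - c * p x \<phi>)"
    have g: "clinear g"
      unfolding g_def using clinearD[OF insert.prems(1)] clinearD[OF p[of \<phi>]]
      by (intro clinearI) (auto simp: algebra_simps scaleC_complex_def)
    have "g x = 0" if "\<forall>\<phi>\<in>\<Phi>. p x \<phi> = 0" for x
    proof -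
      define a where "a = p x \<phi> / p u \<phi>"
      have px: "p (x + (- a) *\<^sub>C u) \<psi> = p x \<psi> - a * p u \<psi>" for \<psi>
        using clinearD[OF p[of \<psi>]] by (simp add: scaleC_complex_def)
      have "f (x + (- a) *\<^sub>C u) = 0"
        using that u by (intro insert.prems(2)) (simp add: px, simp add: a_def)
      then show ?thesis
        using clinearD[OF insert.prems(1)] u
        by (simp add: g_def c_def a_def scaleC_complex_def field_simps)
    qed
    from insert.IH[OF g this] obtain \<psi> where \<psi>: "\<And>x. g x = p x \<psi>" by blast
    have "f x = p x (\<psi> + c *\<^sub>C \<phi>)" for x
      using \<psi>[of x] clinearD[OF pr[of x]] by (simp add: g_def scaleC_complex_def algebra_simps)
    then show ?thesis by blast
  qed
qed

section \<open>Functionals, transposes and uniform boundedness in a dual pair\<close>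

context dual_pair
begin

lemma left_simps:
  "p (x + y) \<phi> = p x \<phi> + p y \<phi>" "p (a *\<^sub>C x) \<phi> = a * p x \<phi>"
  "p 0 \<phi> = 0" "p (- x) \<phi> = - p x \<phi>" "p (x - y) \<phi> = p x \<phi> - p y \<phi>" "p (r *\<^sub>R x) \<phi> = r * p x \<phi>"
proof -
  note c = clinearD[OF clinear_left[of \<phi>]]
  show add: "p (x + y) \<phi> = p x \<phi> + p y \<phi>" for x y using c by simp
  show s: "p (a *\<^sub>C x) \<phi> = a * p x \<phi>" for a using c by (simp add: scaleC_complex_def)
  show 0: "p 0 \<phi> = 0" using add[of 0 0] by simp
  show m: "p (- x) \<phi> = - p x \<phi>" for x using add[of x "- x"] 0 by (simp add: eq_neg_iff_add_eq_0 add.commute)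
  show "p (x - y) \<phi> = p x \<phi> - p y \<phi>" using add[of x "- y"] m by simp
  show "p (r *\<^sub>R x) \<phi> = r * p x \<phi>" by (simp add: scaleR_scaleC s)
qed

lemma sum_left: "p (\<Sum>i\<in>I. x i) \<phi> = (\<Sum>i\<in>I. p (x i) \<phi>)"
  by (induction I rule: infinite_finite_induct) (auto simp: left_simps)

lemma flip: "dual_pair (\<lambda>\<phi> x. p x \<phi>)"
  unfolding dual_pair_def
  by (intro conjI allI) (rule clinear_right clinear_left bdd_right bdd_left norm_right norm_left)+

lemma norm_leI:
  assumes "\<And>\<phi>. norm \<phi> \<le> 1 \<Longrightarrow> cmod (p x \<phi>) \<le> B"
  shows "norm x \<le> B"
  unfolding norm_left using assms by (intro cSUP_least) (auto intro: exI[of _ 0])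

lemma eqI: "(\<And>\<phi>. p x \<phi> = p y \<phi>) \<Longrightarrow> x = y"
  using norm_leI[of "x - y" 0] by (simp add: left_simps)

end

lemma (in dual_pair) norm_bound: "cmod (p x \<phi>) \<le> norm x * norm \<phi>"
proof (cases "\<phi> = 0")
  case True
  then show ?thesis using dual_pair.left_simps(3)[OF flip] by simp
next
  case False
  let ?\<psi> = "complex_of_real (1 / norm \<phi>) *\<^sub>C \<phi>"
  have "cmod (p x ?\<psi>) \<le> norm x"
    unfolding norm_left using False by (intro cSUP_upper bdd_left) (simp add: norm_scaleC norm_divide)
  then show ?thesis
    using False by (simp add: dual_pair.left_simps(2)[OF flip] norm_mult norm_divide field_simps)
qed

text \<open>Continuity at 0 bounds \<open>f\<close> by 1 on a basic neighbourhood, which contains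
  the whole joint kernel of finitely many functionals. A linear map bounded on a subspace vanishes
  there, so \<open>functional_in_span\<close> applies.\<close>

lemma (in dual_pair) sigma_continuous_functional:
  assumes f: "clinear f" and c: "continuous_map (sigma p) euclidean f"
  shows "\<exists>\<psi>. \<forall>x. f x = p x \<psi>"
proof -
  have "openin (sigma p) {x \<in> topspace (sigma p). f x \<in> ball 0 1}"
    using c by (rule openin_continuous_map_preimage) simp
  moreover have f0: "f 0 = 0" using clinearD(2)[OF f, of 0 0] by (simp add: scaleC_complex_def)
  ultimately obtain \<Phi> e where \<Phi>: "finite \<Phi>" "0 < e" and
    *: "\<And>y. (\<forall>\<phi>\<in>\<Phi>. cmod (p y \<phi> - p 0 \<phi>) < e) \<Longrightarrow> cmod (f y) < 1"
    using sigma_neighbourhood_base[of p "{x \<in> topspace (sigma p). f x \<in> ball 0 1}" 0] by auto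
  show ?thesis
  proof (rule functional_in_span[OF \<Phi>(1) clinear_left clinear_right f])
    fix x assume x: "\<forall>\<phi>\<in>\<Phi>. p x \<phi> = 0"
    show "f x = 0"
    proof (rule ccontr)
      assume nz: "f x \<noteq> 0"
      have "cmod (f ((1 / f x) *\<^sub>C x)) < 1"
        using x \<Phi> by (intro *) (simp add: left_simps)
      then show False using nz by (simp add: clinearD(2)[OF f] scaleC_complex_def)
    qed
  qed
qed

text \<open>Lets an operator act on the second argument of the pairing; this is how
  \<open>U t\<close> is later moved past weak integrals and analytic extensions.\<close>

lemma (in dual_pair) transpose:
  assumes "T \<in> B_sigma p"
  shows "\<exists>\<psi>. \<forall>x. p (T x) \<phi> = p x \<psi>"
proof (rule sigma_continuous_functional)
  have T: "clinear T" "continuous_map (sigma p) (sigma p) T"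
    using assms by (auto simp: B_sigma_def)
  show "clinear (\<lambda>x. p (T x) \<phi>)"
    using clinearD[OF T(1)] by (intro clinearI) (auto simp: left_simps scaleC_complex_def)
  show "continuous_map (sigma p) euclidean (\<lambda>x. p (T x) \<phi>)"
    using T(2) by (simp add: continuous_map_sigma_iff)
qed

lemma continuous_map_sigma_pairing: "continuous_map (sigma p) euclidean (\<lambda>x. p x \<phi>)"
  using continuous_map_sigma_iff[of "sigma p" p id] by simp

lemma (in dual_pair) B_sigmaI:
  assumes "clinear T" "bounded_linear T" "\<And>\<phi>. \<exists>\<psi>. \<forall>x. p (T x) \<phi> = p x \<psi>"
  shows "T \<in> B_sigma p"
proof -
  have "continuous_map (sigma p) euclidean (\<lambda>x. p (T x) \<phi>)" for \<phi>
  proof -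
    obtain \<psi> where "\<And>x. p (T x) \<phi> = p x \<psi>" using assms(3) by blast
    then show ?thesis by (simp add: continuous_map_sigma_pairing)
  qed
  then show ?thesis using assms by (simp add: B_sigma_def continuous_map_sigma_iff)
qed

text \<open>Baire category in the Banach space of the functionals: the closed sets
  \<open>C n\<close> on which the family is bounded by \<open>n\<close> cover the space, so one of
  them contains a ball.\<close>

lemma (in dual_pair) uniform_boundedness:
  assumes "\<And>\<phi>. \<exists>B. \<forall>x\<in>A. cmod (p x \<phi>) \<le> B"
  shows "\<exists>B. \<forall>x\<in>A. norm x \<le> B"
proof -
  have lipschitz: "continuous_on UNIV (p x)" for x
  proof -
    have "cmod (p x \<phi> - p x \<psi>) \<le> norm x * norm (\<phi> - \<psi>)" for \<phi> \<psi>
      using norm_bound[of x "\<phi> - \<psi>"] by (simp add: dual_pair.left_simps[OF flip])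
    then have "(norm x)-lipschitz_on UNIV (p x)"
      by (intro lipschitz_onI) (auto simp: dist_norm)
    then show ?thesis by (rule lipschitz_on_continuous_on)
  qed
  define C where "C = (\<lambda>n::nat. {\<phi>. \<forall>x\<in>A. cmod (p x \<phi>) \<le> real n})"
  have closed: "closed (C n)" for n
  proof -
    have "C n = (\<Inter>x\<in>A. {\<phi>. cmod (p x \<phi>) \<le> real n})" by (auto simp: C_def)
    moreover have "closed {\<phi>. cmod (p x \<phi>) \<le> real n}" for x
      using lipschitz[of x] by (intro closed_Collect_le continuous_intros) auto
    ultimately show ?thesis by (simp add: closed_INT)
  qed
  have U: "(\<Union>n. C n) = UNIV"
  proof -
    have "\<exists>n. \<phi> \<in> C n" for \<phi>
    proof -
      obtain B where B: "\<forall>x\<in>A. cmod (p x \<phi>) \<le> B" using assms by blast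
      obtain n where "B \<le> real n" using real_arch_simple by blast
      with B have "\<phi> \<in> C n" by (auto simp: C_def intro: order_trans)
      then show ?thesis by blast
    qed
    then show ?thesis by blast
  qed
  have "\<exists>n. interior (C n) \<noteq> {}"
  proof (rule ccontr)
    assume "\<not> ?thesis"
    moreover have "Metric_space.mcomplete (UNIV :: 'f set) dist"
      using complete_UNIV by (simp add: mcomplete_iff_complete)
    ultimately have "Met_TC.mtopology interior_of (\<Union> (range C)) = {}"
      using closed by (intro Met_TC.metric_Baire_category_alt) auto
    then show False using U by simp
  qed
  then obtain n \<phi> r where r: "r > 0" "ball \<phi> r \<subseteq> C n"
    by (metis all_not_in_conv mem_interior)
  have "norm x \<le> 4 * real n / r" if x: "x \<in> A" for x
  proof (rule norm_leI)
    fix \<psi> :: 'f assume \<psi>: "norm \<psi> \<le> 1"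
    \<comment> \<open>\<open>\<phi>\<close> and \<open>?\<chi>\<close> both lie in
      \<open>C n\<close>, so the pairing with their difference
      \<open>(r / 2) *\<^sub>R \<psi>\<close> is at most \<open>2 * n\<close>, whence the constant
      \<open>4 * n / r\<close>.\<close>
    let ?\<chi> = "\<phi> + (r / 2) *\<^sub>R \<psi>"
    have "r * norm \<psi> \<le> r" using \<psi> r by (simp add: mult_left_le)
    then have "?\<chi> \<in> C n" "\<phi> \<in> C n"
      using r by (auto simp: dist_norm subset_iff)
    then have "cmod (p x ?\<chi>) \<le> n" "cmod (p x \<phi>) \<le> n" using x by (auto simp: C_def)
    then have "cmod (p x ?\<chi> - p x \<phi>) \<le> 2 * n"
      using norm_triangle_ineq4[of "p x ?\<chi>" "p x \<phi>"] by linarith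
    then show "cmod (p x \<psi>) \<le> 4 * real n / r"
      using r by (simp add: dual_pair.left_simps[OF flip] norm_mult field_simps)
  qed
  then show ?thesis by blast
qed

section \<open>Weak integrals\<close>

lemma integrable_indicator_interval:
  fixes f :: "real \<Rightarrow> 'a :: {banach, second_countable_topology}"
  shows "integrable lborel f \<Longrightarrow> integrable lborel (\<lambda>t. indicator {a..b} t *\<^sub>R f t)"
  by (intro integrable_mult_indicator) auto

lemma integral_interval_eq_LINT:
  fixes f :: "real \<Rightarrow> 'a :: euclidean_space"
  assumes "integrable lborel f"
  shows "integral {a..b} f = (LINT t|lborel. indicator {a..b} t *\<^sub>R f t)"
  using set_borel_integral_eq_integral(2)[of "{a..b}" f] integrable_indicator_interval[OF assms]
  by (simp add: set_lebesgue_integral_def set_integrable_def)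

lemma symmetric_integrals_tendsto:
  fixes f :: "real \<Rightarrow> 'a :: euclidean_space"
  assumes f: "integrable lborel f"
  shows "(\<lambda>n. integral {- real n..real n} f) \<longlonglongrightarrow> (LINT t|lborel. f t)"
  unfolding integral_interval_eq_LINT[OF f]
proof (rule integral_dominated_convergence[where w = "\<lambda>t. norm (f t)"])
  let ?A = "\<lambda>n. {- real n..real n}"
  show "f \<in> borel_measurable lborel" "integrable lborel (\<lambda>t. norm (f t))" using f by simp_all
  show "(\<lambda>t. indicator (?A n) t *\<^sub>R f t) \<in> borel_measurable lborel" for n
    using integrable_indicator_interval[OF f] by simp
  show "AE t in lborel. (\<lambda>n. indicator (?A n) t *\<^sub>R f t) \<longlonglongrightarrow> f t"
  proof (intro AE_I2 tendsto_eventually)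
    fix t :: real
    obtain N where N: "\<bar>t\<bar> \<le> real N" using real_arch_simple by blast
    have "indicator (?A n) t *\<^sub>R f t = f t" if "n \<ge> N" for n
      using that N by (auto simp: indicator_def)
    then show "\<forall>\<^sub>F n in sequentially. indicator (?A n) t *\<^sub>R f t = f t"
      unfolding eventually_sequentially by blast
  qed
  show "AE t in lborel. norm (indicator (?A n) t *\<^sub>R f t) \<le> norm (f t)" for n
    by (intro AE_I2) (simp add: indicator_def)
qed

lemma integral_combine_steps:
  fixes f :: "real \<Rightarrow> complex"
  assumes h: "h \<ge> 0" and f: "continuous_on {a..a + real m * h} f"
  shows "integral {a..a + real m * h} f = (\<Sum>j<m. integral {a + real j * h..a + real (Suc j) * h} f)"
  using f
proof (induction m)
  case (Suc m)
  have le: "real m * h \<le> real (Suc m) * h" using h by (intro mult_right_mono) auto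
  have "integral {a..a + real (Suc m) * h} f =
      integral {a..a + real m * h} f + integral {a + real m * h..a + real (Suc m) * h} f"
    using h le by (intro Henstock_Kurzweil_Integration.integral_combine[symmetric]
        integrable_continuous_real Suc.prems) auto
  moreover have "continuous_on {a..a + real m * h} f"
    using le by (intro continuous_on_subset[OF Suc.prems]) auto
  ultimately show ?case using Suc.IH by simp
qed simp

text \<open>Uniform continuity bounds the error on each of the equal pieces. Equal weights are used
  because such sums become convex combinations when formed with vectors.\<close>

lemma riemann_sum_tendsto:
  fixes f :: "real \<Rightarrow> complex"
  assumes "a < b" and f: "continuous_on {a..b} f"
  defines "h \<equiv> \<lambda>n. (b - a) / real (Suc n)"
  shows "(\<lambda>n. \<Sum>j<Suc n. h n *\<^sub>R f (a + real j * h n)) \<longlonglongrightarrow> integral {a..b} f"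
proof (rule metric_LIMSEQ_I)
  fix e :: real assume "e > 0"
  define e' where "e' = e / (2 * (b - a))"
  have e': "e' > 0" using \<open>e > 0\<close> assms by (simp add: e'_def)
  have "uniformly_continuous_on {a..b} f"
    using f by (intro compact_uniformly_continuous) auto
  then obtain d where d: "d > 0" and
    ud: "\<And>s t. s \<in> {a..b} \<Longrightarrow> t \<in> {a..b} \<Longrightarrow> dist s t < d \<Longrightarrow> dist (f s) (f t) < e'"
    using e' unfolding uniformly_continuous_on_def by metis
  obtain N where N: "(b - a) / d < real N" using reals_Archimedean2 by blast
  show "\<exists>N. \<forall>n\<ge>N. dist (\<Sum>j<Suc n. h n *\<^sub>R f (a + real j * h n)) (integral {a..b} f) < e"
  proof (intro exI allI impI)
    fix n assume n: "n \<ge> N"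
    have hpos: "h n > 0" using assms by (simp add: h_def)
    have hd: "h n < d"
    proof -
      have "(b - a) / d < real (Suc n)" using N n by linarith
      then show ?thesis using d by (simp add: h_def field_simps)
    qed
    have b: "a + real (Suc n) * h n = b" by (simp add: h_def)
    have sub: "{a + real j * h n..a + real (Suc j) * h n} \<subseteq> {a..b}" if "j < Suc n" for j
    proof -
      have "real (Suc j) * h n \<le> real (Suc n) * h n"
        using that hpos by (intro mult_right_mono) auto
      moreover have "0 \<le> real j * h n" using hpos by simp
      ultimately show ?thesis using b by auto
    qed
    have "integral {a..b} f = (\<Sum>j<Suc n. integral {a + real j * h n..a + real (Suc j) * h n} f)"
      using integral_combine_steps[of "h n" a "Suc n" f] f hpos unfolding b by simp
    then have "dist (\<Sum>j<Suc n. h n *\<^sub>R f (a + real j * h n)) (integral {a..b} f) =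
        norm (\<Sum>j<Suc n. h n *\<^sub>R f (a + real j * h n) - integral {a + real j * h n..a + real (Suc j) * h n} f)"
      by (simp only: dist_norm sum_subtractf)
    also have "\<dots> \<le> (\<Sum>j<Suc n. e' * h n)"
    proof (rule sum_norm_le)
      fix j assume "j \<in> {..<Suc n}"
      then have j: "j < Suc n" by simp
      let ?I = "{a + real j * h n..a + real (Suc j) * h n}"
      have len: "a + real (Suc j) * h n - (a + real j * h n) = h n" by (simp add: algebra_simps)
      have int: "f integrable_on ?I"
        by (intro integrable_continuous_real continuous_on_subset[OF f] sub j)
      have "h n *\<^sub>R f (a + real j * h n) - integral ?I f = integral ?I (\<lambda>t. f (a + real j * h n) - f t)"
        using int hpos len by (subst Henstock_Kurzweil_Integration.integral_diff) auto
      also have "norm \<dots> \<le> e' * (a + real (Suc j) * h n - (a + real j * h n))"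
      proof (rule integral_bound)
        show "a + real j * h n \<le> a + real (Suc j) * h n" using len hpos by linarith
        show "continuous_on ?I (\<lambda>t. f (a + real j * h n) - f t)"
          using sub[OF j] by (intro continuous_intros continuous_on_subset[OF f])
        fix t assume t: "t \<in> ?I"
        have "dist (f (a + real j * h n)) (f t) < e'"
        proof (rule ud)
          have "a + real j * h n \<in> ?I" using len hpos by simp
          then show "a + real j * h n \<in> {a..b}" "t \<in> {a..b}" using t sub[OF j] by blast+
          show "dist (a + real j * h n) t < d" using t hd len unfolding dist_real_def by auto
        qed
        then show "norm (f (a + real j * h n) - f t) \<le> e'" by (simp add: dist_norm)
      qed
      finally show "norm (h n *\<^sub>R f (a + real j * h n) - integral ?I f) \<le> e' * h n"
        by (simp only: len)
    qed
    also have "\<dots> = e' * (real (Suc n) * h n)" by simp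
    also have "\<dots> = e' * (b - a)" by (simp add: h_def)
    also have "\<dots> = e / 2" using \<open>a < b\<close> unfolding e'_def by (simp add: divide_simps)
    finally show "dist (\<Sum>j<Suc n. h n *\<^sub>R f (a + real j * h n)) (integral {a..b} f) < e"
      using \<open>e > 0\<close> by simp
  qed
qed

section \<open>Vector-valued weak integrals from the Krein property\<close>

text \<open>Replaces sequential compactness, which weak compactness need not provide. If no point of
  \<open>C\<close> were a cluster point, finitely many open sets, each eventually avoided by the
  sequence, would cover \<open>C\<close>.\<close>

lemma compactin_sequence_cluster:
  assumes C: "compactin X C" and R: "\<And>n::nat. R n \<in> C"
  shows "\<exists>y\<in>C. \<forall>U. openin X U \<and> y \<in> U \<longrightarrow> (\<exists>\<^sub>F n in sequentially. R n \<in> U)"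
proof (rule ccontr)
  assume "\<not> ?thesis"
  then have "\<forall>y\<in>C. \<exists>U. openin X U \<and> y \<in> U \<and> (\<forall>\<^sub>F n in sequentially. R n \<notin> U)"
    by (simp add: not_frequently)
  then obtain U where U: "\<And>y. y \<in> C \<Longrightarrow> openin X (U y)" "\<And>y. y \<in> C \<Longrightarrow> y \<in> U y"
    "\<And>y. y \<in> C \<Longrightarrow> \<forall>\<^sub>F n in sequentially. R n \<notin> U y"
    by metis
  have "(\<forall>V\<in>U ` C. openin X V) \<and> C \<subseteq> \<Union> (U ` C)" using U(1,2) by blast
  then have "\<exists>\<F>. finite \<F> \<and> \<F> \<subseteq> U ` C \<and> C \<subseteq> \<Union> \<F>"
    using C unfolding compactin_def by blast
  then obtain D where D: "finite D" "D \<subseteq> C" "C \<subseteq> \<Union> (U ` D)"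
    by (metis finite_subset_image)
  then have "\<forall>\<^sub>F n in sequentially. \<forall>y\<in>D. R n \<notin> U y"
    using U(3) by (intro eventually_ball_finite) auto
  then obtain n where "\<forall>y\<in>D. R n \<notin> U y"
    using eventually_happens'[OF sequentially_bot] by blast
  with R[of n] D(3) show False by blast
qed

text \<open>The Riemann sums lie in a convex hull whose weak closure is compact by the Krein
  property, hence they have a weak cluster point. Since each pairing of the sums converges to the
  scalar integral, that point is the integral.\<close>

lemma (in dual_pair) weak_integral_interval:
  fixes a b :: real
  assumes krein: "krein_property p" and "a < b"
    and g: "continuous_map (top_of_set {a..b}) (sigma p) g"
  shows "\<exists>y. \<forall>\<phi>. p y \<phi> = integral {a..b} (\<lambda>t. p (g t) \<phi>)"
proof -
  \<comment> \<open>The factor \<open>b - a\<close> is put into \<open>K\<close> so that the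
    remaining weights \<open>1 / real (Suc n)\<close> add up to 1.\<close>
  define K where "K = (\<lambda>t. (b - a) *\<^sub>R g t) ` {a..b}"
  have "continuous_map (top_of_set {a..b}) (sigma p) (\<lambda>t. (b - a) *\<^sub>R g t)"
    using g by (auto simp: continuous_map_sigma_iff left_simps intro!: continuous_intros)
  then have "compactin (sigma p) K"
    unfolding K_def by (rule image_compactin[rotated]) (simp add: compactin_subtopology)
  then have C: "compactin (sigma p) (sigma p closure_of (convex hull K))"
    using krein by (simp add: krein_property_def)
  define h where "h = (\<lambda>n. (b - a) / real (Suc n))"
  define R where "R = (\<lambda>n. \<Sum>j<Suc n. (1 / real (Suc n)) *\<^sub>R ((b - a) *\<^sub>R g (a + real j * h n)))"
  have "R n \<in> convex hull K" for n
    unfolding R_def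
  proof (rule convex_sum)
    fix j assume "j \<in> {..<Suc n}"
    then have "real j * (b - a) \<le> real (Suc n) * (b - a)"
      using assms by (intro mult_right_mono) auto
    then have "real j * h n \<le> b - a"
      unfolding h_def by (simp only: times_divide_eq_right divide_le_eq of_nat_0_less_iff zero_less_Suc if_True mult.commute)
    moreover have "0 \<le> real j * h n"
      using assms by (simp add: h_def)
    ultimately have "a + real j * h n \<in> {a..b}" by auto
    then show "(b - a) *\<^sub>R g (a + real j * h n) \<in> convex hull K"
      unfolding K_def by (intro hull_inc) blast
  qed auto
  moreover have "convex hull K \<subseteq> sigma p closure_of (convex hull K)"
    by (rule closure_of_subset) simp
  ultimately have "\<And>n. R n \<in> sigma p closure_of (convex hull K)" by blast
  then obtain y where
    y: "\<And>U. openin (sigma p) U \<Longrightarrow> y \<in> U \<Longrightarrow> \<exists>\<^sub>F n in sequentially. R n \<in> U"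
    using compactin_sequence_cluster[OF C, of R] by blast
  have "p y \<phi> = integral {a..b} (\<lambda>t. p (g t) \<phi>)" for \<phi>
  proof (rule ccontr)
    let ?I = "integral {a..b} (\<lambda>t. p (g t) \<phi>)"
    assume ne: "p y \<phi> \<noteq> ?I"
    define e where "e = dist (p y \<phi>) ?I / 2"
    have e: "e > 0" using ne by (simp add: e_def)
    have "continuous_on {a..b} (\<lambda>t. p (g t) \<phi>)"
      using g by (simp add: continuous_map_sigma_iff)
    from riemann_sum_tendsto[OF \<open>a < b\<close> this]
    have "(\<lambda>n. p (R n) \<phi>) \<longlonglongrightarrow> ?I"
      by (simp add: R_def h_def sum_left left_simps scaleR_conv_of_real sum_distrib_left)
    then have ev: "\<forall>\<^sub>F n in sequentially. dist (p (R n) \<phi>) ?I < e"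
      using e by (rule tendstoD)
    have fr: "\<exists>\<^sub>F n in sequentially. R n \<in> {x. p x \<phi> \<in> ball (p y \<phi>) e}"
      using e by (intro y openin_sigma_basic) auto
    \<comment> \<open>A neighbourhood entered frequently and one entered eventually have a common
      index. As \<open>e\<close> is half of the assumed distance, this is a contradiction.\<close>
    have "\<exists>n. dist (p y \<phi>) (p (R n) \<phi>) < e \<and> dist (p (R n) \<phi>) ?I < e"
    proof (rule ccontr)
      assume "\<not> ?thesis"
      with ev have "\<forall>\<^sub>F n in sequentially. R n \<notin> {x. p x \<phi> \<in> ball (p y \<phi>) e}"
        by (elim eventually_mono) auto
      with fr show False by (simp add: frequently_def)
    qed
    then obtain n where "dist (p y \<phi>) (p (R n) \<phi>) < e" "dist (p (R n) \<phi>) ?I < e" by blast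
    then show False
      using dist_triangle[of "p y \<phi>" ?I "p (R n) \<phi>"] unfolding e_def by linarith
  qed
  then show ?thesis by blast
qed

text \<open>Integrals over growing intervals exist by the interval case and are norm Cauchy, because
  their differences are bounded by tails of the integral of \<open>cmod (k t)\<close>. Completeness
  supplies the limit.\<close>

lemma (in dual_pair) weak_integral:
  fixes g :: "real \<Rightarrow> 'x"
  assumes krein: "krein_property p" and g: "continuous_map euclidean (sigma p) g"
    and B: "\<And>t. norm (g t) \<le> B"
    and kc: "continuous_on UNIV k" and ki: "integrable lborel k"
  shows "\<exists>y. (\<forall>\<phi>. integrable lborel (\<lambda>t. k t * p (g t) \<phi>) \<and> p y \<phi> = (LINT t|lborel. k t * p (g t) \<phi>)) \<and>
     norm y \<le> B * (LINT t|lborel. cmod (k t))"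
proof -
  have B0: "B \<ge> 0" using B[of 0] norm_ge_zero order_trans by blast
  have pg: "continuous_on UNIV (\<lambda>t. p (g t) \<phi>)" for \<phi>
    using g by (simp add: continuous_map_sigma_iff)
  have bound: "cmod (k t * p (g t) \<phi>) \<le> B * norm \<phi> * cmod (k t)" for t \<phi>
  proof -
    have "cmod (p (g t) \<phi>) \<le> B * norm \<phi>"
      using norm_bound[of "g t" \<phi>] B[of t] by (meson mult_right_mono norm_ge_zero order_trans)
    from mult_left_mono[OF this norm_ge_zero[of "k t"]] show ?thesis by (simp add: norm_mult mult_ac)
  qed
  have int: "integrable lborel (\<lambda>t. k t * p (g t) \<phi>)" for \<phi>
  proof (rule Bochner_Integration.integrable_bound)
    show "integrable lborel (\<lambda>t. B * norm \<phi> * cmod (k t))"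
      using ki by simp
    have "continuous_on UNIV (\<lambda>t. k t * p (g t) \<phi>)"
      by (intro continuous_intros kc pg)
    then show "(\<lambda>t. k t * p (g t) \<phi>) \<in> borel_measurable lborel"
      using borel_measurable_continuous_onI by auto
    show "AE t in lborel. norm (k t * p (g t) \<phi>) \<le> norm (B * norm \<phi> * cmod (k t))"
      using bound B0 by (intro AE_I2) (simp add: abs_mult)
  qed
  \<comment> \<open>\<open>Suc n\<close> rather than \<open>n\<close> keeps every interval
    nondegenerate, as the interval case requires.\<close>
  define A where "A = (\<lambda>n. {- real (Suc n)..real (Suc n)})"
  have "\<exists>y. \<forall>\<phi>. p y \<phi> = integral (A n) (\<lambda>t. p (k t *\<^sub>C g t) \<phi>)" for n
    unfolding A_def
  proof (rule weak_integral_interval[OF krein])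
    have "continuous_on {- real (Suc n)..real (Suc n)} (\<lambda>t. k t * p (g t) \<phi>)" for \<phi>
      by (intro continuous_intros continuous_on_subset[OF kc] continuous_on_subset[OF pg] subset_UNIV)
    then show "continuous_map (top_of_set {- real (Suc n)..real (Suc n)}) (sigma p) (\<lambda>t. k t *\<^sub>C g t)"
      by (simp add: continuous_map_sigma_iff left_simps)
  qed simp
  then obtain Y where Y0: "\<And>n \<phi>. p (Y n) \<phi> = integral (A n) (\<lambda>t. p (k t *\<^sub>C g t) \<phi>)" by metis
  note ind = integrable_indicator_interval and eq = integral_interval_eq_LINT
  have Y: "p (Y n) \<phi> = integral (A n) (\<lambda>t. k t * p (g t) \<phi>)" for n \<phi>
    by (simp add: Y0 left_simps)
  define I where "I = (\<lambda>n. integral (A n) (\<lambda>t. cmod (k t)))"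
  have lim: "(\<lambda>n. integral (A n) f) \<longlonglongrightarrow> (LINT t|lborel. f t)"
    if "integrable lborel f" for f :: "real \<Rightarrow> 'c::euclidean_space"
    unfolding A_def by (rule LIMSEQ_Suc[OF symmetric_integrals_tendsto[OF that]])
  have ik: "integrable lborel (\<lambda>t. cmod (k t))" using ki by simp
  have diff: "norm (Y m - Y n) \<le> B * (I m - I n)" if "n \<le> m" for m n
  proof (rule norm_leI)
    fix \<phi> :: 'f assume \<phi>: "norm \<phi> \<le> 1"
    have sub: "A n \<subseteq> A m" using that by (auto simp: A_def)
    have "p (Y m - Y n) \<phi> = (LINT t|lborel. indicator (A m) t *\<^sub>R (k t * p (g t) \<phi>) - indicator (A n) t *\<^sub>R (k t * p (g t) \<phi>))"
      unfolding left_simps Y A_def eq[OF int]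
      by (rule Bochner_Integration.integral_diff[OF ind[OF int] ind[OF int], symmetric])
    also have "cmod \<dots> \<le> (LINT t|lborel. B * (indicator (A m) t *\<^sub>R cmod (k t) - indicator (A n) t *\<^sub>R cmod (k t)))"
    proof (rule Bochner_Integration.integral_norm_bound_integral)
      show "integrable lborel (\<lambda>t. indicator (A m) t *\<^sub>R (k t * p (g t) \<phi>) - indicator (A n) t *\<^sub>R (k t * p (g t) \<phi>))"
        unfolding A_def by (intro Bochner_Integration.integrable_diff ind int)
      show "integrable lborel (\<lambda>t. B * (indicator (A m) t *\<^sub>R cmod (k t) - indicator (A n) t *\<^sub>R cmod (k t)))"
        unfolding A_def by (intro Bochner_Integration.integrable_diff Bochner_Integration.integrable_mult_right ind ik)
      fix t
      have "cmod (k t * p (g t) \<phi>) \<le> B * cmod (k t)"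
        using bound[of t \<phi>] mult_left_mono[OF \<phi>, of "B * cmod (k t)"] B0 by (simp add: mult_ac)
      then show "cmod (indicator (A m) t *\<^sub>R (k t * p (g t) \<phi>) - indicator (A n) t *\<^sub>R (k t * p (g t) \<phi>)) \<le>
          B * (indicator (A m) t *\<^sub>R cmod (k t) - indicator (A n) t *\<^sub>R cmod (k t))"
        using sub by (cases "t \<in> A m"; cases "t \<in> A n") auto
    qed
    also have "\<dots> = B * (I m - I n)"
      unfolding I_def A_def eq[OF ik]
      by (simp only: Bochner_Integration.integral_diff[OF ind[OF ik] ind[OF ik]] Bochner_Integration.integral_mult_right_zero)
    finally show "cmod (p (Y m - Y n) \<phi>) \<le> B * (I m - I n)" .
  qed
  have IL: "I \<longlonglongrightarrow> (LINT t|lborel. cmod (k t))"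
    unfolding I_def by (rule lim[OF ik])
  have "Cauchy Y"
  proof (rule metric_CauchyI)
    fix e :: real assume "e > 0"
    have "Cauchy (\<lambda>n. B * I n)" by (rule LIMSEQ_imp_Cauchy[OF tendsto_mult_left[OF IL]])
    then obtain N where N: "\<And>m n. m \<ge> N \<Longrightarrow> n \<ge> N \<Longrightarrow> dist (B * I m) (B * I n) < e"
      using \<open>e > 0\<close> by (meson metric_CauchyD)
    have *: "dist (Y m) (Y n) < e" if "m \<ge> N" "n \<ge> N" "n \<le> m" for m n
    proof -
      have "dist (Y m) (Y n) \<le> B * I m - B * I n"
        using diff[OF that(3)] by (simp add: dist_norm algebra_simps)
      also have "\<dots> < e" using N[OF that(1,2)] by (simp add: dist_real_def)
      finally show ?thesis .
    qed
    have "dist (Y m) (Y n) < e" if "m \<ge> N" "n \<ge> N" for m n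
      using *[of m n] *[of n m] that by (cases "n \<le> m") (auto simp: dist_commute)
    then show "\<exists>M. \<forall>m\<ge>M. \<forall>n\<ge>M. dist (Y m) (Y n) < e" by blast
  qed
  then obtain y where y: "Y \<longlonglongrightarrow> y" using Cauchy_convergent convergent_def by blast
  have py: "p y \<phi> = (LINT t|lborel. k t * p (g t) \<phi>)" for \<phi>
  proof (rule LIMSEQ_unique)
    show "(\<lambda>n. p (Y n) \<phi>) \<longlonglongrightarrow> (LINT t|lborel. k t * p (g t) \<phi>)"
      unfolding Y by (rule lim[OF int])
    have "(\<lambda>n. norm (Y n - y) * norm \<phi>) \<longlonglongrightarrow> 0"
      using y by (intro tendsto_mult_left_zero) (simp add: LIM_zero tendsto_norm_zero)
    moreover have "\<forall>\<^sub>F n in sequentially. cmod (p (Y n) \<phi> - p y \<phi>) \<le> norm (Y n - y) * norm \<phi>"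
      using norm_bound[of "Y n - y" \<phi> for n] by (simp add: left_simps)
    ultimately have "(\<lambda>n. p (Y n) \<phi> - p y \<phi>) \<longlonglongrightarrow> 0"
      by (rule Lim_null_comparison[rotated])
    then show "(\<lambda>n. p (Y n) \<phi>) \<longlonglongrightarrow> p y \<phi>" by (rule LIM_zero_cancel)
  qed
  have "norm y \<le> B * (LINT t|lborel. cmod (k t))"
  proof (rule norm_leI)
    fix \<phi> :: 'f assume \<phi>: "norm \<phi> \<le> 1"
    have "cmod (p y \<phi>) \<le> (LINT t|lborel. B * cmod (k t))"
      unfolding py
    proof (rule Bochner_Integration.integral_norm_bound_integral[OF int])
      show "integrable lborel (\<lambda>t. B * cmod (k t))"
        by (intro Bochner_Integration.integrable_mult_right ik)
      fix t
      show "cmod (k t * p (g t) \<phi>) \<le> B * cmod (k t)"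
        using bound[of t \<phi>] mult_left_mono[OF \<phi>, of "B * cmod (k t)"] B0 by (simp add: mult_ac)
    qed
    then show "cmod (p y \<phi>) \<le> B * (LINT t|lborel. cmod (k t))"
      by (simp only: Bochner_Integration.integral_mult_right_zero)
  qed
  with py int show ?thesis by blast
qed

section \<open>Weak and norm holomorphy\<close>

text \<open>Cauchy's inequality on discs of radius \<open>r / 4\<close> bounds the second derivative
  on the half ball by \<open>2 * M / (r / 4)\<^sup>2\<close>; two mean value estimates follow. The
  constant depends on \<open>g\<close> only through \<open>M\<close>, which makes the bound uniform
  over a family of functions.\<close>

lemma holomorphic_second_order_bound:
  fixes g :: "complex \<Rightarrow> complex"
  assumes r: "r > 0" and hol: "g holomorphic_on ball w r"
    and M: "\<And>z. z \<in> ball w r \<Longrightarrow> cmod (g z) \<le> M" and h: "cmod h < r / 2"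
  shows "cmod (g (w + h) - g w - h * deriv g w) \<le> 32 * M / r\<^sup>2 * (cmod h)\<^sup>2"
proof -
  let ?L = "32 * M / r\<^sup>2"
  have der: "(g has_field_derivative deriv g z) (at z)" if "z \<in> ball w r" for z
    using hol that by (simp add: holomorphic_derivI)
  have der2: "(deriv g has_field_derivative deriv (deriv g) z) (at z)" if "z \<in> ball w r" for z
    using holomorphic_deriv[OF hol open_ball] that by (simp add: holomorphic_derivI)
  have second: "cmod (deriv (deriv g) z) \<le> ?L" if z: "z \<in> ball w (r / 2)" for z
  proof -
    have sub: "cball z (r / 4) \<subseteq> ball w r"
    proof
      fix u assume "u \<in> cball z (r / 4)"
      then show "u \<in> ball w r" using z r dist_triangle[of w u z] by auto
    qed
    have "cmod ((deriv ^^ 2) g z) \<le> fact 2 * M / (r / 4) ^ 2"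
    proof (rule Cauchy_inequality)
      show "g holomorphic_on ball z (r / 4)"
        by (rule holomorphic_on_subset[OF hol]) (use sub ball_subset_cball in blast)
      show "continuous_on (cball z (r / 4)) g"
        using sub holomorphic_on_imp_continuous_on[OF hol] by (rule continuous_on_subset[rotated])
      show "0 < r / 4" using r by simp
      fix x assume "cmod (z - x) = r / 4"
      then have "x \<in> cball z (r / 4)" by (simp add: dist_norm)
      with sub show "cmod (g x) \<le> M" by (intro M) auto
    qed
    then show ?thesis by (simp add: numeral_2_eq_2 power2_eq_square fact_2)
  qed
  have hr: "cmod h < r" using h r by simp
  have in1: "z \<in> ball w (r / 2)" "z \<in> ball w r" if "z \<in> cball w (cmod h)" for z
    using that h hr r by (auto simp: dist_norm)
  have first: "cmod (deriv g z - deriv g w) \<le> ?L * cmod (z - w)" if z: "z \<in> cball w (cmod h)" for z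
    by (rule field_differentiable_bound[where S = "cball w (cmod h)" and f' = "deriv (deriv g)"])
      (use z in1 second der2 in \<open>auto intro: has_field_derivative_at_within\<close>)
  have M0: "M \<ge> 0" using order_trans[OF norm_ge_zero M[of w]] r by simp
  have "cmod ((g (w + h) - deriv g w * (w + h)) - (g w - deriv g w * w)) \<le> (?L * cmod h) * cmod (w + h - w)"
  proof (rule field_differentiable_bound[where S = "cball w (cmod h)" and f = "\<lambda>z. g z - deriv g w * z" and f' = "\<lambda>z. deriv g z - deriv g w * 1"])
    fix z assume z: "z \<in> cball w (cmod h)"
    show "((\<lambda>z. g z - deriv g w * z) has_field_derivative deriv g z - deriv g w * 1) (at z within cball w (cmod h))"
      using in1[OF z] by (auto intro!: derivative_eq_intros has_field_derivative_at_within[OF der])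
    have "?L * cmod (z - w) \<le> ?L * cmod h"
      using z M0 r by (intro mult_left_mono) (auto simp: dist_norm norm_minus_commute)
    then show "cmod (deriv g z - deriv g w * 1) \<le> ?L * cmod h"
      using first[OF z] by simp
  qed (auto simp: dist_norm)
  then show ?thesis by (simp add: algebra_simps power2_eq_square)
qed

context dual_pair
begin

lemma bounded_linear_left: "bounded_linear (\<lambda>x. p x \<phi>)"
  by (rule bounded_linear_intro[where K = "norm \<phi>"])
    (auto simp: left_simps scaleR_conv_of_real norm_bound)

lemma holomorphic_imp_weakly_holomorphic:
  assumes "\<And>w. w \<in> S \<Longrightarrow> \<exists>D. (H has_derivative (\<lambda>h. h *\<^sub>C D)) (at w)"
  shows "(\<lambda>z. p (H z) \<phi>) holomorphic_on S"
proof -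
  have "\<exists>d. ((\<lambda>z. p (H z) \<phi>) has_field_derivative d) (at w within S)" if w: "w \<in> S" for w
  proof -
    from assms[OF w] obtain D where "(H has_derivative (\<lambda>h. h *\<^sub>C D)) (at w)" by blast
    from bounded_linear.has_derivative[OF bounded_linear_left this]
    have "((\<lambda>z. p (H z) \<phi>) has_derivative (\<lambda>h. p D \<phi> * h)) (at w)"
      by (simp add: left_simps mult.commute)
    then show ?thesis
      using has_field_derivative_def has_field_derivative_at_within by blast
  qed
  then show ?thesis by (simp add: holomorphic_on_def field_differentiable_def)
qed

text \<open>The remainder bound for \<open>p (H z) \<phi>\<close> is uniform over
  \<open>norm \<phi> \<le> 1\<close>, and these functionals determine the norm. Hence the difference
  quotients are Cauchy in norm, and their limit is the derivative.\<close>

lemma weakly_holomorphic_imp_holomorphic: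
  fixes H :: "complex \<Rightarrow> 'x"
  assumes r: "r > 0" and hol: "\<And>\<phi>. (\<lambda>z. p (H z) \<phi>) holomorphic_on ball w r"
    and M: "\<And>z. z \<in> ball w r \<Longrightarrow> norm (H z) \<le> M"
  shows "\<exists>D. (H has_derivative (\<lambda>h. h *\<^sub>C D)) (at w)"
proof -
  define L where "L = 32 * M / r\<^sup>2"
  have M0: "M \<ge> 0" using order_trans[OF norm_ge_zero M[of w]] r by simp
  have L0: "L \<ge> 0" using M0 by (simp add: L_def)
  define g' where "g' = (\<lambda>\<phi>. deriv (\<lambda>z. p (H z) \<phi>) w)"
  have est: "cmod (p (H (w + h)) \<phi> - p (H w) \<phi> - h * g' \<phi>) \<le> L * (cmod h)\<^sup>2"
    if h: "cmod h < r / 2" and \<phi>: "norm \<phi> \<le> 1" for h \<phi>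
    unfolding g'_def L_def
  proof (rule holomorphic_second_order_bound[OF r hol _ h])
    fix z assume "z \<in> ball w r"
    from mult_mono[OF M[OF this] \<phi> M0 norm_ge_zero] show "cmod (p (H z) \<phi>) \<le> M"
      using norm_bound[of "H z" \<phi>] by simp
  qed
  define q where "q = (\<lambda>h. (1 / h) *\<^sub>C (H (w + h) - H w))"
  have q: "cmod (p (q h) \<phi> - g' \<phi>) \<le> L * cmod h" if h: "cmod h < r / 2" "h \<noteq> 0" and \<phi>: "norm \<phi> \<le> 1" for h \<phi>
  proof -
    have "h * (p (q h) \<phi> - g' \<phi>) = p (H (w + h)) \<phi> - p (H w) \<phi> - h * g' \<phi>"
      using h(2) by (simp add: q_def left_simps right_diff_distrib)
    then have "cmod h * cmod (p (q h) \<phi> - g' \<phi>) = cmod (p (H (w + h)) \<phi> - p (H w) \<phi> - h * g' \<phi>)"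
      by (metis norm_mult)
    also have "\<dots> \<le> cmod h * (L * cmod h)" using est[OF h(1) \<phi>] by (simp add: power2_eq_square mult_ac)
    finally show ?thesis using h(2) by (simp add: mult_le_cancel_left)
  qed
  \<comment> \<open>Nonzero increments tending to 0 within radius \<open>r / 2\<close>, where the
    second order bound is valid; they only serve to produce the candidate \<open>D\<close>.\<close>
  define s where "s = (\<lambda>n. complex_of_real (r / 4 / real (Suc n)))"
  have s0: "s n \<noteq> 0" and snorm: "cmod (s n) = r / 4 / real (Suc n)" for n
    using r by (simp_all add: s_def norm_divide del: of_nat_Suc)
  have sle: "cmod (s n) \<le> r / 4" for n
    unfolding snorm using r by (simp add: divide_simps)
  have sr: "cmod (s n) < r / 2" for n using sle[of n] r by linarith
  have slim: "(\<lambda>n. cmod (s n)) \<longlonglongrightarrow> 0"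
    unfolding snorm by (rule LIMSEQ_Suc[OF lim_const_over_n])
  have "Cauchy (\<lambda>n. q (s n))"
  proof (rule metric_CauchyI)
    fix e :: real assume e: "e > 0"
    have "(\<lambda>n. L * cmod (s n)) \<longlonglongrightarrow> 0" by (rule tendsto_mult_right_zero[OF slim])
    then have "\<forall>\<^sub>F n in sequentially. L * cmod (s n) < e / 2"
      using e by (intro order_tendstoD) auto
    then obtain N where N: "\<And>n. n \<ge> N \<Longrightarrow> L * cmod (s n) < e / 2"
      by (auto simp: eventually_sequentially)
    have "dist (q (s m)) (q (s n)) < e" if "m \<ge> N" "n \<ge> N" for m n
    proof -
      have "norm (q (s m) - q (s n)) \<le> L * cmod (s m) + L * cmod (s n)"
      proof (rule norm_leI)
        fix \<phi> :: 'f assume \<phi>: "norm \<phi> \<le> 1"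
        show "cmod (p (q (s m) - q (s n)) \<phi>) \<le> L * cmod (s m) + L * cmod (s n)"
          using q[OF sr s0 \<phi>, of m] q[OF sr s0 \<phi>, of n]
            norm_triangle_ineq4[of "p (q (s m)) \<phi> - g' \<phi>" "p (q (s n)) \<phi> - g' \<phi>"]
          by (simp add: left_simps)
      qed
      then show ?thesis using N that by (smt (verit) dist_norm field_sum_of_halves)
    qed
    then show "\<exists>M. \<forall>m\<ge>M. \<forall>n\<ge>M. dist (q (s m)) (q (s n)) < e" by blast
  qed
  then obtain D where D: "(\<lambda>n. q (s n)) \<longlonglongrightarrow> D" using Cauchy_convergent convergent_def by blast
  have pD: "p D \<phi> = g' \<phi>" if \<phi>: "norm \<phi> \<le> 1" for \<phi>
  proof (rule LIMSEQ_unique)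
    show "(\<lambda>n. p (q (s n)) \<phi>) \<longlonglongrightarrow> p D \<phi>"
      by (rule bounded_linear.tendsto[OF bounded_linear_left D])
    have "(\<lambda>n. p (q (s n)) \<phi> - g' \<phi>) \<longlonglongrightarrow> 0"
      by (rule Lim_null_comparison[OF _ tendsto_mult_right_zero[OF slim, of L]])
        (use q[OF sr s0 \<phi>] in auto)
    then show "(\<lambda>n. p (q (s n)) \<phi>) \<longlonglongrightarrow> g' \<phi>" by (rule LIM_zero_cancel)
  qed
  have main: "norm (H (w + h) - H w - h *\<^sub>C D) \<le> L * cmod h * cmod h" if h: "cmod h < r / 2" for h
  proof (rule norm_leI)
    fix \<phi> :: 'f assume \<phi>: "norm \<phi> \<le> 1"
    show "cmod (p (H (w + h) - H w - h *\<^sub>C D) \<phi>) \<le> L * cmod h * cmod h"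
      using est[OF h \<phi>] by (simp add: left_simps pD[OF \<phi>] power2_eq_square mult_ac)
  qed
  have "(H has_derivative (\<lambda>h. h *\<^sub>C D)) (at w)"
    unfolding has_derivative_at
  proof (intro conjI bounded_linear_scaleC_left)
    have "((\<lambda>h. L * cmod h) \<longlongrightarrow> 0) (at 0)"
      by (intro tendsto_mult_right_zero tendsto_norm_zero tendsto_ident_at)
    moreover have "\<forall>\<^sub>F h in at 0. norm (norm (H (w + h) - H w - h *\<^sub>C D) / norm h) \<le> L * cmod h"
      unfolding eventually_at
    proof (intro exI[of _ "r / 2"] conjI ballI impI)
      fix h :: complex assume h: "h \<noteq> 0 \<and> dist h 0 < r / 2"
      then show "norm (norm (H (w + h) - H w - h *\<^sub>C D) / norm h) \<le> L * cmod h"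
        using main[of h] by (simp add: divide_simps)
    qed (use r in simp)
    ultimately show "((\<lambda>h. norm (H (w + h) - H w - h *\<^sub>C D) / norm h) \<longlongrightarrow> 0) (at 0)"
      by (rule Lim_null_comparison[rotated])
  qed
  then show ?thesis by blast
qed

end

section \<open>The kernel on the real line\<close>

lemma integrable_exp_minus_abs:
  fixes c :: real
  assumes "c > 0"
  shows "integrable lborel (\<lambda>x. exp (- c * \<bar>x\<bar>))"
proof -
  let ?g = "\<lambda>x. indicator {0..} x * exp (- c * x)"
  have "(\<lambda>x. exp (- c * x)) integrable_on {0..}"
    using has_integral_exp_minus_to_infinity[OF assms, of 0] by (auto simp: integrable_on_def)
  then have "(\<lambda>x. exp (- c * x)) absolutely_integrable_on {0..}"
    by (intro nonnegative_absolutely_integrable_1) auto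
  then have "integrable lebesgue ?g" by (simp add: set_integrable_def)
  then have g: "integrable lborel ?g" by (simp add: integrable_completion)
  from lborel_integrable_real_affine[OF g, of "-1" 0]
  have "integrable lborel (\<lambda>x. ?g x + ?g (- x))" using g by simp
  then show ?thesis
    by (rule Bochner_Integration.integrable_bound) (auto simp: indicator_def)
qed

lemma integrable_exp_decay:
  fixes f :: "real \<Rightarrow> complex"
  assumes "continuous_on UNIV f" "c > 0" "\<And>x. cmod (f x) \<le> C * exp (- c * \<bar>x\<bar>)"
  shows "integrable lborel f"
proof (rule Bochner_Integration.integrable_bound)
  show "integrable lborel (\<lambda>x. C * exp (- c * \<bar>x\<bar>))"
    using integrable_exp_minus_abs[OF assms(2)] by simp
  show "f \<in> borel_measurable lborel" using borel_measurable_continuous_onI[OF assms(1)] by simp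
  have "cmod (f x) \<le> \<bar>C * exp (- c * \<bar>x\<bar>)\<bar>" for x using assms(3)[of x] by linarith
  then show "AE x in lborel. cmod (f x) \<le> norm (C * exp (- c * \<bar>x\<bar>))" by simp
qed

lemma contour_integral_linepath_horizontal:
  assumes "x < x'"
  shows "contour_integral (linepath (Complex x a) (Complex x' a)) f = integral {x..x'} (\<lambda>t. f (Complex t a))"
proof -
  let ?c = "\<i> * complex_of_real a"
  have C: "Complex t a = complex_of_real t + ?c" for t by (simp add: complex_eq_iff)
  have "linepath (Complex x a) (Complex x' a) s = linepath (complex_of_real x) (complex_of_real x') s + ?c" for s
    unfolding C by (simp add: linepath_def algebra_simps scaleR_conv_of_real)
  then have "contour_integral (linepath (Complex x a) (Complex x' a)) f =
      contour_integral (linepath (complex_of_real x) (complex_of_real x')) (\<lambda>w. f (w + ?c))"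
    by (simp add: contour_integral_integral C)
  also have "\<dots> = integral {x..x'} (\<lambda>t. f (Complex t a))"
    using assms by (subst contour_integral_linepath_Reals_eq) (auto simp: C)
  finally show ?thesis .
qed

text \<open>The values of \<open>g\<close> inside the bounded part of the strip enter only through the contour
  integrals, so poles there are allowed.\<close>

lemma strip_contour_limit:
  assumes ab: "a < b"
    and cont: "continuous_on {z. a \<le> Im z \<and> Im z \<le> b \<and> (Im z = a \<or> Im z = b \<or> r \<le> \<bar>Re z\<bar>)} g"
    and int: "integrable lborel (\<lambda>x. g (Complex x a))" "integrable lborel (\<lambda>x. g (Complex x b))"
    and side: "\<And>z. a \<le> Im z \<Longrightarrow> Im z \<le> b \<Longrightarrow> r \<le> \<bar>Re z\<bar> \<Longrightarrow> cmod (g z) \<le> d \<bar>Re z\<bar>"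
    and d: "(d \<longlongrightarrow> 0) at_top"
    and c: "\<And>R. R \<ge> r \<Longrightarrow> R > 0 \<Longrightarrow> contour_integral (rectpath (Complex (- R) a) (Complex R b)) g = c"
  shows "(LINT x|lborel. g (Complex x a)) - (LINT x|lborel. g (Complex x b)) = c"
proof (rule LIMSEQ_unique)
  let ?S = "{z. a \<le> Im z \<and> Im z \<le> b \<and> (Im z = a \<or> Im z = b \<or> r \<le> \<bar>Re z\<bar>)}"
  let ?I = "\<lambda>n y. integral {- real n..real n} (\<lambda>x. g (Complex x y))"
  show "(\<lambda>n. ?I n a - ?I n b) \<longlonglongrightarrow> (LINT x|lborel. g (Complex x a)) - (LINT x|lborel. g (Complex x b))"
    by (intro tendsto_diff symmetric_integrals_tendsto int)
  have est: "cmod (?I n a - ?I n b - c) \<le> 2 * (b - a) * d (real n)" if n: "real n \<ge> r" "n > 0" for n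
  proof -
    let ?V = "\<lambda>x. contour_integral (linepath (Complex x a) (Complex x b)) g"
    let ?a1 = "Complex (- real n) a" and ?a2 = "Complex (real n) a"
      and ?a3 = "Complex (real n) b" and ?a4 = "Complex (- real n) b"
    have seg: "closed_segment ?a1 ?a2 \<subseteq> ?S" "closed_segment ?a2 ?a3 \<subseteq> ?S"
      "closed_segment ?a3 ?a4 \<subseteq> ?S" "closed_segment ?a4 ?a1 \<subseteq> ?S"
      using n ab by (auto simp: closed_segment_same_Re closed_segment_same_Im closed_segment_eq_real_ivl split: if_splits)
    have ci: "g contour_integrable_on linepath ?a1 ?a2" "g contour_integrable_on linepath ?a2 ?a3"
      "g contour_integrable_on linepath ?a3 ?a4" "g contour_integrable_on linepath ?a4 ?a1"
      by (intro contour_integrable_continuous_linepath continuous_on_subset[OF cont] seg)+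
    have "c = contour_integral (rectpath ?a1 ?a3) g"
      using c[of "real n"] n by simp
    also have "\<dots> = contour_integral (linepath ?a1 ?a2) g + (contour_integral (linepath ?a2 ?a3) g
        + (contour_integral (linepath ?a3 ?a4) g + contour_integral (linepath ?a4 ?a1) g))"
      unfolding rectpath_def Let_def using ci by (simp add: contour_integrable_joinI)
    also have "contour_integral (linepath ?a1 ?a2) g = ?I n a"
      using n by (intro contour_integral_linepath_horizontal) simp
    also have "contour_integral (linepath ?a3 ?a4) g = - contour_integral (linepath ?a4 ?a3) g"
      by (intro contour_integral_reverse_linepath continuous_on_subset[OF cont seg(3)])
    also have "contour_integral (linepath ?a4 ?a3) g = ?I n b"
      using n by (intro contour_integral_linepath_horizontal) simp
    finally have c_eq: "?I n a - ?I n b - c =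
        - contour_integral (linepath ?a2 ?a3) g - contour_integral (linepath ?a4 ?a1) g" by simp
    have d0: "0 \<le> d (real n)"
      using side[of ?a2] ab n by (auto intro: order_trans[OF norm_ge_zero])
    have seg': "cmod (g z) \<le> d (real n)"
      if "z \<in> closed_segment ?a2 ?a3 \<or> z \<in> closed_segment ?a4 ?a1" for z
    proof -
      have "a \<le> Im z \<and> Im z \<le> b \<and> \<bar>Re z\<bar> = real n"
        using that ab by (auto simp: closed_segment_same_Re closed_segment_eq_real_ivl split: if_splits)
      then show ?thesis using side[of z] n by simp
    qed
    have len: "cmod (?a3 - ?a2) = b - a" "cmod (?a1 - ?a4) = b - a"
      using ab by (auto simp: cmod_def)
    have "cmod (?I n a - ?I n b - c) \<le> cmod (contour_integral (linepath ?a2 ?a3) g)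
        + cmod (contour_integral (linepath ?a4 ?a1) g)"
      unfolding c_eq by (metis norm_minus_cancel norm_triangle_ineq4)
    also have "\<dots> \<le> d (real n) * cmod (?a3 - ?a2) + d (real n) * cmod (?a1 - ?a4)"
      by (intro add_mono contour_integral_bound_linepath[OF ci(2) d0]
          contour_integral_bound_linepath[OF ci(4) d0]) (simp_all add: seg')
    also have "\<dots> = 2 * (b - a) * d (real n)" unfolding len by simp
    finally show ?thesis .
  qed
  have dn: "(\<lambda>n. 2 * (b - a) * d (real n)) \<longlonglongrightarrow> 0"
    by (rule tendsto_mult_right_zero[OF filterlim_compose[OF d filterlim_real_sequentially]])
  have "\<forall>\<^sub>F n in sequentially. cmod (?I n a - ?I n b - c) \<le> 2 * (b - a) * d (real n)"
    using eventually_ge_at_top[of "nat \<lceil>r\<rceil>"] eventually_gt_at_top[of 0]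
    by eventually_elim (rule est, linarith+)
  then have "(\<lambda>n. ?I n a - ?I n b - c) \<longlonglongrightarrow> 0"
    using dn by (rule Lim_null_comparison)
  then show "(\<lambda>n. ?I n a - ?I n b) \<longlonglongrightarrow> c"
    by (rule LIM_zero_cancel)
qed

section \<open>The integral defining the kernel and its closed form\<close>

text \<open>Two bounds are combined: \<open>\<mu>\<close> has positive distance \<open>d\<close>
  from the cut, and the triangle inequality gives growth in \<open>x\<close>. With \<open>m\<close>
  the modulus on the right, \<open>x + 1 \<le> m + cmod \<mu> + 1 \<le> m * (1 + (cmod \<mu> + 1) /
  d)\<close>, which explains \<open>\<kappa>\<close>.\<close>

lemma cmod_of_real_add_lower_bound:
  assumes "\<mu> \<notin> \<real>\<^sub>\<le>\<^sub>0"
  shows "\<exists>\<kappa>>0. \<forall>x\<ge>0. \<kappa> * (x + 1) \<le> cmod (complex_of_real x + \<mu>)"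
proof -
  have "open (- (\<real>\<^sub>\<le>\<^sub>0 :: complex set))" using closed_nonpos_Reals_complex by blast
  then obtain d where d: "d > 0" "ball \<mu> d \<subseteq> - \<real>\<^sub>\<le>\<^sub>0"
    using assms by (meson ComplI open_contains_ball)
  have lower: "d \<le> cmod (complex_of_real x + \<mu>)" if "x \<ge> 0" for x
  proof (rule ccontr)
    assume "\<not> ?thesis"
    then have "- complex_of_real x \<in> ball \<mu> d" by (simp add: dist_norm add.commute)
    with d(2) have "- complex_of_real x \<notin> \<real>\<^sub>\<le>\<^sub>0" by blast
    then show False using that by (simp add: complex_nonpos_Reals_iff)
  qed
  define \<kappa> where "\<kappa> = 1 / (1 + (cmod \<mu> + 1) / d)"
  have \<kappa>: "\<kappa> > 0" using d(1) by (simp add: \<kappa>_def add_pos_nonneg)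
  have "\<kappa> * (x + 1) \<le> cmod (complex_of_real x + \<mu>)" if x: "x \<ge> 0" for x
  proof -
    let ?m = "cmod (complex_of_real x + \<mu>)"
    have "x \<le> ?m + cmod \<mu>"
      using norm_triangle_ineq4[of "complex_of_real x + \<mu>" \<mu>] x by simp
    moreover have "cmod \<mu> + 1 \<le> ?m * ((cmod \<mu> + 1) / d)"
      using mult_right_mono[OF lower[OF x], of "(cmod \<mu> + 1) / d"] d(1) by simp
    ultimately have "x + 1 \<le> ?m * (1 + (cmod \<mu> + 1) / d)" by (simp add: distrib_left)
    moreover have "1 + (cmod \<mu> + 1) / d > 0" using d(1) by (simp add: add_pos_nonneg)
    ultimately show ?thesis unfolding \<kappa>_def by (simp add: pos_divide_le_eq)
  qed
  with \<kappa> show ?thesis by blast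
qed

lemma exp_div_square_le:
  "exp x / (exp x + 1)\<^sup>2 \<le> exp (- \<bar>x\<bar>)" for x :: real
proof -
  have "0 < exp x + 1" by (simp add: add_pos_pos)
  then have pos: "0 < (exp x + 1)\<^sup>2" by (rule zero_less_power)
  have "exp x \<le> exp (- \<bar>x\<bar>) * (exp x + 1)\<^sup>2"
  proof (cases "x \<ge> 0")
    case True
    have "exp x * exp x \<le> (exp x + 1)\<^sup>2" by (simp add: power2_eq_square algebra_simps)
    then show ?thesis using True by (simp add: exp_minus field_simps)
  next
    case False
    have "1 \<le> (exp x + 1)\<^sup>2" by (simp add: one_le_power)
    then show ?thesis using False by simp
  qed
  then show ?thesis using pos by (simp add: pos_divide_le_eq)
qed

text \<open>The dependence on \<open>t\<close> is a phase of modulus 1, so one bound serves all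
  \<open>t\<close> and can dominate limits in \<open>t\<close>.\<close>

lemma exp_kernel_bound:
  assumes "\<mu> \<notin> \<real>\<^sub>\<le>\<^sub>0"
  shows "\<exists>C. \<forall>t E. cmod (exp (complex_of_real E * (1 + \<i> * complex_of_real t)) /
     (exp (complex_of_real E) + \<mu>)\<^sup>2) \<le> C * exp (- \<bar>E\<bar>)"
proof -
  obtain \<kappa> where \<kappa>: "\<kappa> > 0" "\<And>x. x \<ge> 0 \<Longrightarrow> \<kappa> * (x + 1) \<le> cmod (complex_of_real x + \<mu>)"
    using cmod_of_real_add_lower_bound[OF assms] by blast
  have "cmod (exp (complex_of_real E * (1 + \<i> * complex_of_real t)) /
     (exp (complex_of_real E) + \<mu>)\<^sup>2) \<le> 1 / \<kappa>\<^sup>2 * exp (- \<bar>E\<bar>)" for t E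
  proof -
    have pos: "0 < \<kappa> * (exp E + 1)" using \<kappa>(1) by (intro mult_pos_pos add_pos_pos) auto
    have "\<kappa> * (exp E + 1) \<le> cmod (exp (complex_of_real E) + \<mu>)"
      using \<kappa>(2)[of "exp E"] by (simp add: exp_of_real)
    from power_mono[OF this less_imp_le[OF pos], of 2]
    have "exp E / (cmod (exp (complex_of_real E) + \<mu>))\<^sup>2 \<le> exp E / (\<kappa> * (exp E + 1))\<^sup>2"
      using zero_less_power[OF pos, of 2]
      by (intro divide_left_mono mult_pos_pos) (auto simp del: zero_less_power2)
    also have "\<dots> = 1 / \<kappa>\<^sup>2 * (exp E / (exp E + 1)\<^sup>2)" by (simp add: power_mult_distrib)
    also have "\<dots> \<le> 1 / \<kappa>\<^sup>2 * exp (- \<bar>E\<bar>)"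
      by (intro mult_left_mono exp_div_square_le) simp
    finally show ?thesis by (simp add: norm_divide norm_power)
  qed
  then show ?thesis by blast
qed

lemma exp_add_nonzero:
  assumes "\<mu> \<notin> \<real>\<^sub>\<le>\<^sub>0"
  shows "exp (complex_of_real E) + \<mu> \<noteq> 0"
proof
  assume "exp (complex_of_real E) + \<mu> = 0"
  then have "\<mu> = - complex_of_real (exp E)" by (simp add: exp_of_real eq_neg_iff_add_eq_0 add.commute)
  then show False using assms by (simp add: complex_nonpos_Reals_iff)
qed

lemma exp_kernel_integrable:
  assumes "\<mu> \<notin> \<real>\<^sub>\<le>\<^sub>0"
  shows "integrable lborel (\<lambda>E. exp (complex_of_real E * (1 + \<i> * complex_of_real t)) /
     (exp (complex_of_real E) + \<mu>)\<^sup>2)"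
proof -
  obtain C where C: "\<And>E. cmod (exp (complex_of_real E * (1 + \<i> * complex_of_real t)) /
     (exp (complex_of_real E) + \<mu>)\<^sup>2) \<le> C * exp (- \<bar>E\<bar>)"
    using exp_kernel_bound[OF assms] by blast
  show ?thesis
    using C exp_add_nonzero[OF assms]
    by (intro integrable_exp_decay[of _ 1 C] continuous_intros) auto
qed

text \<open>Dominated convergence with a bound independent of \<open>t\<close>. It serves to
  determine the kernel at \<open>t = 0\<close>, where the closed formula gives no meaningful
  value.\<close>

lemma F_kernel_sequentially_continuous:
  assumes \<mu>: "\<mu> \<notin> \<real>\<^sub>\<le>\<^sub>0" and s: "s \<longlonglongrightarrow> t"
  shows "(\<lambda>n. F_kernel \<mu> (s n)) \<longlonglongrightarrow> F_kernel \<mu> t"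
proof -
  obtain C where C: "\<And>E t. cmod (exp (complex_of_real E * (1 + \<i> * complex_of_real t)) /
     (exp (complex_of_real E) + \<mu>)\<^sup>2) \<le> C * exp (- \<bar>E\<bar>)"
    using exp_kernel_bound[OF \<mu>] by blast
  have "(\<lambda>n. LINT E|lborel. exp (complex_of_real E * (1 + \<i> * complex_of_real (s n))) / (exp (complex_of_real E) + \<mu>)\<^sup>2)
    \<longlonglongrightarrow> (LINT E|lborel. exp (complex_of_real E * (1 + \<i> * complex_of_real t)) / (exp (complex_of_real E) + \<mu>)\<^sup>2)"
  proof (rule integral_dominated_convergence[where w = "\<lambda>E. C * exp (- \<bar>E\<bar>)"])
    show "integrable lborel (\<lambda>E. C * exp (- \<bar>E\<bar>))"
      using integrable_exp_minus_abs[of 1] by simp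
    show "AE E in lborel. (\<lambda>n. exp (complex_of_real E * (1 + \<i> * complex_of_real (s n))) / (exp (complex_of_real E) + \<mu>)\<^sup>2)
      \<longlonglongrightarrow> exp (complex_of_real E * (1 + \<i> * complex_of_real t)) / (exp (complex_of_real E) + \<mu>)\<^sup>2"
      using s exp_add_nonzero[OF \<mu>] by (intro AE_I2 tendsto_intros) auto
  qed (use C exp_kernel_integrable[OF \<mu>] in auto)
  then show ?thesis unfolding F_kernel_def by (intro tendsto_intros)
qed

lemma exp_kernel_rectangle_integral:
  assumes \<mu>: "\<mu> \<notin> \<real>\<^sub>\<le>\<^sub>0" and R: "R > \<bar>Re (Ln \<mu>)\<bar>"
  shows "contour_integral (rectpath (Complex (- R) 0) (Complex R (2 * pi)))
      (\<lambda>z. exp (z * (1 + \<i> * complex_of_real t)) / (exp z + \<mu>)\<^sup>2) =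
    2 * pi * t * \<mu> powr (\<i> * complex_of_real t - 1) * exp (- pi * t)"
proof -
  have \<mu>0: "\<mu> \<noteq> 0" using \<mu> by auto
  \<comment> \<open>The pole: the zeros of \<open>exp z + \<mu>\<close> are \<open>z0\<close>
    shifted by multiples of \<open>2 * pi * \<i>\<close>. Since \<open>\<mu>\<close> is off the cut,
    \<open>\<bar>Im (Ln \<mu>)\<bar> < pi\<close>, so \<open>z0\<close> lies strictly between the
    two horizontal sides.\<close>
  define z0 where "z0 = Ln \<mu> + \<i> * pi"
  have Im: "0 < Im z0" "Im z0 < 2 * pi"
  proof -
    have "- pi < Im (Ln \<mu>)" "Im (Ln \<mu>) < pi"
      using mpi_less_Im_Ln[OF \<mu>0] Im_Ln_less_pi[of \<mu>] \<mu> \<mu>0 Im_Ln_le_pi[OF \<mu>0] Im_Ln_eq_pi[of \<mu>]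
      by (auto simp: complex_nonpos_Reals_iff order.strict_iff_order)
    then show "0 < Im z0" "Im z0 < 2 * pi" by (auto simp: z0_def)
  qed
  have ez0: "exp z0 = - \<mu>" using \<mu>0 by (simp add: z0_def exp_add mult.commute)
  \<comment> \<open>Reaches up and down from \<open>z0\<close> by \<open>2 * pi\<close>; being open,
    it contains no other zero, and it contains the closed rectangle.\<close>
  define S where "S = {z. Im z0 - 2 * pi < Im z} \<inter> {z. Im z < Im z0 + 2 * pi}"
  have "open S" unfolding S_def by (intro open_Int open_halfspace_Im_gt open_halfspace_Im_lt)
  have "convex S" unfolding S_def by (intro convex_Int convex_halfspace_Im_gt convex_halfspace_Im_lt)
  have nz: "exp z + \<mu> \<noteq> 0" if "z \<in> S - {z0}" for z
  proof
    assume "exp z + \<mu> = 0"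
    then have "exp z = exp z0" by (simp add: ez0 eq_neg_iff_add_eq_0)
    then obtain n :: int where n: "z = z0 + complex_of_real (of_int (2 * n) * pi) * \<i>"
      by (auto simp: exp_eq)
    then have "- 1 * pi < real_of_int n * pi" "real_of_int n * pi < 1 * pi"
      using that by (auto simp: S_def algebra_simps)
    then have "- 1 < real_of_int n" "real_of_int n < 1"
      by (simp_all only: mult_less_cancel_right_pos[OF pi_gt_zero])
    then have "n = 0" by linarith
    with n that show False by simp
  qed
  let ?r = "rectpath (Complex (- R) 0) (Complex R (2 * pi))"
  have R0: "R > 0" using R by linarith
  have z0_in: "z0 \<in> box (Complex (- R) 0) (Complex R (2 * pi))"
    using Im R by (auto simp: in_box_complex_iff z0_def)
  have cb: "cbox (Complex (- R) 0) (Complex R (2 * pi)) \<subseteq> S"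
    using Im by (auto simp: S_def in_cbox_complex_iff)
  have path: "path_image ?r \<subseteq> S - {z0}"
    using path_image_rectpath_cbox_minus_box[of "Complex (- R) 0" "Complex R (2 * pi)"] cb z0_in R0 by auto
  \<comment> \<open>The double pole of \<open>g\<close> is reduced to the simple pole of
    \<open>q\<close>: \<open>g\<close> is \<open>\<i> * t * q\<close> minus the derivative of
    \<open>q\<close>, and the latter integrates to 0 over a closed path.\<close>
  define q where "q = (\<lambda>z. exp (\<i> * complex_of_real t * z) / (exp z + \<mu>))"
  define g where "g = (\<lambda>z. exp (z * (1 + \<i> * complex_of_real t)) / (exp z + \<mu>)\<^sup>2)"
  have q': "(q has_field_derivative (\<i> * complex_of_real t * q z - g z)) (at z within S - {z0})"
    if "z \<in> S - {z0}" for z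
  proof -
    have "exp (z * (1 + \<i> * complex_of_real t)) = exp z * exp (\<i> * complex_of_real t * z)"
      by (simp add: exp_add[symmetric] algebra_simps)
    then have g: "g z = exp z * exp (\<i> * complex_of_real t * z) / ((exp z + \<mu>) * (exp z + \<mu>))"
      by (simp add: g_def power2_eq_square)
    have "(q has_field_derivative (\<i> * complex_of_real t * exp (\<i> * complex_of_real t * z) * (exp z + \<mu>)
        - exp (\<i> * complex_of_real t * z) * exp z) / ((exp z + \<mu>) * (exp z + \<mu>))) (at z within S - {z0})"
      unfolding q_def using nz[OF that] by (auto intro!: derivative_eq_intros)
    then show ?thesis
      unfolding g q_def using nz[OF that] by (simp add: diff_divide_distrib mult.commute)
  qed
  have prim: "((\<lambda>z. \<i> * complex_of_real t * q z - g z) has_contour_integral 0) ?r"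
    using contour_integral_primitive[OF q' _ path] by simp
  have holq: "q holomorphic_on S - {z0}"
    unfolding q_def using nz by (intro holomorphic_intros) auto
  have "contour_integral ?r q = 2 * pi * \<i> * (\<Sum>p\<in>{z0}. winding_number ?r p * residue q p)"
  proof (rule Residue_theorem[OF \<open>open S\<close> convex_connected[OF \<open>convex S\<close>] _ holq _ _ path])
    show "\<forall>z. z \<notin> S \<longrightarrow> winding_number ?r z = 0"
      using cb R0 by (auto intro!: winding_number_rectpath_outside)
  qed auto
  also have "\<dots> = 2 * pi * \<i> * residue q z0"
    using winding_number_rectpath[OF z0_in] by simp
  also have "residue q z0 = exp (\<i> * complex_of_real t * z0) / (- \<mu>)"
    unfolding q_def
  proof (rule residue_simple_pole_deriv[where s = UNIV])
    show "((\<lambda>w. exp w + \<mu>) has_field_derivative - \<mu>) (at z0)"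
      by (auto intro!: derivative_eq_intros simp: ez0)
  qed (use \<mu>0 ez0 in \<open>auto intro!: holomorphic_intros\<close>)
  finally have cq: "contour_integral ?r q = 2 * pi * \<i> * (exp (\<i> * complex_of_real t * z0) / (- \<mu>))" .
  have "q contour_integrable_on ?r"
    using holq path \<open>open S\<close> by (intro contour_integrable_holomorphic_simple[of q "S - {z0}"]) auto
  then have "(q has_contour_integral contour_integral ?r q) ?r"
    by (rule has_contour_integral_integral)
  from has_contour_integral_diff[OF has_contour_integral_lmul[OF this, of "\<i> * complex_of_real t"] prim]
  have "(g has_contour_integral (\<i> * complex_of_real t * contour_integral ?r q)) ?r" by simp
  then have "contour_integral ?r g = \<i> * complex_of_real t * contour_integral ?r q"
    by (rule contour_integral_unique)
  also have "\<dots> = 2 * pi * t * (exp (\<i> * complex_of_real t * z0) / \<mu>)"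
    unfolding cq by (simp add: field_simps)
  also have "exp (\<i> * complex_of_real t * z0) / \<mu> = \<mu> powr (\<i> * complex_of_real t - 1) * exp (- pi * t)"
  proof -
    have "exp (\<i> * complex_of_real t * z0) = exp (\<i> * complex_of_real t * Ln \<mu>) * exp (- pi * t)"
      by (simp add: z0_def exp_add[symmetric] exp_of_real[symmetric] algebra_simps)
    then show ?thesis using \<mu>0 by (simp add: powr_def exp_diff left_diff_distrib)
  qed
  finally show ?thesis by (simp add: g_def)
qed

text \<open>A shift by \<open>2 * pi * \<i>\<close> multiplies the integrand by
  \<open>exp (- 2 * pi * t)\<close>. The difference of the integrals over the two lines is thus
  \<open>(1 - exp (- 2 * pi * t)) * I\<close> and equals the residue contribution; dividing needs
  \<open>t \<noteq> 0\<close>.\<close>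

lemma F_kernel_eq_F_closed:
  assumes \<mu>: "\<mu> \<notin> \<real>\<^sub>\<le>\<^sub>0" and "t \<noteq> 0"
  shows "F_kernel \<mu> t = F_closed \<mu> t"
proof -
  define g where "g = (\<lambda>z. exp (z * (1 + \<i> * complex_of_real t)) / (exp z + \<mu>)\<^sup>2)"
  define I where "I = (LINT E|lborel. g (complex_of_real E))"
  have \<mu>0: "\<mu> \<noteq> 0" using \<mu> by auto
  have int0: "integrable lborel (\<lambda>E. g (complex_of_real E))"
    unfolding g_def using exp_kernel_integrable[OF \<mu>, of t] by (simp add: exp_of_real)
  have bot: "Complex E 0 = complex_of_real E" for E by (simp add: complex_eq_iff)
  have top: "g (Complex E (2 * pi)) = exp (- 2 * pi * t) * g (complex_of_real E)" for E
  proof -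
    have E: "Complex E (2 * pi) = complex_of_real E + 2 * complex_of_real pi * \<i>" by (simp add: complex_eq_iff)
    have "exp (Complex E (2 * pi)) = exp (complex_of_real E)"
      unfolding E by (simp add: exp_add)
    moreover have "exp (Complex E (2 * pi) * (1 + \<i> * complex_of_real t)) =
        exp (complex_of_real E * (1 + \<i> * complex_of_real t)) * exp (2 * complex_of_real pi * \<i>) * exp (- 2 * pi * t)"
    proof -
      have "Complex E (2 * pi) * (1 + \<i> * complex_of_real t) =
          complex_of_real E * (1 + \<i> * complex_of_real t) + 2 * complex_of_real pi * \<i> + complex_of_real (- 2 * pi * t)"
        unfolding E by (simp add: algebra_simps)
      then show ?thesis by (simp only: exp_add exp_of_real)
    qed
    ultimately show ?thesis by (simp add: g_def)
  qed
  have d: "\<exists>d R0. (d \<longlongrightarrow> 0) at_top \<and> R0 > \<bar>Re (Ln \<mu>)\<bar> \<and>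
    (\<forall>z. 0 \<le> Im z \<longrightarrow> Im z \<le> 2 * pi \<longrightarrow> R0 \<le> \<bar>Re z\<bar> \<longrightarrow> exp z + \<mu> \<noteq> 0 \<and> cmod (g z) \<le> d \<bar>Re z\<bar>)"
  proof -
    \<comment> \<open>Beyond \<open>?R\<close> one of \<open>exp (Re z)\<close> and
      \<open>cmod \<mu>\<close> is at least twice the other, so \<open>cmod (exp z + \<mu>)\<close>
      is at least half the larger one. Squaring gives the 4 in \<open>?C\<close>; the factor
      \<open>exp (2 * pi * \<bar>t\<bar>)\<close> comes from
      \<open>Im z \<le> 2 * pi\<close>.\<close>
    let ?R = "\<bar>ln (cmod \<mu>)\<bar> + ln 2"
    let ?C = "4 * exp (2 * pi * \<bar>t\<bar>) * (1 + 1 / (cmod \<mu>)\<^sup>2)"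
    have "exp z + \<mu> \<noteq> 0 \<and> cmod (g z) \<le> ?C * exp (- \<bar>Re z\<bar>)"
      if z: "0 \<le> Im z" "Im z \<le> 2 * pi" "?R \<le> \<bar>Re z\<bar>" for z
    proof -
      have num: "cmod (exp (z * (1 + \<i> * complex_of_real t))) \<le> exp (Re z) * exp (2 * pi * \<bar>t\<bar>)"
      proof -
        have "\<bar>Im z * t\<bar> \<le> 2 * pi * \<bar>t\<bar>"
          unfolding abs_mult using z by (intro mult_right_mono) auto
        then have "- (Im z * t) \<le> 2 * pi * \<bar>t\<bar>" by linarith
        then show ?thesis by (simp add: exp_add[symmetric] algebra_simps)
      qed
      show ?thesis
      proof (cases "Re z \<ge> 0")
        case True
        have "2 * cmod \<mu> \<le> exp (Re z)"
        proof -
          have "ln (2 * cmod \<mu>) \<le> Re z" using z True \<mu>0 by (simp add: ln_mult)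
          then have "exp (ln (2 * cmod \<mu>)) \<le> exp (Re z)" by (simp only: exp_le_cancel_iff)
          then show ?thesis using \<mu>0 by simp
        qed
        then have den: "exp (Re z) / 2 \<le> cmod (exp z + \<mu>)"
          using norm_triangle_ineq4[of "exp z + \<mu>" \<mu>] by simp
        have pos: "0 < exp (Re z) / 2" by simp
        have "cmod (g z) \<le> exp (Re z) * exp (2 * pi * \<bar>t\<bar>) / (exp (Re z) / 2)\<^sup>2"
          unfolding g_def norm_divide norm_power using num power_mono[OF den, of 2] zero_less_power[OF pos, of 2]
          by (intro frac_le) auto
        also have "\<dots> = 4 * exp (2 * pi * \<bar>t\<bar>) * exp (- \<bar>Re z\<bar>)"
          using True by (simp add: power2_eq_square exp_minus field_simps)
        also have "\<dots> \<le> ?C * exp (- \<bar>Re z\<bar>)" by (intro mult_right_mono) (simp_all add: distrib_left)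
        finally show ?thesis using den pos by auto
      next
        case False
        have "2 * exp (Re z) \<le> cmod \<mu>"
        proof -
          have "Re z + ln 2 \<le> ln (cmod \<mu>)" using z False by linarith
          then have "exp (Re z + ln 2) \<le> exp (ln (cmod \<mu>))" by (simp only: exp_le_cancel_iff)
          then show ?thesis using \<mu>0 by (simp add: exp_add)
        qed
        then have den: "cmod \<mu> / 2 \<le> cmod (exp z + \<mu>)"
          using norm_triangle_ineq4[of "exp z + \<mu>" "exp z"] by simp
        have pos: "0 < cmod \<mu> / 2" using \<mu>0 by simp
        have "cmod (g z) \<le> exp (Re z) * exp (2 * pi * \<bar>t\<bar>) / (cmod \<mu> / 2)\<^sup>2"
          unfolding g_def norm_divide norm_power using num power_mono[OF den, of 2] zero_less_power[OF pos, of 2]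
          by (intro frac_le) auto
        also have "\<dots> = 4 * exp (2 * pi * \<bar>t\<bar>) * (1 / (cmod \<mu>)\<^sup>2) * exp (- \<bar>Re z\<bar>)"
          using False by (simp add: power2_eq_square field_simps)
        also have "\<dots> \<le> ?C * exp (- \<bar>Re z\<bar>)" by (intro mult_right_mono) (simp_all add: distrib_left)
        finally show ?thesis using den pos by auto
      qed
    qed
    moreover have "((\<lambda>x. ?C * exp (- x)) \<longlongrightarrow> 0) at_top"
      by (intro tendsto_mult_right_zero filterlim_compose[OF exp_at_bot] filterlim_uminus_at_bot_at_top)
    moreover have "?R > \<bar>Re (Ln \<mu>)\<bar>" using \<mu>0 by simp
    ultimately show ?thesis by (intro exI[of _ "\<lambda>x. ?C * exp (- x)"] exI[of _ ?R]) auto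
  qed
  then obtain d R0 where d: "(d \<longlongrightarrow> 0) at_top" "R0 > \<bar>Re (Ln \<mu>)\<bar>"
    and far: "\<And>z. 0 \<le> Im z \<Longrightarrow> Im z \<le> 2 * pi \<Longrightarrow> R0 \<le> \<bar>Re z\<bar> \<Longrightarrow> exp z + \<mu> \<noteq> 0"
      "\<And>z. 0 \<le> Im z \<Longrightarrow> Im z \<le> 2 * pi \<Longrightarrow> R0 \<le> \<bar>Re z\<bar> \<Longrightarrow> cmod (g z) \<le> d \<bar>Re z\<bar>"
    by blast
  have nz: "exp z + \<mu> \<noteq> 0" if "0 \<le> Im z" "Im z \<le> 2 * pi" "Im z = 0 \<or> Im z = 2 * pi \<or> R0 \<le> \<bar>Re z\<bar>" for z
  proof -
    have "exp z = exp (complex_of_real (Re z))" if "Im z = 0 \<or> Im z = 2 * pi"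
      using that by (auto simp: exp_eq_polar[of z] exp_of_real cis_2pi)
    then show ?thesis using that exp_add_nonzero[OF \<mu>, of "Re z"] far(1)[of z] by auto
  qed
  have "(LINT x|lborel. g (Complex x 0)) - (LINT x|lborel. g (Complex x (2 * pi))) =
      2 * pi * t * \<mu> powr (\<i> * complex_of_real t - 1) * exp (- pi * t)"
  proof (rule strip_contour_limit[OF _ _ _ _ far(2) d(1)])
    show "continuous_on {z. 0 \<le> Im z \<and> Im z \<le> 2 * pi \<and> (Im z = 0 \<or> Im z = 2 * pi \<or> R0 \<le> \<bar>Re z\<bar>)} g"
      unfolding g_def using nz by (intro continuous_intros) auto
    show "integrable lborel (\<lambda>x. g (Complex x 0))" unfolding bot by (rule int0)
    show "integrable lborel (\<lambda>x. g (Complex x (2 * pi)))" unfolding top using int0 by simp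
    show "contour_integral (rectpath (Complex (- R) 0) (Complex R (2 * pi))) g =
        2 * pi * t * \<mu> powr (\<i> * complex_of_real t - 1) * exp (- pi * t)" if "R \<ge> R0" for R
      unfolding g_def by (rule exp_kernel_rectangle_integral[OF \<mu>]) (use that d(2) in linarith)
  qed auto
  then have "I - exp (- 2 * pi * t) * I = 2 * pi * t * \<mu> powr (\<i> * complex_of_real t - 1) * exp (- pi * t)"
    unfolding bot top I_def by simp
  then have "I * (1 - exp (- 2 * pi * t)) = 2 * pi * t * \<mu> powr (\<i> * complex_of_real t - 1) * exp (- pi * t)"
    by (simp add: algebra_simps)
  \<comment> \<open>Splits off the \<open>exp (- pi * t)\<close> that the residue also carries,
    leaving the symmetric denominator of \<open>F_closed\<close>.\<close>
  moreover have "complex_of_real (1 - exp (- 2 * pi * t)) = complex_of_real (exp (pi * t) - exp (- pi * t)) * exp (- pi * t)"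
    unfolding of_real_mult[symmetric] of_real_eq_iff by (simp add: left_diff_distrib exp_add[symmetric])
  ultimately have "I * complex_of_real (exp (pi * t) - exp (- pi * t)) = 2 * pi * t * \<mu> powr (\<i> * complex_of_real t - 1)"
    by simp
  moreover have "complex_of_real (exp (pi * t) - exp (- pi * t)) \<noteq> 0"
    using \<open>t \<noteq> 0\<close> by (simp del: of_real_diff)
  ultimately have "I = 2 * pi * (t * \<mu> powr (\<i> * complex_of_real t - 1) / complex_of_real (exp (pi * t) - exp (- pi * t)))"
    by (simp add: field_simps)
  then show ?thesis
    unfolding F_kernel_def F_closed_def I_def g_def by simp
qed

section \<open>The kernel on the strip\<close>

text \<open>By the reflection formula the Gamma product is \<open>pi * w / sinh (pi * w)\<close>. In
  this form the singularity of the closed formula at 0 is already removed, and the remaining poles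
  are the nonzero integer multiples of \<open>\<i>\<close>.\<close>

definition strip_kernel :: "complex \<Rightarrow> complex \<Rightarrow> complex" where
  "strip_kernel \<mu> w = \<mu> powr (\<i> * w - 1) * Gamma (1 + \<i> * w) * Gamma (1 - \<i> * w) / (2 * pi)"

lemma not_nonpos_Ints_if_Re_pos: "Re z > 0 \<Longrightarrow> z \<notin> \<int>\<^sub>\<le>\<^sub>0"
  by (auto elim!: nonpos_Ints_cases)

lemma strip_kernel_holomorphic:
  assumes "\<mu> \<noteq> 0"
  shows "strip_kernel \<mu> holomorphic_on {w. \<bar>Im w\<bar> < 1}"
proof -
  have "1 + \<i> * w \<notin> \<int>\<^sub>\<le>\<^sub>0" "1 - \<i> * w \<notin> \<int>\<^sub>\<le>\<^sub>0" if "\<bar>Im w\<bar> < 1" for w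
    using that by (auto intro!: not_nonpos_Ints_if_Re_pos)
  then show ?thesis
    unfolding strip_kernel_def powr_def using assms by (auto intro!: holomorphic_intros)
qed

lemma open_horizontal_strip: "open {w. \<bar>Im w\<bar> < c}"
  by (intro open_Collect_less continuous_intros)

lemma strip_kernel_0: "\<mu> \<noteq> 0 \<Longrightarrow> strip_kernel \<mu> 0 = 1 / (2 * pi * \<mu>)" for \<mu> :: complex
  by (simp add: strip_kernel_def powr_minus field_simps)

lemma strip_kernel_eq_sinh:
  fixes w :: complex
  assumes "Re w \<noteq> 0"
  shows "strip_kernel \<mu> w = w * \<mu> powr (\<i> * w - 1) / (exp (pi * w) - exp (- pi * w))"
proof -
  have w: "\<i> * w \<notin> \<int>\<^sub>\<le>\<^sub>0" using assms by (auto elim!: nonpos_Ints_cases simp: complex_eq_iff)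
  have "sin (pi * (\<i> * w)) = (exp (- pi * w) - exp (pi * w)) / (2 * \<i>)"
    by (simp add: sin_exp_eq mult_ac)
  note sin = this
  have "Gamma (1 + \<i> * w) * Gamma (1 - \<i> * w) = \<i> * w * (Gamma (\<i> * w) * Gamma (1 - \<i> * w))"
    using Gamma_plus1[OF w] by (simp add: add.commute)
  also have "\<dots> = \<i> * w * (pi * (2 * \<i>) / (exp (- pi * w) - exp (pi * w)))"
    by (simp only: Gamma_reflection_complex sin divide_divide_eq_right)
  also have "\<dots> = w * (2 * pi) / (exp (pi * w) - exp (- pi * w))"
    using minus_divide_right[of "w * (2 * pi)" "exp (- pi * w) - exp (pi * w)"] by (simp add: algebra_simps)
  finally have "Gamma (1 + \<i> * w) * Gamma (1 - \<i> * w) = w * (2 * pi) / (exp (pi * w) - exp (- pi * w))" .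
  then show ?thesis by (simp add: strip_kernel_def mult.assoc)
qed

lemma strip_kernel_of_real: "t \<noteq> 0 \<Longrightarrow> strip_kernel \<mu> (complex_of_real t) = F_closed \<mu> t"
  by (simp add: strip_kernel_eq_sinh F_closed_def flip: exp_of_real)

lemma strip_kernel_isCont:
  assumes "\<mu> \<noteq> 0" "\<bar>Im w\<bar> < 1"
  shows "isCont (strip_kernel \<mu>) w"
  using holomorphic_on_imp_continuous_on[OF strip_kernel_holomorphic[OF assms(1)]] assms(2)
  by (simp add: continuous_on_eq_continuous_at open_horizontal_strip)

lemma F_closed_tendsto:
  assumes "\<mu> \<noteq> 0"
  shows "(F_closed \<mu> \<longlongrightarrow> strip_kernel \<mu> 0) (at 0)"
proof -
  have "((\<lambda>t. strip_kernel \<mu> (complex_of_real t)) \<longlongrightarrow> strip_kernel \<mu> 0) (at 0)"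
    by (rule isCont_tendsto_compose[OF strip_kernel_isCont[OF assms]])
      (auto intro!: tendsto_eq_intros)
  then show ?thesis
    by (rule Lim_transform_eventually) (auto simp: eventually_at_filter strip_kernel_of_real)
qed

lemma F_kernel_eq_strip_kernel:
  assumes \<mu>: "\<mu> \<notin> \<real>\<^sub>\<le>\<^sub>0"
  shows "F_kernel \<mu> t = strip_kernel \<mu> (complex_of_real t)"
proof (cases "t = 0")
  case False
  then show ?thesis using F_kernel_eq_F_closed[OF \<mu>] strip_kernel_of_real by simp
next
  case True
  have \<mu>0: "\<mu> \<noteq> 0" using \<mu> by auto
  \<comment> \<open>At 0 both functions are limits of their values at
    \<open>1 / real (Suc n)\<close>, where the closed formula is available.\<close>
  let ?s = "\<lambda>n. 1 / real (Suc n)"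
  have s: "?s \<longlonglongrightarrow> 0" by (rule LIMSEQ_Suc[OF lim_const_over_n])
  have "(\<lambda>n. F_kernel \<mu> (?s n)) \<longlonglongrightarrow> F_kernel \<mu> 0"
    by (rule F_kernel_sequentially_continuous[OF \<mu> s])
  moreover have "F_kernel \<mu> (?s n) = strip_kernel \<mu> (complex_of_real (?s n))" for n
    by (subst F_kernel_eq_F_closed[OF \<mu>], simp, rule strip_kernel_of_real[symmetric], simp)
  moreover have "(\<lambda>n. strip_kernel \<mu> (complex_of_real (?s n))) \<longlonglongrightarrow> strip_kernel \<mu> 0"
    using tendsto_of_real[OF s, where ?'a = complex]
    by (intro isCont_tendsto_compose[OF strip_kernel_isCont[OF \<mu>0]]) auto
  ultimately show ?thesis using True LIMSEQ_unique by force
qed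

text \<open>Shifting by \<open>\<i>\<close> lowers the argument of one Gamma factor and raises that
  of the other, so \<open>Gamma (z + 1) = z * Gamma z\<close> applies to both. The range of
  \<open>Im w\<close> keeps \<open>w\<close> and \<open>w + \<i>\<close> in the strip of
  holomorphy.\<close>

lemma strip_kernel_shift:
  assumes "\<mu> \<noteq> 0" "- 1 < Im w" "Im w < 0"
  shows "\<mu> * (\<i> * w) * strip_kernel \<mu> (w + \<i>) = (1 - \<i> * w) * strip_kernel \<mu> w"
proof -
  have "Gamma (1 + \<i> * w) = \<i> * w * Gamma (\<i> * w)"
    using Gamma_plus1[OF not_nonpos_Ints_if_Re_pos[of "\<i> * w"]] assms by (simp add: add.commute)
  moreover have "Gamma (2 - \<i> * w) = (1 - \<i> * w) * Gamma (1 - \<i> * w)"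
    using Gamma_plus1[OF not_nonpos_Ints_if_Re_pos[of "1 - \<i> * w"]] assms by (simp add: algebra_simps)
  moreover have "\<mu> powr (\<i> * w - 1) = \<mu> * \<mu> powr (\<i> * w - 2)"
  proof -
    have "\<mu> powr (\<i> * w - 2 + 1) = \<mu> powr (\<i> * w - 2) * \<mu> powr 1" by (rule powr_add)
    then show ?thesis using assms by (simp add: mult.commute)
  qed
  moreover have "strip_kernel \<mu> (w + \<i>) = \<mu> powr (\<i> * w - 2) * Gamma (\<i> * w) * Gamma (2 - \<i> * w) / (2 * pi)"
  proof -
    have "\<i> * (w + \<i>) - 1 = \<i> * w - 2" "1 + \<i> * (w + \<i>) = \<i> * w" "1 - \<i> * (w + \<i>) = 2 - \<i> * w"
      by (simp_all add: algebra_simps)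
    then show ?thesis by (simp only: strip_kernel_def)
  qed
  ultimately show ?thesis by (simp add: strip_kernel_def)
qed

text \<open>With \<open>w = s - z\<close> for real \<open>s\<close>, the first identity turns the
  Cauchy kernel on the lower boundary line into regular translates; the second reduces the upper
  line to the same expression, up to sign and the factor \<open>\<mu>\<close>.\<close>

lemma strip_kernel_sum_shift:
  assumes "\<mu> \<noteq> 0" "- 1 < Im w" "Im w < 0"
  shows "strip_kernel \<mu> w / w = \<i> * (strip_kernel \<mu> w + \<mu> * strip_kernel \<mu> (w + \<i>))"
    and "\<mu> * strip_kernel \<mu> (w + \<i>) / (w + \<i>) = - (strip_kernel \<mu> w / w)"
proof -
  have nz: "w \<noteq> 0" "w + \<i> \<noteq> 0" using assms by (auto simp: complex_eq_iff)
  have "\<mu> * strip_kernel \<mu> (w + \<i>) = (1 - \<i> * w) * strip_kernel \<mu> w / (\<i> * w)"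
    using strip_kernel_shift[OF assms] nz by (simp add: eq_divide_eq mult_ac)
  note eq = this
  show "strip_kernel \<mu> w / w = \<i> * (strip_kernel \<mu> w + \<mu> * strip_kernel \<mu> (w + \<i>))"
    unfolding eq using nz by (simp add: field_simps)
  have "1 - \<i> * w = - \<i> * (w + \<i>)" by (simp add: algebra_simps)
  then show "\<mu> * strip_kernel \<mu> (w + \<i>) / (w + \<i>) = - (strip_kernel \<mu> w / w)"
    unfolding eq using nz by simp
qed

text \<open>The power grows at most like
  \<open>exp (\<bar>\<theta>\<bar> * \<bar>Re w\<bar>)\<close> with \<open>\<theta>\<close> the
  argument of \<open>\<mu>\<close>, the denominator like \<open>exp (pi * \<bar>Re w\<bar>)\<close>.
  Off the cut the gap \<open>\<eta>\<close> is positive; one half of it absorbs the linear factor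
  \<open>w\<close>, the other half is the decay rate.\<close>

lemma strip_kernel_far_bound:
  assumes \<mu>: "\<mu> \<notin> \<real>\<^sub>\<le>\<^sub>0"
  shows "\<exists>C \<delta>. \<delta> > 0 \<and> C \<ge> 0 \<and>
    (\<forall>w::complex. \<bar>Im w\<bar> < 1 \<longrightarrow> 1 \<le> \<bar>Re w\<bar> \<longrightarrow> cmod (strip_kernel \<mu> w) \<le> C * exp (- \<delta> * \<bar>Re w\<bar>))"
proof -
  have \<mu>0: "\<mu> \<noteq> 0" using \<mu> by auto
  define \<theta> where "\<theta> = Im (Ln \<mu>)"
  define l where "l = \<bar>ln (cmod \<mu>)\<bar>"
  define \<eta> where "\<eta> = pi - \<bar>\<theta>\<bar>"
  have "\<eta> > 0"
    using mpi_less_Im_Ln[OF \<mu>0] \<mu> \<mu>0 Im_Ln_le_pi[OF \<mu>0] Im_Ln_eq_pi[of \<mu>]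
    by (auto simp: complex_nonpos_Reals_iff order.strict_iff_order \<eta>_def \<theta>_def abs_if)
  have "cmod (strip_kernel \<mu> w) \<le> 8 / \<eta> * exp (2 * l) * exp (- (\<eta> / 2) * \<bar>Re w\<bar>)"
    if w: "\<bar>Im w\<bar> < 1" "1 \<le> \<bar>Re w\<bar>" for w :: complex
  proof -
    let ?x = "\<bar>Re w\<bar>"
    have "cmod w \<le> 2 * ?x" using cmod_le[of w] w by linarith
    moreover have "cmod (\<mu> powr (\<i> * w - 1)) \<le> exp (2 * l) * exp (\<bar>\<theta>\<bar> * ?x)"
    proof -
      have "cmod (\<mu> powr (\<i> * w - 1)) = exp (- (1 + Im w) * ln (cmod \<mu>) - Re w * \<theta>)"
        using \<mu>0 by (simp add: powr_def \<theta>_def algebra_simps)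
      moreover have "- (1 + Im w) * ln (cmod \<mu>) \<le> 2 * l"
      proof -
        have "\<bar>- (1 + Im w) * ln (cmod \<mu>)\<bar> \<le> 2 * l"
          unfolding abs_mult l_def using w by (intro mult_right_mono) auto
        then show ?thesis by linarith
      qed
      moreover have "- (Re w * \<theta>) \<le> \<bar>\<theta>\<bar> * ?x"
        using abs_ge_minus_self[of "Re w * \<theta>"] by (simp add: abs_mult mult.commute)
      ultimately show ?thesis by (simp add: exp_add[symmetric])
    qed
    \<comment> \<open>Here \<open>1 \<le> ?x\<close> is used: \<open>exp (pi * ?x)\<close> is at
      least 2, so subtracting an exponential of at most 1 leaves at least half.\<close>
    moreover have "exp (pi * ?x) / 2 \<le> cmod (exp (pi * w) - exp (- pi * w))"
    proof -
      have "exp (- (pi * ?x)) \<le> 1" by simp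
      moreover have "2 \<le> exp (pi * ?x)"
      proof -
        have "1 \<le> pi * ?x" using mult_mono[of 1 pi 1 ?x] w pi_gt3 by simp
        then show ?thesis using exp_ge_add_one_self[of "pi * ?x"] by linarith
      qed
      moreover have "exp (pi * ?x) - exp (- (pi * ?x)) \<le> cmod (exp (pi * w) - exp (- pi * w))"
        using norm_triangle_ineq2[of "exp (pi * w)" "exp (- pi * w)"]
          norm_triangle_ineq2[of "exp (- pi * w)" "exp (pi * w)"]
        by (cases "Re w \<ge> 0") (auto simp: norm_minus_commute)
      ultimately show ?thesis by linarith
    qed
    moreover have "Re w \<noteq> 0" using w by auto
    ultimately have "cmod (strip_kernel \<mu> w) \<le> 2 * ?x * (exp (2 * l) * exp (\<bar>\<theta>\<bar> * ?x)) / (exp (pi * ?x) / 2)"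
      unfolding strip_kernel_eq_sinh[OF \<open>Re w \<noteq> 0\<close>] norm_divide norm_mult
      by (intro frac_le mult_mono) simp_all
    also have "\<dots> = 4 * exp (2 * l) * ?x * exp (- \<eta> * ?x)"
      by (simp add: \<eta>_def left_diff_distrib exp_diff)
    also have "\<dots> \<le> 4 * exp (2 * l) * (2 / \<eta> * exp (\<eta> / 2 * ?x)) * exp (- \<eta> * ?x)"
    proof -
      have "?x \<le> 2 / \<eta> * exp (\<eta> / 2 * ?x)"
        using exp_ge_add_one_self[of "\<eta> / 2 * ?x"] \<open>\<eta> > 0\<close> by (simp add: field_simps)
      then show ?thesis by (intro mult_right_mono mult_left_mono) auto
    qed
    also have "\<dots> =
        8 / \<eta> * exp (2 * l) * exp (\<eta> / 2 * ?x + - \<eta> * ?x)"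
      unfolding exp_add by simp
    also have "\<eta> / 2 * ?x + - \<eta> * ?x = - (\<eta> / 2) * ?x" by simp
    finally show ?thesis by simp
  qed
  then show ?thesis
    using \<open>\<eta> > 0\<close> by (intro exI[of _ "8 / \<eta> * exp (2 * l)"] exI[of _ "\<eta> / 2"]) auto
qed

text \<open>For \<open>\<bar>Re w\<bar> < 1\<close> the bound comes from compactness of a rectangle
  that avoids the poles at \<open>\<i>\<close> and \<open>- \<i>\<close>, hence
  \<open>c < 1\<close>. The factor \<open>exp \<delta>\<close> compensates the smallest value of the
  exponential there.\<close>

lemma strip_kernel_bound:
  assumes \<mu>: "\<mu> \<notin> \<real>\<^sub>\<le>\<^sub>0" and c: "c < 1"
  shows "\<exists>C \<delta>. \<delta> > 0 \<and> C \<ge> 0 \<and>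
    (\<forall>w::complex. \<bar>Im w\<bar> \<le> c \<longrightarrow> cmod (strip_kernel \<mu> w) \<le> C * exp (- \<delta> * \<bar>Re w\<bar>))"
proof -
  have \<mu>0: "\<mu> \<noteq> 0" using \<mu> by auto
  obtain C \<delta> where C: "\<delta> > 0" "C \<ge> 0" and
    far: "\<And>w. \<bar>Im w\<bar> < 1 \<Longrightarrow> 1 \<le> \<bar>Re w\<bar> \<Longrightarrow> cmod (strip_kernel \<mu> w) \<le> C * exp (- \<delta> * \<bar>Re w\<bar>)"
    using strip_kernel_far_bound[OF \<mu>] by blast
  let ?K = "cbox (Complex (- 1) (- c)) (Complex 1 c)"
  have "continuous_on ?K (strip_kernel \<mu>)"
    using c by (intro holomorphic_on_imp_continuous_on
        holomorphic_on_subset[OF strip_kernel_holomorphic[OF \<mu>0]]) (auto simp: in_cbox_complex_iff)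
  then have "bounded (strip_kernel \<mu> ` ?K)"
    by (intro compact_imp_bounded compact_continuous_image compact_cbox)
  then obtain B where B: "B > 0" "\<And>w. w \<in> ?K \<Longrightarrow> cmod (strip_kernel \<mu> w) \<le> B"
    by (auto simp: bounded_pos)
  have "cmod (strip_kernel \<mu> w) \<le> (C + B * exp \<delta>) * exp (- \<delta> * \<bar>Re w\<bar>)" if w: "\<bar>Im w\<bar> \<le> c" for w :: complex
  proof (cases "1 \<le> \<bar>Re w\<bar>")
    case True
    then have "cmod (strip_kernel \<mu> w) \<le> C * exp (- \<delta> * \<bar>Re w\<bar>)" using w c by (intro far) auto
    also have "\<dots> \<le> (C + B * exp \<delta>) * exp (- \<delta> * \<bar>Re w\<bar>)" using B by (intro mult_right_mono) auto
    finally show ?thesis .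
  next
    case False
    then have "w \<in> ?K" using w by (auto simp: in_cbox_complex_iff)
    then have "cmod (strip_kernel \<mu> w) \<le> B * 1" using B by simp
    also have "\<dots> \<le> B * (exp \<delta> * exp (- \<delta> * \<bar>Re w\<bar>))"
      using False C(1) B(1) unfolding exp_add[symmetric]
      by (intro mult_left_mono) (auto simp: mult_left_le)
    also have "\<dots> \<le> (C + B * exp \<delta>) * exp (- \<delta> * \<bar>Re w\<bar>)" using C(2) by (simp add: distrib_right)
    finally show ?thesis .
  qed
  then show ?thesis
    using C B by (intro exI[of _ "C + B * exp \<delta>"] exI[of _ \<delta>]) auto
qed

section \<open>Transforms of boundary functions and Cauchy's formula on the strip\<close>

text \<open>The translation is put on the kernel, not on \<open>f\<close>, because it is the kernel
  that extends to complex arguments. For an orbit \<open>f\<close> and real \<open>z = t\<close>,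
  the value is the pairing of \<open>U t\<close> applied to the weak integral.\<close>

definition strip_transform :: "complex \<Rightarrow> (real \<Rightarrow> complex) \<Rightarrow> complex \<Rightarrow> complex" where
  "strip_transform \<mu> f z = (LINT s|lborel. strip_kernel \<mu> (complex_of_real s - z) * f s)"

text \<open>Uniformity in \<open>z\<close> over a rectangle provides a common dominating function;
  replacing \<open>\<bar>s - Re z\<bar>\<close> by \<open>\<bar>s\<bar> - \<rho>\<close> costs the
  factor \<open>exp (\<delta> * \<rho>)\<close>.\<close>

lemma strip_kernel_translate_bound:
  assumes \<mu>: "\<mu> \<notin> \<real>\<^sub>\<le>\<^sub>0" and c: "c < 1"
  shows "\<exists>C \<delta>. \<delta> > 0 \<and> C \<ge> 0 \<and> (\<forall>z s. \<bar>Im z\<bar> \<le> c \<longrightarrow> \<bar>Re z\<bar> \<le> \<rho> \<longrightarrow>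
    cmod (strip_kernel \<mu> (complex_of_real s - z)) \<le> C * exp (- \<delta> * \<bar>s\<bar>))"
proof -
  obtain C \<delta> where C: "\<delta> > 0" "C \<ge> 0" and
    bd: "\<And>w. \<bar>Im w\<bar> \<le> c \<Longrightarrow> cmod (strip_kernel \<mu> w) \<le> C * exp (- \<delta> * \<bar>Re w\<bar>)"
    using strip_kernel_bound[OF \<mu> c] by blast
  have "cmod (strip_kernel \<mu> (complex_of_real s - z)) \<le> C * exp (\<delta> * \<rho>) * exp (- \<delta> * \<bar>s\<bar>)"
    if z: "\<bar>Im z\<bar> \<le> c" "\<bar>Re z\<bar> \<le> \<rho>" for z s
  proof -
    have "cmod (strip_kernel \<mu> (complex_of_real s - z)) \<le> C * exp (- \<delta> * \<bar>s - Re z\<bar>)"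
      using bd[of "complex_of_real s - z"] z by simp
    also have "\<dots> \<le> C * exp (\<delta> * \<rho> + - \<delta> * \<bar>s\<bar>)"
    proof -
      have "\<delta> * (\<bar>s\<bar> - \<rho>) \<le> \<delta> * \<bar>s - Re z\<bar>" using z C(1) by (intro mult_left_mono) auto
      then show ?thesis using C(2) by (intro mult_left_mono) (auto simp: algebra_simps)
    qed
    finally show ?thesis unfolding exp_add by (simp only: mult.assoc)
  qed
  then show ?thesis using C by (intro exI[of _ "C * exp (\<delta> * \<rho>)"] exI[of _ \<delta>]) auto
qed

lemma strip_kernel_translate_continuous:
  assumes "\<mu> \<noteq> 0" "\<bar>Im z\<bar> < 1"
  shows "continuous_on UNIV (\<lambda>s. strip_kernel \<mu> (complex_of_real s - z))"
proof (rule continuous_on_compose2[where g = "strip_kernel \<mu>" and f = "\<lambda>s. complex_of_real s - z"])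
  show "continuous_on {w. \<bar>Im w\<bar> < 1} (strip_kernel \<mu>)"
    by (intro holomorphic_on_imp_continuous_on strip_kernel_holomorphic assms)
qed (use assms in \<open>auto intro!: continuous_intros\<close>)

lemma strip_kernel_translate_integrable:
  assumes \<mu>: "\<mu> \<notin> \<real>\<^sub>\<le>\<^sub>0" and z: "\<bar>Im z\<bar> < 1"
  shows "integrable lborel (\<lambda>s. strip_kernel \<mu> (complex_of_real s - z))"
proof -
  obtain C \<delta> where C: "\<delta> > 0" and "\<And>s. cmod (strip_kernel \<mu> (complex_of_real s - z)) \<le> C * exp (- \<delta> * \<bar>s\<bar>)"
    using strip_kernel_translate_bound[OF \<mu> z, of "\<bar>Re z\<bar>"] by blast
  moreover have "\<mu> \<noteq> 0" using \<mu> by auto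
  ultimately show ?thesis using z by (intro integrable_exp_decay strip_kernel_translate_continuous)
qed

lemma strip_transform_integrable:
  fixes f :: "real \<Rightarrow> complex"
  assumes \<mu>: "\<mu> \<notin> \<real>\<^sub>\<le>\<^sub>0" and z: "\<bar>Im z\<bar> < 1" and f: "continuous_on UNIV f" "\<And>s. cmod (f s) \<le> B"
  shows "integrable lborel (\<lambda>s. strip_kernel \<mu> (complex_of_real s - z) * f s)"
proof -
  obtain C \<delta> where C: "\<delta> > 0" "C \<ge> 0" and
    bd: "\<And>s. cmod (strip_kernel \<mu> (complex_of_real s - z)) \<le> C * exp (- \<delta> * \<bar>s\<bar>)"
    using strip_kernel_translate_bound[OF \<mu> z, of "\<bar>Re z\<bar>"] by blast
  have "\<mu> \<noteq> 0" using \<mu> by auto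
  show ?thesis
  proof (rule integrable_exp_decay[OF _ C(1)])
    show "continuous_on UNIV (\<lambda>s. strip_kernel \<mu> (complex_of_real s - z) * f s)"
      using \<open>\<mu> \<noteq> 0\<close> z by (intro continuous_intros f strip_kernel_translate_continuous)
    show "cmod (strip_kernel \<mu> (complex_of_real s - z) * f s) \<le> C * B * exp (- \<delta> * \<bar>s\<bar>)" for s
      using mult_mono[OF bd f(2), of s s] C by (simp add: norm_mult mult_ac)
  qed
qed

text \<open>Truncated integrals are holomorphic by differentiation under the integral sign, and they
  converge locally uniformly because their tails are bounded by those of one exponential.\<close>

lemma strip_transform_holomorphic:
  fixes f :: "real \<Rightarrow> complex"
  assumes \<mu>: "\<mu> \<notin> \<real>\<^sub>\<le>\<^sub>0" and f: "continuous_on UNIV f" "\<And>s. cmod (f s) \<le> B"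
  shows "strip_transform \<mu> f holomorphic_on {z. \<bar>Im z\<bar> < 1}"
proof (rule holomorphic_uniform_sequence[OF open_horizontal_strip])
  let ?S = "{z. \<bar>Im z\<bar> < 1}"
  let ?A = "\<lambda>n. {- real n..real n}"
  let ?F = "\<lambda>z s. strip_kernel \<mu> (complex_of_real s - z) * f s"
  have \<mu>0: "\<mu> \<noteq> 0" using \<mu> by auto
  have B0: "B \<ge> 0" using order_trans[OF norm_ge_zero f(2)] .
  have convex: "convex ?S"
  proof -
    have "?S = {z. Im z > - 1} \<inter> {z. Im z < 1}" by auto
    then show ?thesis by (simp add: convex_Int convex_halfspace_Im_gt convex_halfspace_Im_lt)
  qed
  have hol: "strip_kernel \<mu> holomorphic_on ?S" by (rule strip_kernel_holomorphic[OF \<mu>0])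
  show "(\<lambda>z. integral (?A n) (?F z)) holomorphic_on ?S" for n
    unfolding box_real(2)[symmetric]
  proof (rule leibniz_rule_holomorphic[OF _ _ _ convex])
    fix z s assume z: "z \<in> ?S"
    have "(strip_kernel \<mu> has_field_derivative deriv (strip_kernel \<mu>) (complex_of_real s - z)) (at (complex_of_real s - z))"
      using z by (intro holomorphic_derivI[OF hol open_horizontal_strip]) simp
    moreover have "((\<lambda>z. complex_of_real s - z) has_field_derivative - 1) (at z within ?S)"
      by (auto intro!: derivative_eq_intros)
    ultimately have "((\<lambda>z. strip_kernel \<mu> (complex_of_real s - z)) has_field_derivative
        deriv (strip_kernel \<mu>) (complex_of_real s - z) * - 1) (at z within ?S)"
      by (rule DERIV_chain2)
    from DERIV_cmult_right[OF this, of "f s"]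
    show "((\<lambda>z. ?F z s) has_field_derivative
        deriv (strip_kernel \<mu>) (complex_of_real s - z) * - 1 * f s) (at z within ?S)" by (simp add: mult_ac)
  next
    fix z assume z: "z \<in> ?S"
    then have "continuous_on UNIV (?F z)"
      using \<mu>0 by (intro continuous_intros f strip_kernel_translate_continuous) auto
    then show "?F z integrable_on cbox (- real n) (real n)"
      by (intro integrable_continuous) (rule continuous_on_subset, auto)
  next
    have "deriv (strip_kernel \<mu>) holomorphic_on ?S"
      by (intro holomorphic_deriv hol open_horizontal_strip)
    then have "continuous_on ?S (deriv (strip_kernel \<mu>))" by (rule holomorphic_on_imp_continuous_on)
    then have "continuous_on (?S \<times> cbox (- real n) (real n))
        (\<lambda>x. deriv (strip_kernel \<mu>) (complex_of_real (snd x) - fst x))"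
      by (rule continuous_on_compose2) (auto intro!: continuous_intros)
    moreover have "continuous_on (?S \<times> cbox (- real n) (real n)) (\<lambda>x. f (snd x))"
      by (rule continuous_on_compose2[OF f(1)]) (auto intro!: continuous_intros)
    ultimately show "continuous_on (?S \<times> cbox (- real n) (real n))
        (\<lambda>(z, s). deriv (strip_kernel \<mu>) (complex_of_real s - z) * - 1 * f s)"
      unfolding case_prod_beta by (intro continuous_intros)
  qed
  fix z assume z: "z \<in> ?S"
  obtain d where d: "d > 0" "cball z d \<subseteq> ?S"
    using z open_horizontal_strip[of 1] open_contains_cball by blast
  \<comment> \<open>Shrinks the disc so that all imaginary parts in it stay at most
    \<open>\<bar>Im z\<bar> + d' < 1\<close>, the level at which the common kernel bound is
    taken.\<close>
  define d' where "d' = min d ((1 - \<bar>Im z\<bar>) / 2)"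
  have d': "d' > 0" "cball z d' \<subseteq> ?S" using d z by (auto simp: d'_def)
  have zc: "\<bar>Im z\<bar> + d' < 1" using z by (auto simp: d'_def min_def field_simps)
  obtain C \<delta> where C: "\<delta> > 0" "C \<ge> 0" and
    bd: "\<And>u s. \<bar>Im u\<bar> \<le> \<bar>Im z\<bar> + d' \<Longrightarrow> \<bar>Re u\<bar> \<le> \<bar>Re z\<bar> + d' \<Longrightarrow>
      cmod (strip_kernel \<mu> (complex_of_real s - u)) \<le> C * exp (- \<delta> * \<bar>s\<bar>)"
    using strip_kernel_translate_bound[OF \<mu> zc, of "\<bar>Re z\<bar> + d'"] by blast
  let ?h = "\<lambda>s. C * B * exp (- \<delta> * \<bar>s\<bar>)"
  have h: "integrable lborel ?h" using integrable_exp_minus_abs[OF C(1)] by simp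
  have est: "cmod (integral (?A n) (?F u) - strip_transform \<mu> f u) \<le> (LINT s|lborel. ?h s) - integral (?A n) ?h"
    if u: "u \<in> cball z d'" for u n
  proof -
    have "\<bar>Im u - Im z\<bar> \<le> d'" "\<bar>Re u - Re z\<bar> \<le> d'"
      using u abs_Im_le_cmod[of "u - z"] abs_Re_le_cmod[of "u - z"] by (auto simp: dist_norm norm_minus_commute)
    then have Fh: "cmod (?F u s) \<le> ?h s" for s
      using mult_mono[OF bd f(2), of u s s] C by (simp add: norm_mult mult_ac)
    have uS: "\<bar>Im u\<bar> < 1" using u d'(2) by auto
    have Fi: "integrable lborel (?F u)" by (rule strip_transform_integrable[OF \<mu> uS f])
    note ind = integrable_indicator_interval and eq = integral_interval_eq_LINT
    let ?G = "\<lambda>s. indicator (?A n) s *\<^sub>R ?F u s - ?F u s"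
    let ?H = "\<lambda>s. ?h s - indicator (?A n) s *\<^sub>R ?h s"
    have G: "integral (?A n) (?F u) - strip_transform \<mu> f u = (LINT s|lborel. ?G s)"
      unfolding eq[OF Fi] strip_transform_def
      by (rule Bochner_Integration.integral_diff[OF ind[OF Fi] Fi, symmetric])
    have H: "(LINT s|lborel. ?h s) - integral (?A n) ?h = (LINT s|lborel. ?H s)"
      unfolding eq[OF h] by (rule Bochner_Integration.integral_diff[OF h ind[OF h], symmetric])
    have "integrable lborel ?G" by (rule Bochner_Integration.integrable_diff[OF ind[OF Fi] Fi])
    moreover have "integrable lborel ?H" by (rule Bochner_Integration.integrable_diff[OF h ind[OF h]])
    moreover have "cmod (?G s) \<le> ?H s" for s
      using Fh[of s] by (cases "s \<in> ?A n") auto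
    ultimately show ?thesis
      unfolding G H by (rule Bochner_Integration.integral_norm_bound_integral)
  qed
  have "uniform_limit (cball z d') (\<lambda>n u. integral (?A n) (?F u)) (strip_transform \<mu> f) sequentially"
  proof (rule uniform_limitI)
    fix e :: real assume e: "e > 0"
    have "(\<lambda>n. (LINT s|lborel. ?h s) - integral (?A n) ?h) \<longlonglongrightarrow> (LINT s|lborel. ?h s) - (LINT s|lborel. ?h s)"
      by (intro tendsto_diff tendsto_const symmetric_integrals_tendsto h)
    then have "\<forall>\<^sub>F n in sequentially. (LINT s|lborel. ?h s) - integral (?A n) ?h < e"
      using e by (intro order_tendstoD(2)) auto
    then show "\<forall>\<^sub>F n in sequentially. \<forall>u\<in>cball z d'. dist (integral (?A n) (?F u)) (strip_transform \<mu> f u) < e"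
    proof eventually_elim
      case (elim n)
      then show ?case using est[of _ n] unfolding dist_norm by (meson le_less_trans)
    qed
  qed
  then show "\<exists>d>0. cball z d \<subseteq> ?S \<and> uniform_limit (cball z d) (\<lambda>n u. integral (?A n) (?F u)) (strip_transform \<mu> f) sequentially"
    using d' by blast
qed

text \<open>The Cauchy formula on the strip with the meromorphic kernel
  \<open>2 \<pi> \<mu> strip_kernel \<mu> (s - z) / (s - z)\<close>, whose values on the two boundary lines
  are combinations of regular translates of \<open>strip_kernel\<close>.\<close>

lemma strip_reproducing_formula:
  assumes \<mu>: "\<mu> \<notin> \<real>\<^sub>\<le>\<^sub>0"
    and cont: "continuous_on {w. 0 \<le> Im w \<and> Im w \<le> 1} f"
    and hol: "f holomorphic_on {w. 0 < Im w \<and> Im w < 1}"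
    and bound: "\<And>w. 0 \<le> Im w \<Longrightarrow> Im w \<le> 1 \<Longrightarrow> cmod (f w) \<le> B"
    and z: "0 < Im z" "Im z < 1"
  defines "J0 \<equiv> strip_transform \<mu> (\<lambda>s. f (complex_of_real s))"
    and "J1 \<equiv> strip_transform \<mu> (\<lambda>s. f (complex_of_real s + \<i>))"
  shows "f z = \<mu> * (J0 z + \<mu> * J0 (z - \<i>)) + (J1 z + \<mu> * J1 (z - \<i>))"
proof -
  have \<mu>0: "\<mu> \<noteq> 0" using \<mu> by auto
  have B0: "B \<ge> 0" using order_trans[OF norm_ge_zero bound[of 0]] by simp
  let ?k = "\<lambda>s. strip_kernel \<mu> (complex_of_real s - z) + \<mu> * strip_kernel \<mu> (complex_of_real s - (z - \<i>))"
  \<comment> \<open>The factor \<open>2 * pi * \<mu>\<close> normalises the kernel to 1 at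
    \<open>s = z\<close>, so the residue of \<open>g\<close> at \<open>z\<close> is
    \<open>f z\<close>.\<close>
  define g where "g = (\<lambda>s. f s * (2 * pi * \<mu> * strip_kernel \<mu> (s - z)) / (s - z))"
  let ?f0 = "\<lambda>s. f (complex_of_real s)" and ?f1 = "\<lambda>s. f (complex_of_real s + \<i>)"
  have f0: "continuous_on UNIV ?f0" "\<And>s. cmod (?f0 s) \<le> B"
    by (rule continuous_on_compose2[OF cont], auto intro!: continuous_intros bound)
  have f1: "continuous_on UNIV ?f1" "\<And>s. cmod (?f1 s) \<le> B"
    by (rule continuous_on_compose2[OF cont], auto intro!: continuous_intros bound)
  have z': "\<bar>Im z\<bar> < 1" "\<bar>Im (z - \<i>)\<bar> < 1" using z by auto
  have int: "integrable lborel (\<lambda>s. ?k s * h s)"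
    "(LINT s|lborel. ?k s * h s) = strip_transform \<mu> h z + \<mu> * strip_transform \<mu> h (z - \<i>)"
    if h: "continuous_on UNIV h" "\<And>s. cmod (h s) \<le> B" for h
  proof -
    note i1 = strip_transform_integrable[OF \<mu> z'(1) h]
    note i2 = Bochner_Integration.integrable_mult_right[OF strip_transform_integrable[OF \<mu> z'(2) h], of \<mu>]
    have eq: "?k s * h s = strip_kernel \<mu> (complex_of_real s - z) * h s
        + \<mu> * (strip_kernel \<mu> (complex_of_real s - (z - \<i>)) * h s)" for s
      by (simp add: distrib_right)
    show "integrable lborel (\<lambda>s. ?k s * h s)"
      unfolding eq by (rule Bochner_Integration.integrable_add[OF i1 i2])
    show "(LINT s|lborel. ?k s * h s) = strip_transform \<mu> h z + \<mu> * strip_transform \<mu> h (z - \<i>)"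
      unfolding eq strip_transform_def
      using Bochner_Integration.integral_add[OF i1 i2] by simp
  qed
  have bot: "g (Complex s 0) = 2 * pi * \<i> * \<mu> * (?k s * ?f0 s)" for s
  proof -
    have s: "Complex s 0 = complex_of_real s" by (simp add: complex_eq_iff)
    have "g (Complex s 0) = f s * (2 * pi * \<mu>) * (strip_kernel \<mu> (complex_of_real s - z) / (complex_of_real s - z))"
      by (simp add: g_def s)
    also have "\<dots> = 2 * pi * \<i> * \<mu> * (?k s * ?f0 s)"
      using z by (subst strip_kernel_sum_shift(1)[OF \<mu>0]) (simp_all add: algebra_simps)
    finally show ?thesis .
  qed
  \<comment> \<open>The same \<open>?k\<close> as on the lower line appears, with opposite sign and
    without \<open>\<mu>\<close>; this is the source of the different factors of \<open>J0\<close>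
    and \<open>J1\<close>.\<close>
  have top: "g (Complex s 1) = - 2 * pi * \<i> * (?k s * ?f1 s)" for s
  proof -
    let ?w = "complex_of_real s - z"
    have s: "Complex s 1 = complex_of_real s + \<i>" by (simp add: complex_eq_iff)
    have "g (Complex s 1) = 2 * pi * ?f1 s * (\<mu> * strip_kernel \<mu> (?w + \<i>) / (?w + \<i>))"
      by (simp add: g_def s algebra_simps)
    also have "\<dots> = 2 * pi * ?f1 s * - (\<i> * (strip_kernel \<mu> ?w + \<mu> * strip_kernel \<mu> (?w + \<i>)))"
      using z by (subst strip_kernel_sum_shift(2)[OF \<mu>0]) (simp_all add: strip_kernel_sum_shift(1)[OF \<mu>0])
    finally show ?thesis by (simp add: algebra_simps)
  qed
  \<comment> \<open>The largest modulus of \<open>Im (w - z)\<close> for \<open>w\<close> in the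
    closed strip.\<close>
  define c where "c = max (Im z) (1 - Im z)"
  have c: "c < 1" using z by (simp add: c_def)
  obtain C \<delta> where C: "\<delta> > 0" "C \<ge> 0" and
    bd: "\<And>u s. \<bar>Im u\<bar> \<le> c \<Longrightarrow> \<bar>Re u\<bar> \<le> \<bar>Re z\<bar> \<Longrightarrow>
      cmod (strip_kernel \<mu> (complex_of_real s - u)) \<le> C * exp (- \<delta> * \<bar>s\<bar>)"
    using strip_kernel_translate_bound[OF \<mu> c, of "\<bar>Re z\<bar>"] by blast
  let ?D = "B * (2 * pi * cmod \<mu> * C)"
  have cK: "continuous_on {w. 0 \<le> Im w \<and> Im w \<le> 1} (\<lambda>s. f s * (2 * pi * \<mu> * strip_kernel \<mu> (s - z)))"
  proof -
    have "continuous_on {w. \<bar>Im w\<bar> < 1} (strip_kernel \<mu>)"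
      by (intro holomorphic_on_imp_continuous_on strip_kernel_holomorphic \<mu>0)
    then have "continuous_on {w. 0 \<le> Im w \<and> Im w \<le> 1} (\<lambda>s. strip_kernel \<mu> (s - z))"
      by (rule continuous_on_compose2) (use z in \<open>auto intro!: continuous_intros\<close>)
    then show ?thesis by (intro continuous_on_mult cont continuous_on_const)
  qed
  have "(LINT s|lborel. g (Complex s 0)) - (LINT s|lborel. g (Complex s 1)) = 2 * pi * \<i> * f z"
  \<comment> \<open>The choice of \<open>r\<close> keeps \<open>z\<close> inside the rectangle and
    at distance at least 1 from its vertical sides.\<close>
  proof (rule strip_contour_limit[where r = "\<bar>Re z\<bar> + 1" and d = "\<lambda>r. ?D * exp (- \<delta> * r)"])
    show "continuous_on {w. 0 \<le> Im w \<and> Im w \<le> 1 \<and> (Im w = 0 \<or> Im w = 1 \<or> \<bar>Re z\<bar> + 1 \<le> \<bar>Re w\<bar>)} g"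
      unfolding g_def using z by (intro continuous_on_divide continuous_on_subset[OF cK] continuous_intros) auto
    show "integrable lborel (\<lambda>x. g (Complex x 0))" "integrable lborel (\<lambda>x. g (Complex x 1))"
      unfolding bot top by (intro Bochner_Integration.integrable_mult_right int(1) f0 f1)+
    show "((\<lambda>r. ?D * exp (- \<delta> * r)) \<longlongrightarrow> 0) at_top"
    proof (rule tendsto_mult_right_zero)
      have "filterlim (\<lambda>r. - \<delta> * r) at_bot at_top"
        using C(1) by (intro filterlim_tendsto_neg_mult_at_bot[OF tendsto_const]) (auto simp: filterlim_ident)
      then show "((\<lambda>r. exp (- \<delta> * r)) \<longlongrightarrow> 0) at_top" by (rule filterlim_compose[OF exp_at_bot])
    qed
    fix w assume w: "0 \<le> Im w" "Im w \<le> 1" "\<bar>Re z\<bar> + 1 \<le> \<bar>Re w\<bar>"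
    have eq: "w - z = complex_of_real (Re w) - (z - \<i> * Im w)" by (simp add: complex_eq_iff)
    have "cmod (strip_kernel \<mu> (w - z)) \<le> C * exp (- \<delta> * \<bar>Re w\<bar>)"
      unfolding eq by (rule bd) (use w z in \<open>auto simp: c_def\<close>)
    moreover have "1 \<le> cmod (w - z)" using abs_Re_le_cmod[of "w - z"] w by simp
    ultimately have "cmod (g w) \<le> B * (2 * pi * cmod \<mu> * (C * exp (- \<delta> * \<bar>Re w\<bar>))) / 1"
      unfolding g_def norm_divide norm_mult using bound[OF w(1,2)] B0 C(2)
      by (intro frac_le mult_mono) simp_all
    then show "cmod (g w) \<le> ?D * exp (- \<delta> * \<bar>Re w\<bar>)" by (simp add: mult_ac)
  next
    fix R assume R: "\<bar>Re z\<bar> + 1 \<le> R" "R > 0"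
    let ?K = "cbox (Complex (- R) 0) (Complex R 1)"
    have box: "z \<in> box (Complex (- R) 0) (Complex R 1)" using R z by (auto simp: in_box_complex_iff)
    have "(g has_contour_integral 2 * pi * \<i> * winding_number (rectpath (Complex (- R) 0) (Complex R 1)) z *
        (f z * (2 * pi * \<mu> * strip_kernel \<mu> (z - z)))) (rectpath (Complex (- R) 0) (Complex R 1))"
      unfolding g_def
    \<comment> \<open>The weak form is used because \<open>f\<close> is only continuous on the
      horizontal sides.\<close>
    proof (rule Cauchy_integral_formula_weak[where S = ?K and k = "{}"])
      show "continuous_on ?K (\<lambda>s. f s * (2 * pi * \<mu> * strip_kernel \<mu> (s - z)))"
        by (rule continuous_on_subset[OF cK]) (auto simp: in_cbox_complex_iff)
      show "z \<in> interior ?K - {}" using box by simp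
      show "path_image (rectpath (Complex (- R) 0) (Complex R 1)) \<subseteq> ?K - {z}"
        using path_image_rectpath_cbox_minus_box[of "Complex (- R) 0" "Complex R 1"] R box by auto
      fix x assume "x \<in> interior ?K - {}"
      then have x: "0 < Im x" "Im x < 1" by (auto simp: in_box_complex_iff)
      have "open {w. 0 < Im w \<and> Im w < 1}"
        by (intro open_Collect_conj open_Collect_less continuous_intros)
      then have "f field_differentiable at x"
        using hol x by (auto intro: holomorphic_on_imp_differentiable_at)
      moreover have "strip_kernel \<mu> field_differentiable at (x - z)"
        using strip_kernel_holomorphic[OF \<mu>0] open_horizontal_strip[of 1] x z
        by (auto intro: holomorphic_on_imp_differentiable_at)
      then have "(strip_kernel \<mu> \<circ> (\<lambda>s. s - z)) field_differentiable at x"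
        by (intro field_differentiable_compose) (auto intro!: derivative_intros)
      ultimately show "(\<lambda>s. f s * (2 * pi * \<mu> * strip_kernel \<mu> (s - z))) field_differentiable at x"
        by (auto simp: o_def intro!: derivative_intros)
    qed auto
    from contour_integral_unique[OF this]
    show "contour_integral (rectpath (Complex (- R) 0) (Complex R 1)) g = 2 * pi * \<i> * f z"
      using \<mu>0 unfolding winding_number_rectpath[OF box] diff_self strip_kernel_0[OF \<mu>0] by simp
  qed simp
  moreover have "(LINT s|lborel. g (Complex s 0)) = 2 * pi * \<i> * \<mu> * (J0 z + \<mu> * J0 (z - \<i>))"
    unfolding bot J0_def using int(2)[OF f0] by simp
  moreover have "(LINT s|lborel. g (Complex s 1)) = - 2 * pi * \<i> * (J1 z + \<mu> * J1 (z - \<i>))"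
    unfolding top J1_def using int(2)[OF f1] by simp
  ultimately have "2 * pi * \<i> * f z = 2 * pi * \<i> * (\<mu> * (J0 z + \<mu> * J0 (z - \<i>)) + (J1 z + \<mu> * J1 (z - \<i>)))"
    by (simp add: algebra_simps)
  then show ?thesis by simp
qed

section \<open>Analytic extensions of orbits\<close>

abbreviation closed_strip :: "complex set" where
  "closed_strip \<equiv> {w. 0 \<le> Im w \<and> Im w \<le> 1}"

abbreviation open_strip :: "complex set" where
  "open_strip \<equiv> {w. 0 < Im w \<and> Im w < 1}"

lemma open_open_strip: "open open_strip"
  by (intro open_Collect_conj open_Collect_less continuous_intros)

lemma strip_vertical_continuous:
  assumes "continuous_on closed_strip f"
  shows "continuous_on {0..1} (\<lambda>y. f (Complex x y))"
  using assms by (rule continuous_on_compose2) (auto simp: Complex_eq intro!: continuous_intros)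

text \<open>Pasting with the zero function: continued by 0 below the real line, \<open>f\<close>
  stays continuous and is therefore holomorphic across the line, so it vanishes identically. The
  upper boundary line follows by continuity along vertical segments.\<close>

lemma strip_uniqueness:
  fixes f :: "complex \<Rightarrow> complex"
  assumes cont: "continuous_on closed_strip f" and hol: "f holomorphic_on open_strip"
    and zero: "\<And>t. f (complex_of_real t) = 0" and z: "z \<in> closed_strip"
  shows "f z = 0"
proof -
  define g where "g = (\<lambda>w. if 0 \<le> Im w then f w else 0)"
  let ?S = "{w. - 1 < Im w} \<inter> {w. Im w < 1}"
  have S: "open ?S" "connected ?S"
    by (intro open_Int open_halfspace_Im_gt open_halfspace_Im_lt)
      (intro convex_connected convex_Int convex_halfspace_Im_gt convex_halfspace_Im_lt)
  have fz: "f w = 0" if "Im w = 0" for w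
    using zero[of "Re w"] that by (simp add: complex_eq_iff[of "complex_of_real (Re w)" w] complex_is_Real_iff of_real_Re)
  have "continuous_on (closed_strip \<union> {w. Im w \<le> 0}) g"
    unfolding g_def
  proof (rule continuous_on_cases)
    show "closed closed_strip"
      by (intro closed_Collect_conj closed_Collect_le continuous_intros)
    show "closed {w. Im w \<le> 0}" by (rule closed_halfspace_Im_le)
  qed (use cont fz in auto)
  then have g: "continuous_on ?S g" by (rule continuous_on_subset) auto
  have holg: "g holomorphic_on ?S"
  proof (rule holomorphic_on_paste_across_line[OF S(1) _ _ _ g])
    have "(\<lambda>_. 0) holomorphic_on ?S \<inter> {w. \<i> \<bullet> w < 0}" by simp
    then show "g holomorphic_on ?S \<inter> {w. \<i> \<bullet> w < 0}"
      by (rule holomorphic_transform) (auto simp: g_def inner_complex_def)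
    have "f holomorphic_on ?S \<inter> {w. 0 < \<i> \<bullet> w}"
      by (rule holomorphic_on_subset[OF hol]) (auto simp: inner_complex_def)
    then show "g holomorphic_on ?S \<inter> {w. 0 < \<i> \<bullet> w}"
      by (rule holomorphic_transform) (auto simp: g_def inner_complex_def)
  qed simp
  have g0: "g w = 0" if "w \<in> ?S" for w
  proof (rule analytic_continuation_open[of "?S \<inter> {w. Im w < 0}" ?S g "\<lambda>_. 0"])
    show "open (?S \<inter> {w. Im w < 0})" by (intro open_Int S(1) open_halfspace_Im_lt)
    have "- \<i> / 2 \<in> ?S \<inter> {w. Im w < 0}" by simp
    then show "?S \<inter> {w. Im w < 0} \<noteq> {}" by blast
  qed (use S holg that in \<open>auto simp: g_def\<close>)
  have inner: "f (Complex (Re z) y) = 0" if "y \<in> {0..<1}" for y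
    using g0[of "Complex (Re z) y"] that by (simp add: g_def)
  have "f (Complex (Re z) (Im z)) = 0"
  proof (rule continuous_constant_on_closure[of "{0..<1}" "\<lambda>y. f (Complex (Re z) y)" 0 "Im z"])
    show "continuous_on (closure {0..<1}) (\<lambda>y. f (Complex (Re z) y))"
      using strip_vertical_continuous[OF cont] by simp
  qed (use inner z in auto)
  then show ?thesis by simp
qed

lemma strip_zero_boundary:
  fixes f :: "complex \<Rightarrow> complex"
  assumes cont: "continuous_on closed_strip f" and zero: "\<And>w. w \<in> open_strip \<Longrightarrow> f w = 0"
  shows "f 0 = 0"
proof -
  have "f (Complex 0 0) = 0"
  proof (rule continuous_constant_on_closure[of "{0<..<1}" "\<lambda>y. f (Complex 0 y)" 0 0])
    show "continuous_on (closure {0<..<1}) (\<lambda>y. f (Complex 0 y))"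
      using strip_vertical_continuous[OF cont] by simp
  qed (use zero in auto)
  then show ?thesis by (simp add: zero_complex.code)
qed

section \<open>Isometry groups on a pair with both Krein properties\<close>

locale krein_isometry_group = dual_pair p + sigma_isometry_group p U
  for p :: "'x::complex_banach \<Rightarrow> 'f::complex_banach \<Rightarrow> complex" and U :: "real \<Rightarrow> 'x \<Rightarrow> 'x" +
  assumes krein_left: "krein_property p" and krein_right: "krein_property (\<lambda>\<phi> x. p x \<phi>)"
begin

lemma U_linear:
  "U t (x + y) = U t x + U t y" "U t (a *\<^sub>C x) = a *\<^sub>C U t x"
  using in_B_sigma[of t] by (auto simp: B_sigma_def dest: clinearD)

lemma U_add: "U (s + t) x = U s (U t x)"
  using add[of s t] by simp

lemma orbit_continuous: "continuous_on UNIV (\<lambda>t. p (U t x) \<phi>)"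
  using sigma_continuous[of x] by (simp add: continuous_map_sigma_iff)

lemma orbit_bounded: "cmod (p (U t x) \<phi>) \<le> norm x * norm \<phi>"
  using norm_bound[of "U t x" \<phi>] by (simp add: isometry)

text \<open>Continuity and holomorphy are tested against functionals, so that scalar function theory
  applies to each \<open>p (F w) \<phi>\<close>.\<close>

definition extension :: "(complex \<Rightarrow> 'x) \<Rightarrow> 'x \<Rightarrow> bool" where
  "extension F x \<longleftrightarrow> (\<forall>\<phi>. continuous_on closed_strip (\<lambda>w. p (F w) \<phi>)) \<and>
     (\<forall>\<phi>. (\<lambda>w. p (F w) \<phi>) holomorphic_on open_strip) \<and> (\<forall>t. F (complex_of_real t) = U t x)"

text \<open>Weak and norm holomorphy agree here: by the uniform boundedness principle a weakly
  continuous function is locally norm bounded.\<close>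

lemma analytic_generator_iff:
  "(x, y) \<in> analytic_generator p U \<longleftrightarrow> (\<exists>F. extension F x \<and> F \<i> = y)"
proof -
  have "(\<forall>w. 0 < Im w \<and> Im w < 1 \<longrightarrow> (\<exists>D. (F has_derivative (\<lambda>h. h *\<^sub>C D)) (at w))) \<longleftrightarrow>
      (\<forall>\<phi>. (\<lambda>w. p (F w) \<phi>) holomorphic_on open_strip)"
    if cont: "\<And>\<phi>. continuous_on closed_strip (\<lambda>w. p (F w) \<phi>)" for F :: "complex \<Rightarrow> 'x"
  proof (intro iffI allI impI)
    fix \<phi>
    assume "\<forall>w. 0 < Im w \<and> Im w < 1 \<longrightarrow> (\<exists>D. (F has_derivative (\<lambda>h. h *\<^sub>C D)) (at w))"
    then show "(\<lambda>w. p (F w) \<phi>) holomorphic_on open_strip"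
      by (intro holomorphic_imp_weakly_holomorphic) auto
  next
    fix w assume hol: "\<forall>\<phi>. (\<lambda>w. p (F w) \<phi>) holomorphic_on open_strip" and w: "0 < Im w \<and> Im w < 1"
    then obtain r where r: "r > 0" "cball w r \<subseteq> open_strip"
      using open_open_strip open_contains_cball by blast
    have "\<exists>B. \<forall>x\<in>F ` cball w r. cmod (p x \<phi>) \<le> B" for \<phi>
    proof -
      have "continuous_on (cball w r) (\<lambda>w. p (F w) \<phi>)"
        by (rule continuous_on_subset[OF cont]) (use r in auto)
      then have "bounded ((\<lambda>w. p (F w) \<phi>) ` cball w r)"
        by (intro compact_imp_bounded compact_continuous_image compact_cball)
      then show ?thesis by (auto simp: bounded_iff)
    qed
    from uniform_boundedness[OF this] obtain M where M: "\<And>z. z \<in> cball w r \<Longrightarrow> norm (F z) \<le> M" by blast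
    show "\<exists>D. (F has_derivative (\<lambda>h. h *\<^sub>C D)) (at w)"
    proof (rule weakly_holomorphic_imp_holomorphic[OF r(1)])
      show "(\<lambda>z. p (F z) \<phi>) holomorphic_on ball w r" for \<phi>
        using hol r(2) ball_subset_cball[of w r] by (blast intro: holomorphic_on_subset)
      show "norm (F z) \<le> M" if "z \<in> ball w r" for z using M that by simp
    qed
  qed
  then show ?thesis
    unfolding analytic_generator_def extension_def
    by (auto simp: continuous_map_sigma_iff)
qed

lemma extension_add:
  assumes "extension F x" "extension F' x'"
  shows "extension (\<lambda>w. F w + F' w) (x + x')"
  using assms unfolding extension_def
  by (auto simp: left_simps U_linear intro!: continuous_intros holomorphic_intros)

lemma extension_scaleC:
  assumes "extension F x"
  shows "extension (\<lambda>w. a *\<^sub>C F w) (a *\<^sub>C x)"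
  using assms unfolding extension_def
  by (auto simp: left_simps U_linear intro!: continuous_intros holomorphic_intros)

text \<open>Both sides extend the orbit of \<open>U t x\<close>, and extensions are unique by
  \<open>strip_uniqueness\<close>. Pairing with the transposed functional \<open>\<psi>\<close>
  makes the side with \<open>U t\<close> holomorphic in \<open>z\<close>.\<close>

lemma extension_translate:
  assumes F: "extension F x" and z: "z \<in> closed_strip"
  shows "F (z + complex_of_real t) = U t (F z)"
proof (rule eqI)
  fix \<phi>
  obtain \<psi> where \<psi>: "\<And>x. p (U t x) \<phi> = p x \<psi>" using transpose[OF in_B_sigma] by blast
  have cont: "continuous_on closed_strip (\<lambda>w. p (F w) \<eta>)" and
    hol: "(\<lambda>w. p (F w) \<eta>) holomorphic_on open_strip" for \<eta>
    using F by (auto simp: extension_def)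
  have "p (F (z + complex_of_real t)) \<phi> - p (F z) \<psi> = 0"
  proof (rule strip_uniqueness[OF _ _ _ z])
    have "continuous_on closed_strip (\<lambda>w. p (F (w + complex_of_real t)) \<phi>)"
      by (rule continuous_on_compose2[OF cont[of \<phi>]]) (auto intro!: continuous_intros)
    then show "continuous_on closed_strip (\<lambda>w. p (F (w + complex_of_real t)) \<phi> - p (F w) \<psi>)"
      by (intro continuous_on_diff cont)
    have "((\<lambda>w. p (F w) \<phi>) \<circ> (\<lambda>w. w + complex_of_real t)) holomorphic_on open_strip"
      by (rule holomorphic_on_compose_gen[OF _ hol[of \<phi>]]) (auto intro!: holomorphic_intros)
    then show "(\<lambda>w. p (F (w + complex_of_real t)) \<phi> - p (F w) \<psi>) holomorphic_on open_strip"
      using hol by (intro holomorphic_on_diff) (auto simp: o_def)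
    fix s
    have "p (F (complex_of_real s + complex_of_real t)) \<phi> = p (U t (U s x)) \<phi>"
      using F by (simp add: extension_def flip: of_real_add U_add) (simp add: add.commute)
    then show "p (F (complex_of_real s + complex_of_real t)) \<phi> - p (F (complex_of_real s)) \<psi> = 0"
      using F by (simp add: extension_def \<psi>)
  qed
  then show "p (F (z + complex_of_real t)) \<phi> = p (U t (F z)) \<phi>" by (simp add: \<psi>)
qed

text \<open>Horizontal translation acts by isometries, so it suffices to bound \<open>F\<close> on
  the segment from 0 to \<open>\<i>\<close>; there weak continuity gives a bound for each functional
  and \<open>uniform_boundedness\<close> a norm bound.\<close>

lemma extension_bounded:
  assumes F: "extension F x"
  shows "\<exists>B. \<forall>w\<in>closed_strip. norm (F w) \<le> B"
proof -
  have "\<exists>B. \<forall>x\<in>(\<lambda>y. F (Complex 0 y)) ` {0..1}. cmod (p x \<phi>) \<le> B" for \<phi>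
  proof -
    have "continuous_on {0..1} (\<lambda>y. p (F (Complex 0 y)) \<phi>)"
      using F by (intro strip_vertical_continuous) (simp add: extension_def)
    then have "bounded ((\<lambda>y. p (F (Complex 0 y)) \<phi>) ` {0..1})"
      by (intro compact_imp_bounded compact_continuous_image) auto
    then show ?thesis by (auto simp: bounded_iff)
  qed
  from uniform_boundedness[OF this] obtain B where
    B: "\<And>y. y \<in> {0..1} \<Longrightarrow> norm (F (Complex 0 y)) \<le> B" by blast
  have "norm (F w) \<le> B" if w: "w \<in> closed_strip" for w
  proof -
    have "w = Complex 0 (Im w) + complex_of_real (Re w)" by (simp add: complex_eq_iff)
    then have "F w = U (Re w) (F (Complex 0 (Im w)))"
      using extension_translate[OF F, of "Complex 0 (Im w)" "Re w"] w by simp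
    then show ?thesis using B[of "Im w"] w by (simp add: isometry)
  qed
  then show ?thesis by blast
qed

lemma analytic_generator_add:
  assumes "(x, y) \<in> analytic_generator p U" "(x', y') \<in> analytic_generator p U"
  shows "(x + x', y + y') \<in> analytic_generator p U"
  using assms extension_add unfolding analytic_generator_iff by fastforce

lemma analytic_generator_scaleC:
  assumes "(x, y) \<in> analytic_generator p U"
  shows "(a *\<^sub>C x, a *\<^sub>C y) \<in> analytic_generator p U"
  using assms extension_scaleC unfolding analytic_generator_iff by fastforce

lemma analytic_generator_diff:
  assumes "(x, y) \<in> analytic_generator p U" "(x', y') \<in> analytic_generator p U"
  shows "(x - x', y - y') \<in> analytic_generator p U"
  using analytic_generator_add[OF assms(1) analytic_generator_scaleC[OF assms(2), of "- 1"]]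
  by (simp add: scaleC_minus_left scaleC_one)

text \<open>By translation the values on the upper line are \<open>U s (F \<i>)\<close>, so both
  boundary functions are orbits; boundedness of \<open>F\<close> admits the scalar formula.\<close>

lemma extension_reproducing_formula:
  fixes \<phi> :: 'f
  assumes \<mu>: "\<mu> \<notin> \<real>\<^sub>\<le>\<^sub>0" and F: "extension F x" and z: "z \<in> open_strip"
  defines "J \<equiv> \<lambda>x. strip_transform \<mu> (\<lambda>s. p (U s x) \<phi>)"
  shows "p (F z) \<phi> = \<mu> * (J x z + \<mu> * J x (z - \<i>)) + (J (F \<i>) z + \<mu> * J (F \<i>) (z - \<i>))"
proof -
  obtain B where B: "\<And>w. w \<in> closed_strip \<Longrightarrow> norm (F w) \<le> B" using extension_bounded[OF F] by blast
  have "cmod (p (F w) \<phi>) \<le> B * norm \<phi>" if "w \<in> closed_strip" for w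
    using norm_bound[of "F w" \<phi>] mult_right_mono[OF B[OF that], of "norm \<phi>"] by simp
  moreover have "F (complex_of_real s + \<i>) = U s (F \<i>)" for s
    using extension_translate[OF F, of \<i> s] by (simp add: add.commute)
  moreover have "F (complex_of_real s) = U s x" for s using F by (simp add: extension_def)
  ultimately show ?thesis
    using strip_reproducing_formula[OF \<mu>, of "\<lambda>w. p (F w) \<phi>" "B * norm \<phi>" z] F z
    unfolding J_def extension_def by simp
qed

text \<open>The transform of the upper orbit is \<open>- \<mu>\<close> times that of the lower one,
  so the two halves of the reproducing formula cancel. Thus \<open>F\<close> vanishes in the open
  strip, and at 0 by continuity.\<close>

lemma eigenvector_zero:
  assumes \<mu>: "\<mu> \<notin> \<real>\<^sub>\<le>\<^sub>0" and y: "(y, (- \<mu>) *\<^sub>C y) \<in> analytic_generator p U"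
  shows "y = 0"
proof (rule eqI)
  fix \<phi>
  from y obtain F where F: "extension F y" "F \<i> = (- \<mu>) *\<^sub>C y"
    by (auto simp: analytic_generator_iff)
  have J: "strip_transform \<mu> (\<lambda>s. p (U s ((- \<mu>) *\<^sub>C y)) \<phi>) z = - \<mu> * strip_transform \<mu> (\<lambda>s. p (U s y) \<phi>) z" for z
  proof -
    have "strip_kernel \<mu> (complex_of_real s - z) * p (U s ((- \<mu>) *\<^sub>C y)) \<phi> =
        - \<mu> * (strip_kernel \<mu> (complex_of_real s - z) * p (U s y) \<phi>)" for s
      by (simp add: U_linear left_simps)
    then show ?thesis unfolding strip_transform_def by (simp only: Bochner_Integration.integral_mult_right_zero)
  qed
  have "p (F 0) \<phi> = 0"
  proof (rule strip_zero_boundary[of "\<lambda>w. p (F w) \<phi>"])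
    show "continuous_on closed_strip (\<lambda>w. p (F w) \<phi>)" using F by (simp add: extension_def)
    show "p (F w) \<phi> = 0" if "w \<in> open_strip" for w
      using extension_reproducing_formula[OF \<mu> F(1) that, of \<phi>] by (simp add: F(2) J algebra_simps)
  qed
  moreover have "F 0 = y"
    using F(1) zero by (auto simp: extension_def dest: spec[of _ 0])
  ultimately show "p y \<phi> = p 0 \<phi>" by (simp add: left_simps)
qed

end

section \<open>The weak integral \<open>Q \<mu>\<close> and the resolvent vector in the
  graph\<close>

context krein_isometry_group
begin

lemma orbit_transform:
  assumes \<mu>: "\<mu> \<notin> \<real>\<^sub>\<le>\<^sub>0" and z: "\<bar>Im z\<bar> < 1"
  shows "\<exists>y. (\<forall>\<phi>. p y \<phi> = strip_transform \<mu> (\<lambda>s. p (U s x) \<phi>) z) \<and>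
    norm y \<le> norm x * (LINT s|lborel. cmod (strip_kernel \<mu> (complex_of_real s - z)))"
proof -
  have "\<mu> \<noteq> 0" using \<mu> by auto
  show ?thesis
    using weak_integral[OF krein_left sigma_continuous[of x] _
        strip_kernel_translate_continuous[OF \<open>\<mu> \<noteq> 0\<close> z] strip_kernel_translate_integrable[OF \<mu> z], of "norm x"]
    by (auto simp: isometry strip_transform_def)
qed

lemma orbit_transform_integrable:
  assumes "\<mu> \<notin> \<real>\<^sub>\<le>\<^sub>0" and "\<bar>Im z\<bar> < 1"
  shows "integrable lborel (\<lambda>s. strip_kernel \<mu> (complex_of_real s - z) * p (U s x) \<phi>)"
  by (rule strip_transform_integrable[OF assms orbit_continuous orbit_bounded])

lemma F_kernel_orbit_integrable:
  assumes \<mu>: "\<mu> \<notin> \<real>\<^sub>\<le>\<^sub>0"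
  shows "integrable lborel (\<lambda>t. F_kernel \<mu> t * p (U t x) \<phi>)"
  using orbit_transform_integrable[OF \<mu>, of 0 x \<phi>] by (simp add: F_kernel_eq_strip_kernel[OF \<mu>])

lemma F_kernel_integrable:
  assumes \<mu>: "\<mu> \<notin> \<real>\<^sub>\<le>\<^sub>0"
  shows "integrable lborel (F_kernel \<mu>)"
proof -
  have "F_kernel \<mu> = (\<lambda>t. strip_kernel \<mu> (complex_of_real t - 0))"
    by (simp add: F_kernel_eq_strip_kernel[OF \<mu>] fun_eq_iff)
  then show ?thesis using strip_kernel_translate_integrable[OF \<mu>, of 0] by simp
qed

abbreviation Q :: "complex \<Rightarrow> 'x \<Rightarrow> 'x" where
  "Q \<mu> \<equiv> sigma_integral p (F_kernel \<mu>) U"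

text \<open>Resolves the definite description: existence comes from the Krein property, uniqueness
  from the pairing separating points.\<close>

lemma Q_weak_integral:
  assumes \<mu>: "\<mu> \<notin> \<real>\<^sub>\<le>\<^sub>0"
  shows "p (Q \<mu> x) \<phi> = (LINT t|lborel. F_kernel \<mu> t * p (U t x) \<phi>)"
    and "norm (Q \<mu> x) \<le> norm x * (LINT t|lborel. cmod (F_kernel \<mu> t))"
proof -
  obtain y where y: "\<And>\<phi>. p y \<phi> = (LINT t|lborel. F_kernel \<mu> t * p (U t x) \<phi>)"
    "norm y \<le> norm x * (LINT t|lborel. cmod (F_kernel \<mu> t))"
    using orbit_transform[OF \<mu>, of 0 x]
    by (auto simp: strip_transform_def F_kernel_eq_strip_kernel[OF \<mu>])
  have "Q \<mu> x = y"
    unfolding sigma_integral_def by (rule the_equality) (auto simp: y intro: eqI)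
  with y show "p (Q \<mu> x) \<phi> = (LINT t|lborel. F_kernel \<mu> t * p (U t x) \<phi>)"
    and "norm (Q \<mu> x) \<le> norm x * (LINT t|lborel. cmod (F_kernel \<mu> t))" by simp_all
qed

lemma Q_strip_transform:
  assumes \<mu>: "\<mu> \<notin> \<real>\<^sub>\<le>\<^sub>0"
  shows "p (Q \<mu> x) \<phi> = strip_transform \<mu> (\<lambda>s. p (U s x) \<phi>) 0"
  by (simp add: Q_weak_integral(1)[OF \<mu>] strip_transform_def F_kernel_eq_strip_kernel[OF \<mu>])

lemma Q_linear:
  assumes \<mu>: "\<mu> \<notin> \<real>\<^sub>\<le>\<^sub>0"
  shows "Q \<mu> (x + y) = Q \<mu> x + Q \<mu> y" "Q \<mu> (a *\<^sub>C x) = a *\<^sub>C Q \<mu> x"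
proof -
  note int = F_kernel_orbit_integrable[OF \<mu>]
  show "Q \<mu> (x + y) = Q \<mu> x + Q \<mu> y"
  proof (rule eqI)
    fix \<phi>
    have "p (Q \<mu> (x + y)) \<phi> = (LINT t|lborel. F_kernel \<mu> t * p (U t x) \<phi> + F_kernel \<mu> t * p (U t y) \<phi>)"
      by (simp add: Q_weak_integral(1)[OF \<mu>] U_linear left_simps distrib_left)
    also have "\<dots> = p (Q \<mu> x + Q \<mu> y) \<phi>"
      unfolding left_simps Q_weak_integral(1)[OF \<mu>] by (rule Bochner_Integration.integral_add[OF int int])
    finally show "p (Q \<mu> (x + y)) \<phi> = p (Q \<mu> x + Q \<mu> y) \<phi>" .
  qed
  show "Q \<mu> (a *\<^sub>C x) = a *\<^sub>C Q \<mu> x"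
  proof (rule eqI)
    fix \<phi>
    have "F_kernel \<mu> t * p (U t (a *\<^sub>C x)) \<phi> = a * (F_kernel \<mu> t * p (U t x) \<phi>)" for t
      by (simp add: U_linear left_simps)
    then show "p (Q \<mu> (a *\<^sub>C x)) \<phi> = p (a *\<^sub>C Q \<mu> x) \<phi>"
      unfolding left_simps Q_weak_integral(1)[OF \<mu>] by (simp only: Bochner_Integration.integral_mult_right_zero)
  qed
qed

lemma Q_bounded_linear:
  assumes \<mu>: "\<mu> \<notin> \<real>\<^sub>\<le>\<^sub>0"
  shows "bounded_linear (Q \<mu>)"
  by (rule bounded_linear_intro[OF Q_linear(1)[OF \<mu>] _ Q_weak_integral(2)[OF \<mu>]])
    (simp add: scaleR_scaleC Q_linear(2)[OF \<mu>])

text \<open>The transpose of \<open>Q \<mu>\<close> is the weak integral of the transposed group; it exists by the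
  Krein property of the flipped pair.\<close>

lemma Q_in_B_sigma:
  assumes \<mu>: "\<mu> \<notin> \<real>\<^sub>\<le>\<^sub>0"
  shows "Q \<mu> \<in> B_sigma p"
proof (rule B_sigmaI)
  show "clinear (Q \<mu>)" using Q_linear[OF \<mu>] by (intro clinearI) auto
  show "bounded_linear (Q \<mu>)" by (rule Q_bounded_linear[OF \<mu>])
  fix \<phi>
  interpret flip: dual_pair "\<lambda>\<phi> x. p x \<phi>" by (rule flip)
  have "\<exists>\<psi>. \<forall>x. p (U t x) \<phi> = p x \<psi>" for t by (rule transpose[OF in_B_sigma])
  then obtain V where V: "\<And>t x. p (U t x) \<phi> = p x (V t)" by metis
  have "\<mu> \<noteq> 0" using \<mu> by auto
  have "\<exists>\<psi>. (\<forall>x. integrable lborel (\<lambda>t. strip_kernel \<mu> (complex_of_real t - 0) * p x (V t)) \<and>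
      p x \<psi> = (LINT t|lborel. strip_kernel \<mu> (complex_of_real t - 0) * p x (V t))) \<and>
      norm \<psi> \<le> norm \<phi> * (LINT t|lborel. cmod (strip_kernel \<mu> (complex_of_real t - 0)))"
  proof (rule flip.weak_integral[OF krein_right])
    show "continuous_map euclidean (sigma (\<lambda>\<phi> x. p x \<phi>)) V"
      using orbit_continuous by (simp add: continuous_map_sigma_iff flip: V)
    show "norm (V t) \<le> norm \<phi>" for t
    proof (rule flip.norm_leI)
      fix x :: 'x assume x: "norm x \<le> 1"
      have "cmod (p x (V t)) \<le> norm x * norm \<phi>" using orbit_bounded[of t x \<phi>] by (simp add: V)
      also have "\<dots> \<le> norm \<phi>" using mult_right_mono[OF x, of "norm \<phi>"] by simp
      finally show "cmod (p x (V t)) \<le> norm \<phi>" .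
    qed
    show "continuous_on UNIV (\<lambda>t. strip_kernel \<mu> (complex_of_real t - 0))"
      by (rule strip_kernel_translate_continuous[OF \<open>\<mu> \<noteq> 0\<close>]) simp
    show "integrable lborel (\<lambda>t. strip_kernel \<mu> (complex_of_real t - 0))"
      by (rule strip_kernel_translate_integrable[OF \<mu>]) simp
  qed
  then obtain \<psi> where "\<And>x. p x \<psi> = (LINT t|lborel. strip_kernel \<mu> (complex_of_real t - 0) * p x (V t))"
    by blast
  then have "\<forall>x. p (Q \<mu> x) \<phi> = p x \<psi>"
    by (simp add: Q_strip_transform[OF \<mu>] strip_transform_def V)
  then show "\<exists>\<psi>. \<forall>x. p (Q \<mu> x) \<phi> = p x \<psi>" by blast
qed

text \<open>The transpose carries \<open>U t\<close> inside the weak integral; the group law and the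
  substitution of \<open>s - t\<close> for \<open>s\<close> then move the translation onto the
  kernel.\<close>

lemma U_Q:
  assumes \<mu>: "\<mu> \<notin> \<real>\<^sub>\<le>\<^sub>0"
  shows "p (U t (Q \<mu> x)) \<phi> = strip_transform \<mu> (\<lambda>s. p (U s x) \<phi>) (complex_of_real t)"
proof -
  obtain \<psi> where \<psi>: "\<And>x. p (U t x) \<phi> = p x \<psi>" using transpose[OF in_B_sigma] by blast
  have "p (U t (Q \<mu> x)) \<phi> = (LINT s|lborel. strip_kernel \<mu> (complex_of_real s) * p (U (t + s) x) \<phi>)"
    by (simp add: \<psi> Q_strip_transform[OF \<mu>] strip_transform_def U_add)
  also have "\<dots> = strip_transform \<mu> (\<lambda>s. p (U s x) \<phi>) (complex_of_real t)"
    unfolding strip_transform_def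
    by (subst lborel_integral_real_affine[where c = 1 and t = t]) simp_all
  finally show ?thesis .
qed

text \<open>The extension of the orbit of \<open>(U\<^sub>i + \<mu>)\<inverse> x = x / \<mu> - Q x - Q x' / \<mu>\<close> is given by one formula
  on the strip without its upper boundary line and by another one on the strip without its lower
  boundary line; the two agree in the interior by the reproducing formula.\<close>

lemma resolvent_in_graph:
  assumes \<mu>: "\<mu> \<notin> \<real>\<^sub>\<le>\<^sub>0" and x: "(x, x') \<in> analytic_generator p U"
  shows "((1 / \<mu>) *\<^sub>C x - Q \<mu> x - (1 / \<mu>) *\<^sub>C Q \<mu> x', \<mu> *\<^sub>C Q \<mu> x + Q \<mu> x') \<in> analytic_generator p U"
proof -
  have \<mu>0: "\<mu> \<noteq> 0" using \<mu> by auto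
  obtain F where F: "extension F x" "F \<i> = x'" using x by (auto simp: analytic_generator_iff)
  \<comment> \<open>A vector whose pairings are the scalar transforms; it exists for
    \<open>\<bar>Im z\<bar> < 1\<close> by \<open>orbit_transform\<close>, and only such
    \<open>z\<close> are used.\<close>
  define W where "W = (\<lambda>u z. SOME y. \<forall>\<phi>. p y \<phi> = strip_transform \<mu> (\<lambda>s. p (U s u) \<phi>) z)"
  have W: "p (W u z) \<phi> = strip_transform \<mu> (\<lambda>s. p (U s u) \<phi>) z" if "\<bar>Im z\<bar> < 1" for u z \<phi>
  proof -
    have "\<exists>y. \<forall>\<phi>. p y \<phi> = strip_transform \<mu> (\<lambda>s. p (U s u) \<phi>) z"
      using orbit_transform[OF \<mu> that] by blast
    from someI_ex[OF this] show ?thesis by (simp add: W_def)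
  qed
  \<comment> \<open>The first expression uses transforms at \<open>z\<close>, which stops short of
    \<open>Im z = 1\<close>; on the upper line the second one uses them at \<open>z - \<i>\<close>.
    \<open>L\<close> and \<open>V\<close> are the pairings of the two expressions.\<close>
  define H where "H = (\<lambda>z. if Im z < 1 then (1 / \<mu>) *\<^sub>C F z - W x z - (1 / \<mu>) *\<^sub>C W x' z
    else \<mu> *\<^sub>C W x (z - \<i>) + W x' (z - \<i>))"
  define L where "L = (\<lambda>\<phi> z. p (F z) \<phi> / \<mu> - strip_transform \<mu> (\<lambda>s. p (U s x) \<phi>) z
    - strip_transform \<mu> (\<lambda>s. p (U s x') \<phi>) z / \<mu>)"
  define V where "V = (\<lambda>\<phi> z. \<mu> * strip_transform \<mu> (\<lambda>s. p (U s x) \<phi>) (z - \<i>)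
    + strip_transform \<mu> (\<lambda>s. p (U s x') \<phi>) (z - \<i>))"
  have hol: "strip_transform \<mu> (\<lambda>s. p (U s u) \<phi>) holomorphic_on {z. \<bar>Im z\<bar> < 1}" for u \<phi>
    by (rule strip_transform_holomorphic[OF \<mu> orbit_continuous orbit_bounded])
  have contF: "continuous_on closed_strip (\<lambda>z. p (F z) \<phi>)" and
    holF: "(\<lambda>z. p (F z) \<phi>) holomorphic_on open_strip" for \<phi>
    using F(1) by (auto simp: extension_def)
  have HL: "p (H z) \<phi> = L \<phi> z" if "0 \<le> Im z" "Im z < 1" for z \<phi>
    using that by (simp add: H_def L_def left_simps W)
  have HV: "p (H z) \<phi> = V \<phi> z" if z: "0 < Im z" "Im z \<le> 1" for z \<phi>
  proof (cases "Im z < 1")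
    case True
    have "L \<phi> z = V \<phi> z"
      using extension_reproducing_formula[OF \<mu> F(1), of z \<phi>] True z \<mu>0
      by (simp add: L_def V_def F(2) field_simps)
    then show ?thesis using HL True z by simp
  qed (use z in \<open>simp add: H_def V_def left_simps W\<close>)
  have contL: "continuous_on {z. 0 \<le> Im z \<and> Im z < 1} (L \<phi>)" for \<phi>
    unfolding L_def using \<mu>0
    by (intro continuous_intros continuous_on_subset[OF contF]
        continuous_on_subset[OF holomorphic_on_imp_continuous_on[OF hol]]) auto
  have contV: "continuous_on {z. 0 < Im z \<and> Im z \<le> 1} (V \<phi>)" for \<phi>
    unfolding V_def
    by (intro continuous_intros continuous_on_compose2[OF holomorphic_on_imp_continuous_on[OF hol]]) auto
  have holL: "L \<phi> holomorphic_on open_strip" for \<phi>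
    unfolding L_def using \<mu>0
    by (intro holomorphic_intros holF holomorphic_on_subset[OF hol]) auto
  have "extension H ((1 / \<mu>) *\<^sub>C x - Q \<mu> x - (1 / \<mu>) *\<^sub>C Q \<mu> x')"
    unfolding extension_def
  proof (intro conjI allI)
    fix \<phi>
    let ?A = "{z. 0 \<le> Im z \<and> Im z < 1}" and ?B = "{z. 0 < Im z \<and> Im z \<le> 1}"
    have AB: "?A \<union> ?B = closed_strip" by auto
    \<comment> \<open>Both pieces are relatively open in the closed strip, which is why continuity
      on each of them glues.\<close>
    have A: "openin (top_of_set (?A \<union> ?B)) ?A"
      unfolding AB openin_open by (intro exI[of _ "{z. Im z < 1}"]) (auto simp: open_halfspace_Im_lt)
    have B: "openin (top_of_set (?A \<union> ?B)) ?B"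
      unfolding AB openin_open by (intro exI[of _ "{z. 0 < Im z}"]) (auto simp: open_halfspace_Im_gt)
    have "continuous_on ?A (\<lambda>w. p (H w) \<phi>)"
      using contL[of \<phi>] by (rule continuous_on_eq) (simp add: HL)
    moreover have "continuous_on ?B (\<lambda>w. p (H w) \<phi>)"
      using contV[of \<phi>] by (rule continuous_on_eq) (simp add: HV)
    ultimately show "continuous_on closed_strip (\<lambda>w. p (H w) \<phi>)"
      using continuous_on_Un_local_open[OF A B] unfolding AB by blast
    show "(\<lambda>w. p (H w) \<phi>) holomorphic_on open_strip"
      using holL[of \<phi>] by (rule holomorphic_transform) (simp add: HL)
  next
    fix t
    show "H (complex_of_real t) = U t ((1 / \<mu>) *\<^sub>C x - Q \<mu> x - (1 / \<mu>) *\<^sub>C Q \<mu> x')"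
    proof (rule eqI)
      fix \<phi>
      have U_diff: "U t (a - b) = U t a - U t b" for a b
        using U_linear(1)[of t a "(- 1) *\<^sub>C b"] U_linear(2)[of t "- 1" b] by (simp add: scaleC_minus_left scaleC_one)
      have "F (complex_of_real t) = U t x" using F(1) by (simp add: extension_def)
      then show "p (H (complex_of_real t)) \<phi> = p (U t ((1 / \<mu>) *\<^sub>C x - Q \<mu> x - (1 / \<mu>) *\<^sub>C Q \<mu> x')) \<phi>"
        by (simp add: HL L_def U_diff U_linear left_simps U_Q[OF \<mu>])
    qed
  qed
  \<comment> \<open>At \<open>\<i>\<close> the second expression evaluates both transforms at 0,
    where they are pairings with values of \<open>Q \<mu>\<close>.\<close>
  moreover have "H \<i> = \<mu> *\<^sub>C Q \<mu> x + Q \<mu> x'"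
    by (rule eqI) (simp add: HV V_def left_simps Q_strip_transform[OF \<mu>])
  ultimately show ?thesis by (auto simp: analytic_generator_iff)
qed

end

section \<open>Resolvent and spectrum of the ampliation\<close>

theorem corollary2p4:
  fixes p :: "'x::complex_banach \<Rightarrow> 'f::complex_banach \<Rightarrow> complex"
    and U :: "real \<Rightarrow> 'x \<Rightarrow> 'x"
  assumes "dual_pair p"
    and "krein_property p"
    and "krein_property (\<lambda>\<phi> x. p x \<phi>)"
    and "sigma_isometry_group p U"
  defines "G \<equiv> analytic_generator p U"
  defines "\<Delta> \<equiv> ampliation G"
  defines "Q \<equiv> (\<lambda>\<mu>. sigma_integral p (F_kernel \<mu>) U)"
  defines "M \<equiv> (\<lambda>\<mu>. block_op
      (\<lambda>x. - Q \<mu> x + (1 / \<mu>) *\<^sub>C x) (\<lambda>x. - (1 / \<mu>) *\<^sub>C Q \<mu> x)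
      (\<lambda>x. \<mu> *\<^sub>C Q \<mu> x)             (\<lambda>x. Q \<mu> x))"
  shows "spectrum G \<Delta> \<subseteq> \<real>\<^sub>\<ge>\<^sub>0 \<and>
    (\<forall>\<mu>. \<mu> \<notin> \<real>\<^sub>\<le>\<^sub>0 \<longrightarrow>
       (\<forall>t. integrable lborel (\<lambda>E. exp (complex_of_real E * (1 + \<i> * complex_of_real t)) /
                                    (exp (complex_of_real E) + \<mu>)\<^sup>2)) \<and>
       (\<forall>t. t \<noteq> 0 \<longrightarrow> F_kernel \<mu> t = F_closed \<mu> t) \<and>
       (F_closed \<mu> \<longlongrightarrow> F_kernel \<mu> 0) (at 0) \<and>
       integrable lborel (F_kernel \<mu>) \<and>
       (\<forall>x \<phi>. integrable lborel (\<lambda>t. F_kernel \<mu> t * p (U t x) \<phi>) \<and>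
              p (Q \<mu> x) \<phi> = (LINT t|lborel. F_kernel \<mu> t * p (U t x) \<phi>)) \<and>
       Q \<mu> \<in> B_sigma p \<and>
       M \<mu> ` G \<subseteq> G \<and>
       is_resolvent G \<Delta> (- \<mu>) (M \<mu>))"
proof -
  interpret krein_isometry_group p U
    unfolding krein_isometry_group_def krein_isometry_group_axioms_def using assms(1-4) by blast
  note G_add = analytic_generator_add[folded G_def] and G_scale = analytic_generator_scaleC[folded G_def]
    and G_diff = analytic_generator_diff[folded G_def]
  have resolvent: "is_resolvent G \<Delta> (- \<mu>) (M \<mu>) \<and> M \<mu> ` G \<subseteq> G" if \<mu>: "\<mu> \<notin> \<real>\<^sub>\<le>\<^sub>0" for \<mu>
  proof -
    have \<mu>0: "\<mu> \<noteq> 0" using \<mu> by auto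
    have Q_eq: "sigma_integral p (F_kernel \<mu>) U = Q \<mu>" by (simp add: Q_def)
    note Q_lin = Q_linear[OF \<mu>, unfolded Q_eq]
    have M: "M \<mu> (x, x') = ((1 / \<mu>) *\<^sub>C x - Q \<mu> x - (1 / \<mu>) *\<^sub>C Q \<mu> x', \<mu> *\<^sub>C Q \<mu> x + Q \<mu> x')" for x x'
      by (simp add: M_def block_op_def scaleC_minus_left)
    have MG: "M \<mu> u \<in> G" if "u \<in> G" for u
      using that resolvent_in_graph[OF \<mu>] by (cases u) (simp add: M G_def Q_def)
    have S: "x - \<mu> *\<^sub>C fst (M \<mu> (x, x')) = snd (M \<mu> (x, x'))" for x x'
      using \<mu>0 by (simp add: M scaleC_diff_right scaleC_scaleC scaleC_one)
    \<comment> \<open>The four memberships in \<open>ampliation\<close> reduce to two: by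
      \<open>S\<close> the pair of first components is \<open>M \<mu> u\<close> itself, and the pair
      of second components is \<open>u - \<mu> *\<^sub>C M \<mu> u\<close>. Both lie in
      \<open>G\<close>.\<close>
    have right: "(M \<mu> u, u - \<mu> *\<^sub>C M \<mu> u) \<in> \<Delta>" if u: "u \<in> G" for u
    proof -
      obtain x x' R S' where xx: "u = (x, x')" and RS: "M \<mu> u = (R, S')" by (metis surj_pair)
      have R: "(R, S') \<in> G" using MG[OF u] RS by simp
      have d: "(x - \<mu> *\<^sub>C R, x' - \<mu> *\<^sub>C S') \<in> G"
        using G_diff[OF u[unfolded xx] G_scale[OF R]] .
      have "x - \<mu> *\<^sub>C R = S'" using S[of x x'] RS xx by simp
      with R d show ?thesis
        unfolding RS unfolding xx \<Delta>_def ampliation_def by (simp add: scaleC_prod_def)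
    qed
    \<comment> \<open>In each component, \<open>v\<close> and
      \<open>M \<mu> (w + \<mu> *\<^sub>C v)\<close> solve the same equation, so their difference
      \<open>d\<close> satisfies \<open>U_i d = - \<mu> d\<close> and vanishes by
      \<open>eigenvector_zero\<close>.\<close>
    have unique: "v = M \<mu> (w + \<mu> *\<^sub>C v)" if vw: "(v, w) \<in> \<Delta>" for v w
    proof -
      let ?u = "w + \<mu> *\<^sub>C v"
      obtain y y' z z' where v: "v = (y, y')" and w: "w = (z, z')" by (metis surj_pair)
      have G: "(y, y') \<in> G" "(z, z') \<in> G" "(y, z) \<in> G" "(y', z') \<in> G"
        using vw unfolding \<Delta>_def ampliation_def v w by auto
      have uG: "?u \<in> G" using G_add[OF G(2) G_scale[OF G(1)]] by (simp add: v w scaleC_prod_def)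
      obtain R S' where RS: "M \<mu> ?u = (R, S')" by (metis surj_pair)
      have r: "(R, z + \<mu> *\<^sub>C y - \<mu> *\<^sub>C R) \<in> G" "(S', z' + \<mu> *\<^sub>C y' - \<mu> *\<^sub>C S') \<in> G"
        using right[OF uG] unfolding RS unfolding \<Delta>_def ampliation_def v w by (auto simp: scaleC_prod_def)
      have "y - R = 0" using G_diff[OF G(3) r(1)]
        by (intro eigenvector_zero[OF \<mu>]) (simp add: G_def scaleC_minus_left scaleC_diff_right algebra_simps)
      moreover have "y' - S' = 0" using G_diff[OF G(4) r(2)]
        by (intro eigenvector_zero[OF \<mu>]) (simp add: G_def scaleC_minus_left scaleC_diff_right algebra_simps)
      ultimately have "v = (R, S')" by (simp add: v)
      then show ?thesis unfolding RS .
    qed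
    \<comment> \<open>The inclusion from right to left is surjectivity of
      \<open>\<Delta> + \<mu>\<close> onto \<open>G\<close>, supplied by \<open>right\<close>; the
      other one rests on injectivity, supplied by \<open>unique\<close>.\<close>
    have inv: "(minus_scalar \<Delta> (- \<mu>))\<inverse> = {(u, M \<mu> u) |u. u \<in> G}"
    proof (intro set_eqI iffI)
      fix a assume "a \<in> (minus_scalar \<Delta> (- \<mu>))\<inverse>"
      then obtain v w where vw: "(v, w) \<in> \<Delta>" and a: "a = (w + \<mu> *\<^sub>C v, v)"
        by (auto simp: minus_scalar_def scaleC_minus_left)
      have "v \<in> G" "w \<in> G" using vw by (auto simp: \<Delta>_def ampliation_def)
      then have "w + \<mu> *\<^sub>C v \<in> G"
        using G_add G_scale by (cases v, cases w) (simp add: scaleC_prod_def)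
      moreover have "a = (w + \<mu> *\<^sub>C v, M \<mu> (w + \<mu> *\<^sub>C v))"
        by (simp only: a unique[OF vw, symmetric])
      ultimately show "a \<in> {(u, M \<mu> u) |u. u \<in> G}" by blast
    next
      fix a assume "a \<in> {(u, M \<mu> u) |u. u \<in> G}"
      then obtain u where u: "u \<in> G" and a: "a = (u, M \<mu> u)" by blast
      have "(M \<mu> u, (u - \<mu> *\<^sub>C M \<mu> u) - (- \<mu>) *\<^sub>C M \<mu> u) \<in> minus_scalar \<Delta> (- \<mu>)"
        using right[OF u] unfolding minus_scalar_def by blast
      then show "a \<in> (minus_scalar \<Delta> (- \<mu>))\<inverse>" by (simp add: a scaleC_minus_left)
    qed
    have add: "M \<mu> (u + v) = M \<mu> u + M \<mu> v" for u v
      by (cases u, cases v) (simp add: M Q_lin scaleC_add_right algebra_simps)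
    have scale: "M \<mu> (c *\<^sub>C u) = c *\<^sub>C M \<mu> u" for c u
      by (cases u) (simp add: M Q_lin scaleC_prod_def scaleC_diff_right scaleC_add_right scaleC_scaleC mult.commute)
    have "\<exists>K. \<forall>u. norm (M \<mu> u) \<le> K * norm u"
    proof -
      note bl = Q_bounded_linear[OF \<mu>, unfolded Q_eq] and sc = bounded_linear_scaleC_right
      have "bounded_linear (\<lambda>u. ((1 / \<mu>) *\<^sub>C fst u - Q \<mu> (fst u) - (1 / \<mu>) *\<^sub>C Q \<mu> (snd u),
          \<mu> *\<^sub>C Q \<mu> (fst u) + Q \<mu> (snd u)))"
        by (intro bounded_linear_Pair bounded_linear_add bounded_linear_sub
            bounded_linear_compose[OF sc] bounded_linear_compose[OF bl] bounded_linear_fst bounded_linear_snd)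
      moreover have "M \<mu> u = ((1 / \<mu>) *\<^sub>C fst u - Q \<mu> (fst u) - (1 / \<mu>) *\<^sub>C Q \<mu> (snd u),
          \<mu> *\<^sub>C Q \<mu> (fst u) + Q \<mu> (snd u))" for u
        by (cases u) (simp add: M)
      ultimately have "bounded_linear (M \<mu>)" by presburger
      then obtain K where "\<And>u. norm (M \<mu> u) \<le> norm u * K" using bounded_linear.bounded by blast
      then show ?thesis by (intro exI[of _ K]) (simp add: mult.commute)
    qed
    then show ?thesis
      unfolding is_resolvent_def using inv MG add scale by blast
  qed
  have "spectrum G \<Delta> \<subseteq> \<real>\<^sub>\<ge>\<^sub>0"
  proof
    fix z assume z: "z \<in> spectrum G \<Delta>"
    show "z \<in> \<real>\<^sub>\<ge>\<^sub>0"
    proof (rule ccontr)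
      assume "z \<notin> \<real>\<^sub>\<ge>\<^sub>0"
      \<comment> \<open>The resolvent at \<open>z\<close> is the one constructed for
        \<open>\<mu> = - z\<close>, and reflection exchanges the two closed half-lines.\<close>
      then have "- z \<notin> \<real>\<^sub>\<le>\<^sub>0" by (auto simp: complex_nonneg_Reals_iff complex_nonpos_Reals_iff)
      from resolvent[OF this] z show False by (auto simp: spectrum_def)
    qed
  qed
  moreover have "(F_closed \<mu> \<longlongrightarrow> F_kernel \<mu> 0) (at 0)" if "\<mu> \<notin> \<real>\<^sub>\<le>\<^sub>0" for \<mu>
    using F_closed_tendsto[of \<mu>] that by (cases "\<mu> = 0") (auto simp: F_kernel_eq_strip_kernel)
  ultimately show ?thesis
    using resolvent by (intro conjI allI impI) (simp_all add: exp_kernel_integrable F_kernel_eq_F_closed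
        F_kernel_integrable F_kernel_orbit_integrable Q_weak_integral(1) Q_in_B_sigma Q_def)
qed

end
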